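(* Let $G$ be a connected graph and $\mathcal{B}$ its set of blocks. Let $<_{\mathrm{rev}}$ be the degree reverse lexicographic term order on $S=\mathbb{K}[x_{\mathcal{A}}\mid\mathcal{A}\subseteq\mathcal{B},\ G[\mathcal{A}]\text{ connected}]$ with respect to any linear extension of the partial order on variables given by $x_{\mathcal{A}_1}<x_{\mathcal{A}_2}$ if and only if $\mathcal{A}_1\supsetneq\mathcal{A}_2$. Then $$\mathcal{G}=\{x_{\mathcal{A}_1}x_{\mathcal{A}_2}-x_{\mathcal{A}_1\cap\mathcal{A}_2}x_{\mathcal{A}_1\cup\mathcal{A}_2}\mid \mathcal{A}_1,\mathcal{A}_2\subseteq\mathcal{B},\ \mathcal{A}_1\nsubseteq\mathcal{A}_2,\ \mathcal{A}_2\nsubseteq\mathcal{A}_1,\ G[\mathcal{A}_1],G[\mathcal{A}_2],G[\mathcal{A}_1\cup\mathcal{A}_2]\text{ connected}\}$$ is a Gröbner basis of the toric ideal $I_{\mathrm{CBP}(G)}$ with respect to $<_{\mathrm{rev}}$, and the leading monomial of each listed binomial is $x_{\mathcal{A}_1}x_{\mathcal{A}_2}$. In particular, $\mathrm{CBP}(G)$ has a regular unimodular triangulation.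
   Context: Graphs are finite, simple and undirected. A connected graph is 2-connected if it has at least three vertices and remains connected after deleting any single vertex. A bridge is an edge whose deletion increases the number of connected components. A block of $G$ is a maximal 2-connected subgraph of $G$ or a bridge together with its two end vertices; $\mathcal{B}$ denotes the set of blocks of $G$. For $\mathcal{A}\subseteq\mathcal{B}$ let $G[\mathcal{A}]=\bigcup_{B\in\mathcal{A}}B$ (the empty graph counts as connected), and let $\chi^{\mathcal{A}}\in\{0,1\}^{\mathcal{B}}$ be the incidence vector of $\mathcal{A}$. The connected blocks polytope is $\mathrm{CBP}(G)=\mathrm{conv}\{\chi^{\mathcal{A}}\mid \mathcal{A}\subseteq\mathcal{B},\ G[\mathcal{A}]\text{ connected}\}\subseteq\mathbb{R}^{\mathcal{B}}$; its lattice points are exactly the vectors $\chi^{\mathcal{A}}$ with $G[\mathcal{A}]$ connected. $\mathbb{K}$ is a field. For a lattice polytope $P\subseteq\mathbb{R}^d$, the toric ideal $I_P$ is the kernel of the $\mathbb{K}$-algebra homomorphism $\mathbb{K}[x_\alpha\mid\alpha\in P\cap\mathbb{Z}^d]\to\mathbb{K}[y_1^{\pm1},\dots,y_d^{\pm1},s]$, $x_\alpha\mapsto y^\alpha s$. For $P=\mathrm{CBP}(G)$ write $x_{\mathcal{A}}$ for $x_{\chi^{\mathcal{A}}}$. The degree reverse lexicographic order induced by $x_1<\dots<x_n$ is: $x^\alpha<_{\mathrm{rev}}x^\beta$ iff $\sum\alpha_i<\sum\beta_i$, or $\sum\alpha_i=\sum\beta_i$ and $\alpha_\ell>\beta_\ell$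 for $\ell=\min\{j\mid\alpha_j\ne\beta_j\}$. The initial term of a polynomial is its largest monomial; a set of generators of an ideal $I$ is a Gröbner basis if the initial terms of its elements generate the ideal generated by all initial terms of elements of $I$. A triangulation of a lattice polytope is unimodular if all its maximal simplices are lattice simplices of normalized volume 1. *)

theory Defs
  imports "HOL-Analysis.Analysis" "HOL-Library.Poly_Mapping"
begin

section \<open>Graphs and blocks\<close>

text \<open>A graph is the pair of its vertex set and its edge set. Pairs rather than a record are used
  because the type of graphs on a finite vertex type is then itself of class finite, so that it can
  index the coordinates of a vector.\<close>

type_synonym 'v graph = "'v set \<times> 'v set set"

abbreviation verts :: "'v graph \<Rightarrow> 'v set" where "verts \<equiv> fst"
abbreviation edges :: "'v graph \<Rightarrow> 'v set set" where "edges \<equiv> snd"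

definition simple_graph :: "'v graph \<Rightarrow> bool" where
  "simple_graph G \<longleftrightarrow> finite (verts G) \<and> (\<forall>e\<in>edges G. e \<subseteq> verts G \<and> card e = 2)"

definition subgraph_of :: "'v graph \<Rightarrow> 'v graph \<Rightarrow> bool" where
  "subgraph_of H G \<longleftrightarrow> simple_graph H \<and> verts H \<subseteq> verts G \<and> edges H \<subseteq> edges G"

definition reach :: "'v graph \<Rightarrow> 'v rel" where
  "reach G = {(u, v). u \<in> verts G \<and> v \<in> verts G \<and> (u, v) \<in> {(x, y). {x, y} \<in> edges G}\<^sup>*}"

text \<open>The empty graph is connected.\<close>

definition connected_graph :: "'v graph \<Rightarrow> bool" where
  "connected_graph G \<longleftrightarrow> (\<forall>u\<in>verts G. \<forall>v\<in>verts G. (u, v) \<in> reach G)"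

definition components :: "'v graph \<Rightarrow> 'v set set" where
  "components G = verts G // reach G"

definition del_vert :: "'v graph \<Rightarrow> 'v \<Rightarrow> 'v graph" where
  "del_vert G v = (verts G - {v}, {e \<in> edges G. v \<notin> e})"

definition del_edge :: "'v graph \<Rightarrow> 'v set \<Rightarrow> 'v graph" where
  "del_edge G e = (verts G, edges G - {e})"

definition two_connected :: "'v graph \<Rightarrow> bool" where
  "two_connected G \<longleftrightarrow>
     connected_graph G \<and> card (verts G) \<ge> 3 \<and> (\<forall>v\<in>verts G. connected_graph (del_vert G v))"

definition bridge :: "'v graph \<Rightarrow> 'v set \<Rightarrow> bool" where
  "bridge G e \<longleftrightarrow> e \<in> edges G \<and> card (components (del_edge G e)) > card (components G)"

definition blocks :: "'v graph \<Rightarrow> 'v graph set" where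
  "blocks G =
     {H. subgraph_of H G \<and> two_connected H \<and>
         (\<forall>H'. subgraph_of H' G \<and> two_connected H' \<and> subgraph_of H H' \<longrightarrow> H' = H)}
     \<union> {(e, {e}) | e. bridge G e}"

definition graph_Union :: "'v graph set \<Rightarrow> 'v graph" where
  "graph_Union A = (\<Union>H\<in>A. verts H, \<Union>H\<in>A. edges H)"

definition connected_families :: "'v graph \<Rightarrow> 'v graph set set" where
  "connected_families G = {A. A \<subseteq> blocks G \<and> connected_graph (graph_Union A)}"


section \<open>Lattice points and the connected blocks polytope\<close>

definition rvec :: "int ^ 'n \<Rightarrow> real ^ 'n" where
  "rvec a = (\<chi> i. real_of_int (a $ i))"

definition lattice_points :: "(real ^ 'n) set \<Rightarrow> (int ^ 'n) set" where
  "lattice_points P = {a. rvec a \<in> P}"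

text \<open>The coordinates are indexed by all graphs on the vertex type, and the space of real vectors
  indexed by the blocks of \<open>G\<close> is the coordinate subspace of the vectors vanishing outside
  \<open>blocks G\<close>.\<close>

definition inc :: "('v::finite) graph set \<Rightarrow> int ^ 'v graph" where
  "inc A = (\<chi> H. if H \<in> A then 1 else 0)"

definition CBP :: "('v::finite) graph \<Rightarrow> (real ^ 'v graph) set" where
  "CBP G = convex hull {rvec (inc A) | A. A \<in> connected_families G}"


section \<open>Polynomials, toric ideals and Groebner bases\<close>

text \<open>Monomials are finitely supported exponent functions on the variables. The polynomial ring in
  a given set \<open>X\<close> of variables is the subring \<open>polys X\<close>.\<close>

type_synonym 'x monom = "'x \<Rightarrow>\<^sub>0 nat"
type_synonym ('x, 'k) mpoly = "('x \<Rightarrow>\<^sub>0 nat) \<Rightarrow>\<^sub>0 'k"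

definition polys :: "'x set \<Rightarrow> ('x, 'k::field) mpoly set" where
  "polys X = {f. \<forall>m\<in>Poly_Mapping.keys f. Poly_Mapping.keys m \<subseteq> X}"

definition mvar :: "'x \<Rightarrow> ('x, 'k::field) mpoly" where
  "mvar x = Poly_Mapping.single (Poly_Mapping.single x 1) 1"

text \<open>The ideal of \<open>polys X\<close> generated by \<open>F\<close>.\<close>

definition ideal_gen :: "'x set \<Rightarrow> ('x, 'k::field) mpoly set \<Rightarrow> ('x, 'k) mpoly set" where
  "ideal_gen X F =
     {\<Sum>f\<in>T. q f * f | T q. finite T \<and> T \<subseteq> F \<and> (\<forall>f\<in>T. q f \<in> polys X)}"

text \<open>The homomorphism sending the variable of a lattice point \<open>a\<close> to \<open>y\<^sup>a s\<close>. An
  exponent of the target ring is a pair of the exponent vector of \<open>y\<close> and the exponent of \<open>s\<close>.\<close>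

definition toric_map ::
  "(int ^ 'n, 'k::field) mpoly \<Rightarrow> ((int ^ 'n) \<times> nat) \<Rightarrow>\<^sub>0 'k" where
  "toric_map f =
     (\<Sum>m\<in>Poly_Mapping.keys f.
        Poly_Mapping.single 0 (Poly_Mapping.lookup f m) *
        (\<Prod>a\<in>Poly_Mapping.keys m. Poly_Mapping.single (a, 1) 1 ^ Poly_Mapping.lookup m a))"

definition toric_ideal :: "(real ^ 'n) set \<Rightarrow> (int ^ 'n, 'k::field) mpoly set" where
  "toric_ideal P = {f \<in> polys (lattice_points P). toric_map f = 0}"

definition mdeg :: "'x monom \<Rightarrow> nat" where
  "mdeg m = (\<Sum>x\<in>Poly_Mapping.keys m. Poly_Mapping.lookup m x)"

text \<open>Here \<open>(x, y) \<in> r\<close> means that the variable \<open>x\<close> is smaller than the variable \<open>y\<close>; the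
  variable \<open>l\<close> is the smallest one in which the two monomials differ.\<close>

definition degrevlex_less :: "'x rel \<Rightarrow> 'x monom \<Rightarrow> 'x monom \<Rightarrow> bool" where
  "degrevlex_less r m m' \<longleftrightarrow>
     mdeg m < mdeg m' \<or>
     mdeg m = mdeg m' \<and>
       (\<exists>l. Poly_Mapping.lookup m l > Poly_Mapping.lookup m' l \<and>
            (\<forall>j. Poly_Mapping.lookup m j \<noteq> Poly_Mapping.lookup m' j \<and> j \<noteq> l \<longrightarrow> (l, j) \<in> r))"

text \<open>The initial term is the largest monomial, without its coefficient. It is meaningful only for
  nonzero polynomials.\<close>

definition initial_term :: "'x rel \<Rightarrow> ('x, 'k::field) mpoly \<Rightarrow> ('x, 'k) mpoly" where
  "initial_term r f =
     Poly_Mapping.single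
       (THE m. m \<in> Poly_Mapping.keys f \<and>
          (\<forall>m'\<in>Poly_Mapping.keys f. m' \<noteq> m \<longrightarrow> degrevlex_less r m' m)) 1"

definition groebner_basis ::
  "'x set \<Rightarrow> 'x rel \<Rightarrow> ('x, 'k::field) mpoly set \<Rightarrow> ('x, 'k) mpoly set \<Rightarrow> bool" where
  "groebner_basis X r F I \<longleftrightarrow>
     F \<subseteq> I \<and> ideal_gen X F = I \<and>
     ideal_gen X (initial_term r ` (F - {0})) = ideal_gen X (initial_term r ` (I - {0}))"

definition block_binomial ::
  "('v::finite) graph set \<Rightarrow> 'v graph set \<Rightarrow> (int ^ 'v graph, 'k::field) mpoly" where
  "block_binomial A1 A2 =
     mvar (inc A1) * mvar (inc A2) - mvar (inc (A1 \<inter> A2)) * mvar (inc (A1 \<union> A2))"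

definition block_pair :: "'v graph \<Rightarrow> 'v graph set \<Rightarrow> 'v graph set \<Rightarrow> bool" where
  "block_pair G A1 A2 \<longleftrightarrow>
     A1 \<in> connected_families G \<and> A2 \<in> connected_families G \<and> A1 \<union> A2 \<in> connected_families G \<and>
     \<not> A1 \<subseteq> A2 \<and> \<not> A2 \<subseteq> A1"


section \<open>Regular unimodular triangulations\<close>

definition triangulation_of :: "(real ^ 'n) set set \<Rightarrow> (real ^ 'n) set \<Rightarrow> bool" where
  "triangulation_of T P \<longleftrightarrow> simplicial_complex T \<and> \<Union>T = P"

text \<open>The faces of \<open>Q\<close> (including the empty one) on which a functional whose last coefficient is
  \<open>1\<close> attains its minimum; these are the faces of \<open>Q\<close> visible from below.\<close>

definition lower_faces :: "((real ^ 'n) \<times> real) set \<Rightarrow> ((real ^ 'n) \<times> real) set set" where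
  "lower_faces Q =
     {Q \<inter> {z. (c, 1) \<bullet> z = b} | c b. Q \<subseteq> {z. (c, 1) \<bullet> z \<ge> b}}"

text \<open>A triangulation is regular if it is the projection of the lower faces of the polytope obtained
  by lifting each lattice point of \<open>P\<close> to some height.\<close>

definition regular_triangulation :: "(real ^ 'n) set set \<Rightarrow> (real ^ 'n) set \<Rightarrow> bool" where
  "regular_triangulation T P \<longleftrightarrow>
     triangulation_of T P \<and>
     (\<exists>w :: int ^ 'n \<Rightarrow> real.
        T = (\<lambda>F. fst ` F) ` lower_faces (convex hull {(rvec a, w a) | a. a \<in> lattice_points P}))"

definition lattice_simplex :: "(real ^ 'n) set \<Rightarrow> bool" where
  "lattice_simplex S \<longleftrightarrow> (\<exists>C. C \<subseteq> range rvec \<and> \<not> affine_dependent C \<and> S = convex hull C)"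

text \<open>For a set \<open>S\<close> of vectors vanishing outside the coordinate set \<open>D\<close>, the Lebesgue measure of
  \<open>S\<close> inside the space of real vectors indexed by \<open>D\<close>, multiplied by the factorial of its
  dimension.\<close>

definition normalized_volume :: "'n set \<Rightarrow> (real ^ 'n) set \<Rightarrow> real" where
  "normalized_volume D S =
     fact (card D) * measure (Pi\<^sub>M D (\<lambda>_. lborel)) ((\<lambda>x. \<lambda>i\<in>D. x $ i) ` S)"

text \<open>For a triangulation of a polytope that is full-dimensional in the space of real vectors
  indexed by \<open>D\<close>. This applies to \<open>CBP G\<close> with \<open>D = blocks G\<close>, since \<open>CBP G\<close> contains the
  origin and the unit vectors of all blocks.\<close>

definition unimodular :: "'n set \<Rightarrow> (real ^ 'n) set set \<Rightarrow> bool" where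
  "unimodular D T \<longleftrightarrow>
     (\<forall>S\<in>T. (\<forall>S'\<in>T. S \<subseteq> S' \<longrightarrow> S' = S) \<longrightarrow> lattice_simplex S \<and> normalized_volume D S = 1)"

end

theory Submission
  imports Defs
begin

text \<open>Two connected block families meet in a connected family, because a path between two vertices of
  \<open>G[A]\<close> cannot leave \<open>G[A]\<close>: it would close up to a cycle, and every cycle lies in a single block.
  Call two connected families incompatible if they are incomparable and their union is connected.
  A point of the cone over the polytope determines its decomposition into pairwise compatible
  families, since an inclusion-maximal set carrying different weights in two decompositions would be
  covered by smaller sets, and a connected set covered by a compatible family lies in one of its
  members. Hence distinct standard monomials have distinct images under the toric map, while
  replacing an incompatible pair by its intersection and union decreases the monomial; this gives
  the Groebner basis. Geometrically, the height \<open>- (card A)\<^sup>2\<close> is strictly submodular on incompatible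
  pairs, so the lower faces of the lifted polytope are exactly the hulls of compatible families. In a
  maximal compatible family every nonempty member has a private block outside its proper
  submembers, every block is private to some member, and the resulting incidence matrix is
  unitriangular, whence unimodularity.\<close>

section \<open>Compatible families of connected sets\<close>

text \<open>Graphs enter the combinatorics through few properties: single blocks are connected,
  connected families are closed under intersection, two that touch have a connected union, and a
  connected family cannot be split without a touching pair. A locale isolates them, and the algebra
  and geometry are developed from there. One quantity serves both halves, the sum of squared sizes:
  uncrossing \<open>A\<close> and \<open>B\<close> raises it by twice the product of the sizes of
  \<open>A - B\<close> and \<open>B - A\<close>. As a bounded integer potential it makes the
  rewriting of monomials terminate; negated, it is the height. The obstacle to regularity is the
  passage from local to global. A functional can be prescribed only on one maximal compatible
  family, yet it must be controlled at every connected family. Prescribing the values 0 and 1 and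
  using the gap 2 of the height, an induction over the number of conflicts gives a value of at least
  1 everywhere else. Volume is a Lebesgue measure on a product space, so unimodularity is derived
  from a measure-preserving shear instead of a determinant.\<close>

lemma finite_subset_maximal:
  fixes M :: "'a set set"
  assumes "finite M" "A \<in> M"
  obtains K where "K \<in> M" "A \<subseteq> K" "\<forall>D\<in>M. K \<subseteq> D \<longrightarrow> K = D"
  using finite_has_maximal2[OF assms] by metis

lemma finite_subset_minimal:
  fixes M :: "'a set set"
  assumes "finite M" "A \<in> M"
  obtains K where "K \<in> M" "K \<subseteq> A" "\<forall>D\<in>M. D \<subseteq> K \<longrightarrow> K = D"
  using finite_has_minimal2[OF assms] by metis

text \<open>\<open>E\<close> stands for the blocks, \<open>F\<close> for the connected families,
  \<open>adj\<close> for sharing a vertex. The assumptions make \<open>F\<close> consist of the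
  empty set and the sets that induce connected subgraphs of \<open>adj\<close>;
  \<open>Int_in\<close> is the tree-like feature of blocks, which fails for vertex sets of a
  cycle.\<close>

locale connected_family =
  fixes E :: "'a set" and F :: "'a set set" and adj :: "'a \<Rightarrow> 'a \<Rightarrow> bool"
  assumes finite_E: "finite E"
    and F_subset: "A \<in> F \<Longrightarrow> A \<subseteq> E"
    and empty_in: "{} \<in> F"
    and full_in: "E \<in> F"
    and singleton_in: "e \<in> E \<Longrightarrow> {e} \<in> F"
    and Int_in: "A \<in> F \<Longrightarrow> B \<in> F \<Longrightarrow> A \<inter> B \<in> F"
    and adj_refl: "e \<in> E \<Longrightarrow> adj e e"
    and adj_sym: "adj x y \<Longrightarrow> adj y x"
    and Un_in: "A \<in> F \<Longrightarrow> B \<in> F \<Longrightarrow> x \<in> A \<Longrightarrow> y \<in> B \<Longrightarrow> adj x y \<Longrightarrow> A \<union> B \<in> F"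
    and crossing: "A \<in> F \<Longrightarrow> A \<inter> C \<noteq> {} \<Longrightarrow> \<not> A \<subseteq> C \<Longrightarrow> \<exists>x\<in>A \<inter> C. \<exists>y\<in>A - C. adj x y"
begin

lemma finite_F: "finite F"
  using finite_E F_subset by (meson Pow_iff finite_Pow_iff finite_subset subsetI)

lemma finite_member: "A \<in> F \<Longrightarrow> finite A"
  using finite_E F_subset finite_subset by blast

lemma Un_in_meet: "A \<in> F \<Longrightarrow> B \<in> F \<Longrightarrow> A \<inter> B \<noteq> {} \<Longrightarrow> A \<union> B \<in> F"
  using Un_in adj_refl F_subset by blast

text \<open>Converse of \<open>Un_in\<close>: apply \<open>crossing\<close> to the union with
  \<open>C = A\<close>. If \<open>B\<close> lies inside \<open>A\<close>, an element of
  \<open>B\<close> is paired with itself, which is where \<open>A \<subseteq> E\<close>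
  enters.\<close>

lemma Un_in_adjE:
  assumes "A \<union> B \<in> F" "A \<noteq> {}" "B \<noteq> {}" "A \<subseteq> E"
  obtains x y where "x \<in> A" "y \<in> B" "adj x y"
proof (cases "B \<subseteq> A")
  case True
  then show ?thesis using assms adj_refl that by blast
next
  case False
  then show ?thesis using crossing[OF assms(1), of A] assms(2) that by blast
qed

definition incompatible :: "'a set \<Rightarrow> 'a set \<Rightarrow> bool" where
  "incompatible A B \<longleftrightarrow> \<not> A \<subseteq> B \<and> \<not> B \<subseteq> A \<and> A \<union> B \<in> F"

definition compatible :: "'a set set \<Rightarrow> bool" where
  "compatible N \<longleftrightarrow> N \<subseteq> F \<and> (\<forall>A\<in>N. \<forall>B\<in>N. \<not> incompatible A B)"

definition maximal_compatible :: "'a set set \<Rightarrow> bool" where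
  "maximal_compatible N \<longleftrightarrow> compatible N \<and> (\<forall>A\<in>F. compatible (insert A N) \<longrightarrow> A \<in> N)"

lemma incompatible_sym: "incompatible A B \<longleftrightarrow> incompatible B A"
  by (auto simp: incompatible_def Un_commute)

lemma compatible_subset: "compatible N \<Longrightarrow> M \<subseteq> N \<Longrightarrow> compatible M"
  by (auto simp: compatible_def)

lemma compatible_finite: "compatible N \<Longrightarrow> finite N"
  using finite_F finite_subset by (auto simp: compatible_def)

lemma compatible_insert:
  "compatible (insert A N) \<longleftrightarrow> compatible N \<and> A \<in> F \<and> (\<forall>B\<in>N. \<not> incompatible A B)"
proof -
  have "\<not> incompatible A A" by (simp add: incompatible_def)
  then show ?thesis unfolding compatible_def using incompatible_sym[of _ A] by blast
qed

lemma maximal_compatibleE: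
  assumes "maximal_compatible N" "A \<in> F" "A \<notin> N"
  obtains B where "B \<in> N" "incompatible A B"
  using assms unfolding maximal_compatible_def compatible_insert by blast

text \<open>Take a maximal member \<open>C\<close> meeting \<open>A\<close>. If \<open>A\<close>
  leaves \<open>C\<close>, it does so through an adjacent pair, and the member \<open>D\<close>
  covering the outer element has a connected union with \<open>C\<close>. Compatibility nests
  \<open>C\<close> and \<open>D\<close>, which contradicts the maximality of \<open>C\<close> or the
  choice of the outer element.\<close>

lemma compatible_cover:
  assumes N: "compatible N" and A: "A \<in> F" "A \<noteq> {}" "A \<subseteq> \<Union>N"
  shows "\<exists>C\<in>N. A \<subseteq> C"
proof -
  let ?M = "{C \<in> N. A \<inter> C \<noteq> {}}"
  have "finite ?M" "?M \<noteq> {}" using compatible_finite[OF N] A by auto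
  then obtain A' where "A' \<in> ?M" by blast
  with \<open>finite ?M\<close> obtain C where C: "C \<in> ?M" and "\<forall>D\<in>?M. C \<subseteq> D \<longrightarrow> C = D"
    by (rule finite_subset_maximal)
  then have max: "\<And>D. D \<in> ?M \<Longrightarrow> C \<subseteq> D \<Longrightarrow> C = D" by metis
  have "A \<subseteq> C"
  proof (rule ccontr)
    assume "\<not> A \<subseteq> C"
    then obtain x y where xy: "x \<in> A \<inter> C" "y \<in> A - C" "adj x y"
      using crossing[OF A(1), of C] C by auto
    then obtain D where D: "D \<in> N" "y \<in> D" using A by auto
    have "C \<union> D \<in> F" using Un_in[of C D x y] xy D C N by (auto simp: compatible_def)
    then have "C \<subseteq> D \<or> D \<subseteq> C" using N C D by (auto simp: compatible_def incompatible_def)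
    then show False using max[of D] D xy by auto
  qed
  then show ?thesis using C by auto
qed

text \<open>Otherwise the members not containing \<open>A\<close> would cover \<open>A\<close>, and
  by \<open>compatible_cover\<close> one of them would contain it.\<close>

lemma compatible_private:
  assumes "compatible N" "A \<in> N" "A \<noteq> {}"
  shows "\<exists>e\<in>A. \<forall>B\<in>N. e \<in> B \<longrightarrow> A \<subseteq> B"
proof (rule ccontr)
  assume "\<not> ?thesis"
  then have "A \<subseteq> \<Union>{B \<in> N. \<not> A \<subseteq> B}" by blast
  then show False
    using compatible_cover[of "{B \<in> N. \<not> A \<subseteq> B}" A] compatible_subset[OF assms(1)] assms
    by (auto simp: compatible_def)
qed

text \<open>If \<open>u A > v A\<close>, equality of the marginals at each \<open>e\<close> in
  \<open>A\<close> forces \<open>v\<close> to put positive weight on a member that contains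
  \<open>e\<close> but not all of \<open>A\<close>. These members cover \<open>A\<close>, so one of
  them contains it. Exchanging \<open>u\<close> and \<open>v\<close> gives the opposite
  inequality.\<close>

lemma weights_le_aux:
  fixes u v :: "'a set \<Rightarrow> real"
  assumes u: "\<And>B. B \<in> F \<Longrightarrow> 0 \<le> u B" and v: "\<And>B. B \<in> F \<Longrightarrow> 0 \<le> v B"
    and cv: "compatible {B \<in> F. v B \<noteq> 0}"
    and eq: "\<And>e. e \<in> E \<Longrightarrow> (\<Sum>B\<in>{B \<in> F. e \<in> B}. u B) = (\<Sum>B\<in>{B \<in> F. e \<in> B}. v B)"
    and A: "A \<in> F" "A \<noteq> {}"
    and above: "\<And>B. B \<in> F \<Longrightarrow> A \<subset> B \<Longrightarrow> u B = v B"
  shows "u A \<le> v A"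
proof (rule ccontr)
  assume less: "\<not> u A \<le> v A"
  have split: "(\<Sum>B\<in>{B \<in> F. e \<in> B}. w B)
      = (\<Sum>B\<in>{B \<in> F. A \<subset> B}. w B) + w A + (\<Sum>B\<in>{B \<in> F. e \<in> B \<and> \<not> A \<subseteq> B}. w B)"
    if "e \<in> A" for e and w :: "'a set \<Rightarrow> real"
  proof -
    have "{B \<in> F. e \<in> B} = ({B \<in> F. A \<subset> B} \<union> {A}) \<union> {B \<in> F. e \<in> B \<and> \<not> A \<subseteq> B}"
      using that A by auto
    then show ?thesis
      using finite_F by (simp only:) (subst sum.union_disjoint, auto)+
  qed
  have "A \<subseteq> \<Union>{B \<in> F. v B \<noteq> 0 \<and> \<not> A \<subseteq> B}"
  proof
    fix e assume e: "e \<in> A"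
    have "(\<Sum>B\<in>{B \<in> F. A \<subset> B}. u B) = (\<Sum>B\<in>{B \<in> F. A \<subset> B}. v B)"
      using above by (intro sum.cong) auto
    moreover have "0 \<le> (\<Sum>B\<in>{B \<in> F. e \<in> B \<and> \<not> A \<subseteq> B}. u B)"
      using u by (intro sum_nonneg) auto
    ultimately have pos: "0 < (\<Sum>B\<in>{B \<in> F. e \<in> B \<and> \<not> A \<subseteq> B}. v B)"
      using eq[of e] split[OF e, of u] split[OF e, of v] less e A F_subset by force
    show "e \<in> \<Union>{B \<in> F. v B \<noteq> 0 \<and> \<not> A \<subseteq> B}"
    proof (rule ccontr)
      assume "\<not> ?thesis"
      then have "(\<Sum>B\<in>{B \<in> F. e \<in> B \<and> \<not> A \<subseteq> B}. v B) = 0" by (intro sum.neutral) blast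
      then show False using pos by linarith
    qed
  qed
  then have "\<exists>C\<in>{B \<in> F. v B \<noteq> 0 \<and> \<not> A \<subseteq> B}. A \<subseteq> C"
    by (intro compatible_cover compatible_subset[OF cv] A) auto
  then show False by auto
qed

lemma weights_unique_nonempty:
  fixes u v :: "'a set \<Rightarrow> real"
  assumes u: "\<And>B. B \<in> F \<Longrightarrow> 0 \<le> u B" and v: "\<And>B. B \<in> F \<Longrightarrow> 0 \<le> v B"
    and cu: "compatible {B \<in> F. u B \<noteq> 0}" and cv: "compatible {B \<in> F. v B \<noteq> 0}"
    and eq: "\<And>e. e \<in> E \<Longrightarrow> (\<Sum>B\<in>{B \<in> F. e \<in> B}. u B) = (\<Sum>B\<in>{B \<in> F. e \<in> B}. v B)"
    and A: "A \<in> F" "A \<noteq> {}"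
  shows "u A = v A"
proof (rule ccontr)
  assume ne: "u A \<noteq> v A"
  let ?M = "{B \<in> F. B \<noteq> {} \<and> u B \<noteq> v B}"
  have "finite ?M" "A \<in> ?M" using finite_F A ne by auto
  then obtain C where C: "C \<in> ?M" and "\<forall>D\<in>?M. C \<subseteq> D \<longrightarrow> C = D"
    by (rule finite_subset_maximal)
  then have max: "\<And>D. D \<in> ?M \<Longrightarrow> C \<subseteq> D \<Longrightarrow> C = D" by metis
  have "u D = v D" if "D \<in> F" "C \<subset> D" for D using max[of D] that by blast
  then have "u C \<le> v C" "v C \<le> u C"
    using weights_le_aux[of u v C] weights_le_aux[of v u C] u v cu cv eq C by auto
  then show False using C by auto
qed

text \<open>The marginals do not see \<open>{}\<close>; its weight is what the others leave of the
  total. For monomials the total is the exponent of \<open>s\<close>, for convex combinations it is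
  1.\<close>

lemma weights_unique:
  fixes u v :: "'a set \<Rightarrow> real"
  assumes u: "\<And>B. B \<in> F \<Longrightarrow> 0 \<le> u B" and v: "\<And>B. B \<in> F \<Longrightarrow> 0 \<le> v B"
    and cu: "compatible {B \<in> F. u B \<noteq> 0}" and cv: "compatible {B \<in> F. v B \<noteq> 0}"
    and eq: "\<And>e. e \<in> E \<Longrightarrow> (\<Sum>B\<in>{B \<in> F. e \<in> B}. u B) = (\<Sum>B\<in>{B \<in> F. e \<in> B}. v B)"
    and total: "sum u F = sum v F"
    and A: "A \<in> F"
  shows "u A = v A"
proof -
  have ne: "u B = v B" if "B \<in> F" "B \<noteq> {}" for B
    by (rule weights_unique_nonempty[OF u v cu cv eq that])
  have "sum w F = w {} + sum w (F - {{}})" for w :: "'a set \<Rightarrow> real"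
    using finite_F empty_in by (simp add: sum.remove)
  moreover have "sum u (F - {{}}) = sum v (F - {{}})" using ne by (intro sum.cong) auto
  ultimately have "u {} = v {}" using total by simp
  then show ?thesis using ne A by (cases "A = {}") auto
qed

text \<open>The positive and the negative part of \<open>w\<close> are nonnegative weights with
  equal marginals and supports inside \<open>N\<close>, so they agree on nonempty sets; as their
  supports are disjoint, both vanish there.\<close>

lemma weights_independent:
  fixes w :: "'a set \<Rightarrow> real"
  assumes N: "compatible N" and A: "A \<in> N" "A \<noteq> {}"
    and eq: "\<And>e. e \<in> E \<Longrightarrow> (\<Sum>B\<in>{B \<in> N. e \<in> B}. w B) = 0"
  shows "w A = 0"
proof -
  have NF: "N \<subseteq> F" using N by (simp add: compatible_def)
  let ?u = "\<lambda>B. if B \<in> N then max (w B) 0 else 0" and ?v = "\<lambda>B. if B \<in> N then max (- w B) 0 else 0"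
  have "?u A = ?v A"
  proof (rule weights_unique_nonempty)
    show "compatible {B \<in> F. ?u B \<noteq> 0}" "compatible {B \<in> F. ?v B \<noteq> 0}"
      by (rule compatible_subset[OF N], auto)+
    show "(\<Sum>B\<in>{B \<in> F. e \<in> B}. ?u B) = (\<Sum>B\<in>{B \<in> F. e \<in> B}. ?v B)" if "e \<in> E" for e
    proof -
      have "(\<Sum>B\<in>{B \<in> F. e \<in> B}. ?u B) - (\<Sum>B\<in>{B \<in> F. e \<in> B}. ?v B)
          = (\<Sum>B\<in>{B \<in> F. e \<in> B}. if B \<in> N then w B else 0)"
        unfolding sum_subtractf[symmetric] by (intro sum.cong) auto
      also have "\<dots> = (\<Sum>B\<in>{B \<in> N. e \<in> B}. w B)"
        using finite_F NF by (intro sum.mono_neutral_cong_right) auto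
      finally show ?thesis using eq[OF that] by simp
    qed
  qed (use A NF in auto)
  then show ?thesis using A by (auto simp: max_def split: if_splits)
qed

section \<open>Maximal compatible families\<close>

lemma extend_maximal:
  assumes "compatible N"
  obtains M where "N \<subseteq> M" "maximal_compatible M"
proof -
  have "finite {M. compatible M}"
    using finite_F by (auto simp: compatible_def intro: finite_subset[of _ "Pow F"])
  then obtain M where M: "N \<subseteq> M" "compatible M"
    and max: "\<And>K. compatible K \<Longrightarrow> M \<subseteq> K \<Longrightarrow> M = K"
    using finite_has_maximal2[of "{M. compatible M}" N] assms by auto
  then have "maximal_compatible M"
    unfolding maximal_compatible_def by (metis insertI1 subset_insertI)
  then show ?thesis using M that by auto
qed

lemma maximal_compatible_empty: "maximal_compatible N \<Longrightarrow> {} \<in> N"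
  using maximal_compatibleE[OF _ empty_in] by (auto simp: incompatible_def)

lemma maximal_compatible_full:
  assumes N: "maximal_compatible N"
  shows "E \<in> N"
proof (rule ccontr)
  assume "E \<notin> N"
  then obtain B where "B \<in> N" "incompatible E B" using maximal_compatibleE[OF N full_in] by blast
  then show False using N F_subset[of B]
    by (auto simp: maximal_compatible_def compatible_def incompatible_def)
qed

lemma component_exists:
  assumes S: "S \<subseteq> E" and e: "e \<in> S"
  obtains K where "K \<in> F" "e \<in> K" "K \<subseteq> S"
    "\<And>A. A \<in> F \<Longrightarrow> A \<subseteq> S \<Longrightarrow> K \<union> A \<in> F \<Longrightarrow> A \<subseteq> K"
proof -
  let ?M = "{K \<in> F. e \<in> K \<and> K \<subseteq> S}"
  have "finite ?M" "{e} \<in> ?M" using finite_F singleton_in S e by auto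
  then obtain K where K: "K \<in> ?M" and "\<forall>D\<in>?M. K \<subseteq> D \<longrightarrow> K = D"
    by (rule finite_subset_maximal)
  then have max: "\<And>D. D \<in> ?M \<Longrightarrow> K \<subseteq> D \<Longrightarrow> K = D" by metis
  show ?thesis
  proof (rule that)
    show "A \<subseteq> K" if "A \<in> F" "A \<subseteq> S" "K \<union> A \<in> F" for A
      using max[of "K \<union> A"] that K by auto
  qed (use K in auto)
qed

text \<open>If \<open>e\<close> were missed by the private elements, let \<open>A\<close> be the smallest member containing
  \<open>e\<close>. The component of \<open>e\<close> in \<open>A\<close> minus its private element could be added to \<open>N\<close>.\<close>

lemma maximal_compatible_private:
  assumes N: "maximal_compatible N" and e: "e \<in> E"
    and b: "\<And>A. A \<in> N \<Longrightarrow> A \<noteq> {} \<Longrightarrow> b A \<in> A \<and> (\<forall>B\<in>N. b A \<in> B \<longrightarrow> A \<subseteq> B)"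
  shows "\<exists>A\<in>N - {{}}. b A = e"
proof (rule ccontr)
  assume no: "\<not> ?thesis"
  have cN: "compatible N" using N by (simp add: maximal_compatible_def)
  let ?M = "{A \<in> N. e \<in> A}"
  have "finite ?M" "E \<in> ?M" using compatible_finite[OF cN] maximal_compatible_full[OF N] e by auto
  then obtain A where A: "A \<in> ?M" and "\<forall>D\<in>?M. D \<subseteq> A \<longrightarrow> A = D"
    by (rule finite_subset_minimal)
  then have min: "\<And>D. D \<in> ?M \<Longrightarrow> D \<subseteq> A \<Longrightarrow> A = D" by metis
  have AF: "A \<in> F" using A cN by (auto simp: compatible_def)
  have bA: "b A \<in> A" "b A \<noteq> e" using b[of A] A no by auto
  obtain K where K: "K \<in> F" "e \<in> K" "K \<subseteq> A - {b A}"
    and Kmax: "\<And>B. B \<in> F \<Longrightarrow> B \<subseteq> A - {b A} \<Longrightarrow> K \<union> B \<in> F \<Longrightarrow> B \<subseteq> K"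
    using component_exists[of "A - {b A}" e] A bA F_subset[OF AF] by blast
  have "K \<notin> N" using min[of K] K bA by auto
  then obtain B where B: "B \<in> N" "incompatible K B" using maximal_compatibleE[OF N K(1)] by blast
  have BF: "B \<in> F" using B cN by (auto simp: compatible_def)
  have "B \<noteq> {}" using B by (auto simp: incompatible_def)
  \<comment> \<open>\<open>B\<close> conflicts with \<open>K\<close>, so it touches \<open>K\<close>
    and hence \<open>A\<close>. Being compatible with \<open>A\<close>, it is nested with
    \<open>A\<close>, and each way of nesting contradicts the choice of \<open>K\<close>.\<close>
  have "A \<union> B \<in> F"
  proof -
    have "K \<union> B \<in> F" "A \<inter> (K \<union> B) \<noteq> {}" using B K by (auto simp: incompatible_def)
    then have "A \<union> (K \<union> B) \<in> F" using Un_in_meet[OF AF] by blast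
    moreover have "A \<union> (K \<union> B) = A \<union> B" using K by auto
    ultimately show ?thesis by simp
  qed
  then have "A \<subseteq> B \<or> B \<subseteq> A" using cN A B by (auto simp: compatible_def incompatible_def)
  then show False
  proof
    assume "A \<subseteq> B" then show False using K B by (auto simp: incompatible_def)
  next
    assume BA: "B \<subseteq> A"
    show False
    proof (cases "b A \<in> B")
      case True
      then have "A \<subseteq> B" using b[of A] A B by auto
      then show False using K B by (auto simp: incompatible_def)
    next
      case False
      then show False using Kmax[of B] BA BF B by (auto simp: incompatible_def)
    qed
  qed
qed

text \<open>Two members with the same private block contain each other. With
  \<open>maximal_compatible_private\<close> this yields \<open>card E\<close> nonempty members, as
  many as a full-dimensional simplex has vertices besides the origin.\<close>

lemma maximal_compatible_bij:
  assumes N: "maximal_compatible N"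
  obtains b where "bij_betw b (N - {{}}) E"
    "\<And>A. A \<in> N \<Longrightarrow> A \<noteq> {} \<Longrightarrow> b A \<in> A"
    "\<And>A B. A \<in> N \<Longrightarrow> A \<noteq> {} \<Longrightarrow> B \<in> N \<Longrightarrow> b A \<in> B \<Longrightarrow> A \<subseteq> B"
proof -
  have cN: "compatible N" using N by (simp add: maximal_compatible_def)
  have "\<forall>A\<in>N - {{}}. \<exists>e. e \<in> A \<and> (\<forall>B\<in>N. e \<in> B \<longrightarrow> A \<subseteq> B)"
    using compatible_private[OF cN] by blast
  then obtain b where b: "\<And>A. A \<in> N \<Longrightarrow> A \<noteq> {} \<Longrightarrow> b A \<in> A \<and> (\<forall>B\<in>N. b A \<in> B \<longrightarrow> A \<subseteq> B)"
    by (metis DiffI singletonD)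
  have "bij_betw b (N - {{}}) E"
    unfolding bij_betw_def
  proof
    show "inj_on b (N - {{}})"
    proof (rule inj_onI)
      fix A B assume "A \<in> N - {{}}" "B \<in> N - {{}}" "b A = b B"
      then show "A = B" using b[of A] b[of B] by (metis DiffE singletonI subset_antisym)
    qed
    show "b ` (N - {{}}) = E"
    proof
      show "b ` (N - {{}}) \<subseteq> E" using b cN F_subset by (fastforce simp: compatible_def)
      show "E \<subseteq> b ` (N - {{}})" using maximal_compatible_private[OF N _ b] by blast
    qed
  qed
  then show ?thesis by (rule that) (simp_all add: b)
qed

text \<open>Passing from \<open>C\<close> to \<open>C \<inter> A\<close> or
  \<open>C \<union> A\<close> creates no conflict with \<open>N\<close> that \<open>C\<close> did
  not already have, while the conflict with \<open>A\<close> disappears. This is the decrease behind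
  the induction in \<open>uncross\<close>.\<close>

lemma incompatible_uncross:
  assumes N: "compatible N" and A: "A \<in> N" and C: "C \<in> F" and CA: "incompatible C A"
    and B: "B \<in> N" and inc: "incompatible (C \<inter> A) B \<or> incompatible (C \<union> A) B"
  shows "incompatible C B"
proof -
  have F: "A \<in> F" "B \<in> F" using N A B by (auto simp: compatible_def)
  have AB: "\<not> incompatible A B" using N A B by (auto simp: compatible_def)
  have CAF: "C \<union> A \<in> F" "\<not> C \<subseteq> A" "\<not> A \<subseteq> C" using CA by (auto simp: incompatible_def)
  from inc show ?thesis
  proof
    \<comment> \<open>Such a conflict joins \<open>B\<close> to both \<open>A\<close> and
      \<open>C\<close> through their common blocks, and compatibility of \<open>A\<close> with
      \<open>B\<close> leaves only \<open>B \<subseteq> A\<close>.\<close>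
    assume i: "incompatible (C \<inter> A) B"
    then have ne: "C \<inter> A \<noteq> {}" and nAB: "\<not> A \<subseteq> B"
      and U: "(C \<inter> A) \<union> B \<in> F" by (auto simp: incompatible_def)
    have "A \<union> ((C \<inter> A) \<union> B) \<in> F" using Un_in_meet[OF F(1) U] ne by blast
    moreover have "A \<union> ((C \<inter> A) \<union> B) = A \<union> B" by auto
    ultimately have "B \<subseteq> A" using AB nAB by (auto simp: incompatible_def)
    moreover have "C \<union> ((C \<inter> A) \<union> B) \<in> F" using Un_in_meet[OF C U] ne by blast
    moreover have "C \<union> ((C \<inter> A) \<union> B) = C \<union> B" by auto
    ultimately show ?thesis using i CAF unfolding incompatible_def by auto
  next
    assume i: "incompatible (C \<union> A) B"
    then have U: "C \<union> A \<union> B \<in> F" and nBA: "\<not> B \<subseteq> A" "\<not> B \<subseteq> C" by (auto simp: incompatible_def)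
    show ?thesis
    proof (cases "A \<subseteq> B")
      case True
      then have "C \<union> A \<union> B = C \<union> B" by auto
      then show ?thesis using U i nBA True by (auto simp: incompatible_def)
    next
      case False
      then have AUB: "A \<union> B \<notin> F" using AB nBA by (auto simp: incompatible_def)
      have "C \<noteq> {}" using CAF by auto
      have nCB: "\<not> C \<subseteq> B"
      proof
        assume "C \<subseteq> B"
        then have "(C \<union> A) \<union> B \<in> F" "(C \<union> A) \<union> B = A \<union> B"
          using CAF F \<open>C \<noteq> {}\<close> by (auto intro!: Un_in_meet)
        then show False using AUB by simp
      qed
      have "C \<union> A \<noteq> {}" "B \<noteq> {}" "C \<union> A \<subseteq> E" using CAF nBA F_subset by auto
      \<comment> \<open>The adjacency between \<open>C \<union> A\<close> and \<open>B\<close> must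
        start in \<open>C\<close>; starting in \<open>A\<close> it would make
        \<open>A \<union> B\<close> connected.\<close>
      then obtain x y where xy: "x \<in> C \<union> A" "y \<in> B" "adj x y"
        using Un_in_adjE[OF U] by blast
      then have "x \<in> C" using AUB Un_in[OF F(1) F(2)] by blast
      then have "C \<union> B \<in> F" using Un_in[OF C F(2)] xy by blast
      then show ?thesis using nCB nBA by (auto simp: incompatible_def)
    qed
  qed
qed

text \<open>If \<open>C\<close> conflicts with \<open>A\<close> in \<open>N\<close>, the
  intersection and the union have fewer conflicts, so their values are nonnegative by induction. The
  gap 2 less \<open>h A \<le> 1\<close> leaves \<open>1 \<le> h C\<close>; this is how the constants
  fit together.\<close>

lemma uncross:
  fixes h :: "'a set \<Rightarrow> real"
  assumes N: "maximal_compatible N"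
    and h: "\<And>A B. A \<in> F \<Longrightarrow> B \<in> F \<Longrightarrow> incompatible A B \<Longrightarrow> h (A \<inter> B) + h (A \<union> B) + 2 \<le> h A + h B"
    and hN: "\<And>A. A \<in> N \<Longrightarrow> 0 \<le> h A \<and> h A \<le> 1"
    and C: "C \<in> F"
  shows "0 \<le> h C \<and> (C \<notin> N \<longrightarrow> 1 \<le> h C)"
  using C
proof (induction "card {B \<in> N. incompatible C B}" arbitrary: C rule: less_induct)
  case less
  have cN: "compatible N" using N by (simp add: maximal_compatible_def)
  show ?case
  proof (cases "C \<in> N")
    case False
    then obtain A where A: "A \<in> N" "incompatible C A"
      using maximal_compatibleE[OF N less.prems] by blast
    have AF: "A \<in> F" using A cN by (auto simp: compatible_def)
    have F: "C \<inter> A \<in> F" "C \<union> A \<in> F" using Int_in less.prems A AF by (auto simp: incompatible_def)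
    have fin: "finite {B \<in> N. incompatible C B}" using compatible_finite[OF cN] by simp
    have "\<not> incompatible (C \<inter> A) A" "\<not> incompatible (C \<union> A) A" by (auto simp: incompatible_def)
    then have "{B \<in> N. incompatible (C \<inter> A) B} \<subset> {B \<in> N. incompatible C B}"
      "{B \<in> N. incompatible (C \<union> A) B} \<subset> {B \<in> N. incompatible C B}"
      using incompatible_uncross[OF cN A(1) less.prems A(2)] A by blast+
    then have "0 \<le> h (C \<inter> A)" "0 \<le> h (C \<union> A)"
      using less.hyps[OF _ F(1)] less.hyps[OF _ F(2)] psubset_card_mono[OF fin] by blast+
    moreover have "h (C \<inter> A) + h (C \<union> A) + 2 \<le> h C + h A" using h[OF less.prems AF A(2)] .
    ultimately show ?thesis using hN[OF A(1)] by auto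
  qed (use hN in auto)
qed

text \<open>With \<open>a\<close>, \<open>b\<close>, \<open>c\<close> the sizes of the two
  differences and of the intersection, the sums of squares differ by exactly
  \<open>2 * a * b\<close>, and incomparability makes \<open>a\<close> and \<open>b\<close> at least
  1.\<close>

lemma card_square_uncross:
  assumes "A \<in> F" "B \<in> F" "incompatible A B"
  shows "(real (card A))\<^sup>2 + (real (card B))\<^sup>2 + 2
           \<le> (real (card (A \<inter> B)))\<^sup>2 + (real (card (A \<union> B)))\<^sup>2"
proof -
  have fin: "finite A" "finite B" using assms finite_member by auto
  define a where "a = real (card (A - B))"
  define b where "b = real (card (B - A))"
  define c where "c = real (card (A \<inter> B))"
  have "A - B \<noteq> {}" "B - A \<noteq> {}" using assms by (auto simp: incompatible_def)
  then have ab: "1 \<le> a" "1 \<le> b" using fin by (auto simp: a_def b_def Suc_le_eq card_gt_0_iff)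
  have "card A = card (A - B) + card (A \<inter> B)" "card B = card (B - A) + card (A \<inter> B)"
    "card (A \<union> B) = card (A - B) + card (B - A) + card (A \<inter> B)"
    using fin by (subst card_Un_disjoint[symmetric]; auto intro: arg_cong[where f = card])+
  then have eq: "real (card A) = a + c" "real (card B) = b + c" "real (card (A \<union> B)) = a + b + c"
    by (simp_all add: a_def b_def c_def)
  have "1 \<le> a * b" using mult_mono[OF ab] ab by simp
  then show ?thesis unfolding eq c_def[symmetric] by (simp add: power2_eq_square algebra_simps)
qed

end

section \<open>Paths, cycles and blocks\<close>

definition adjrel :: "'v graph \<Rightarrow> 'v rel" where
  "adjrel G = {(x, y). {x, y} \<in> edges G}"

lemma adjrel_rtrancl_sym: "(x, y) \<in> (adjrel G)\<^sup>* \<Longrightarrow> (y, x) \<in> (adjrel G)\<^sup>*"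
proof -
  have "sym (adjrel G)" by (auto simp: adjrel_def sym_def insert_commute)
  then show "(x, y) \<in> (adjrel G)\<^sup>* \<Longrightarrow> (y, x) \<in> (adjrel G)\<^sup>*"
    using sym_rtrancl symD by metis
qed

lemma adjrel_rtrancl_mono: "edges H \<subseteq> edges G \<Longrightarrow> (adjrel H)\<^sup>* \<subseteq> (adjrel G)\<^sup>*"
  by (rule rtrancl_mono) (auto simp: adjrel_def)

lemma connected_graph_iff:
  "connected_graph G \<longleftrightarrow> (\<forall>u\<in>verts G. \<forall>v\<in>verts G. (u, v) \<in> (adjrel G)\<^sup>*)"
  by (auto simp: connected_graph_def reach_def adjrel_def)

lemma simple_graph_edgeE:
  assumes "simple_graph G" "e \<in> edges G"
  obtains x y where "e = {x, y}" "x \<noteq> y" "x \<in> verts G" "y \<in> verts G"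
proof -
  have "e \<subseteq> verts G" "card e = 2" using assms by (auto simp: simple_graph_def)
  then show ?thesis using that by (auto simp: card_2_iff)
qed

lemma simple_graph_edge:
  assumes "simple_graph G" "{x, y} \<in> edges G"
  shows "x \<in> verts G \<and> y \<in> verts G \<and> x \<noteq> y"
  using simple_graph_edgeE[OF assms] by (auto simp: doubleton_eq_iff)

definition graph_Un :: "'v graph \<Rightarrow> 'v graph \<Rightarrow> 'v graph" where
  "graph_Un H K = (verts H \<union> verts K, edges H \<union> edges K)"

lemma connected_graph_Un:
  assumes "connected_graph H" "connected_graph K" "verts H \<inter> verts K \<noteq> {}"
  shows "connected_graph (graph_Un H K)"
proof -
  obtain w where w: "w \<in> verts H" "w \<in> verts K" using assms by auto
  have "(u, w) \<in> (adjrel (graph_Un H K))\<^sup>*" if "u \<in> verts (graph_Un H K)" for u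
    using that w assms(1,2) adjrel_rtrancl_mono[of H "graph_Un H K"]
      adjrel_rtrancl_mono[of K "graph_Un H K"]
    unfolding connected_graph_iff graph_Un_def by auto
  then show ?thesis
    unfolding connected_graph_iff by (meson adjrel_rtrancl_sym rtrancl_trans)
qed

lemma del_vert_Un: "del_vert (graph_Un H K) w = graph_Un (del_vert H w) (del_vert K w)"
  by (auto simp: del_vert_def graph_Un_def)

lemma del_vert_idle:
  assumes "simple_graph H" "w \<notin> verts H"
  shows "del_vert H w = H"
proof -
  have "w \<notin> e" if "e \<in> edges H" for e using that assms by (auto simp: simple_graph_def)
  then show ?thesis using assms by (cases H) (auto simp: del_vert_def)
qed

lemma two_connected_del_vert:
  "simple_graph H \<Longrightarrow> two_connected H \<Longrightarrow> connected_graph (del_vert H w)"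
  by (cases "w \<in> verts H") (auto simp: two_connected_def del_vert_idle)

lemma simple_graph_Un: "simple_graph H \<Longrightarrow> simple_graph K \<Longrightarrow> simple_graph (graph_Un H K)"
  by (auto simp: simple_graph_def graph_Un_def)

text \<open>Whichever vertex is deleted, \<open>u\<close> or \<open>v\<close> survives in both parts
  and keeps them joined.\<close>

lemma two_connected_Un:
  assumes H: "simple_graph H" "two_connected H" and K: "simple_graph K" "two_connected K"
    and uv: "u \<in> verts H \<inter> verts K" "v \<in> verts H \<inter> verts K" "u \<noteq> v"
  shows "two_connected (graph_Un H K)"
proof -
  have "connected_graph (del_vert (graph_Un H K) w)" for w
  proof -
    have "verts (del_vert H w) \<inter> verts (del_vert K w) \<noteq> {}"
      using uv by (cases "w = u") (auto simp: del_vert_def)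
    then show ?thesis
      unfolding del_vert_Un
      using two_connected_del_vert[OF H] two_connected_del_vert[OF K] by (rule connected_graph_Un[rotated 2])
  qed
  moreover have "connected_graph (graph_Un H K)"
    using H K uv by (intro connected_graph_Un) (auto simp: two_connected_def)
  moreover have "card (verts H) \<le> card (verts (graph_Un H K))"
    using H K by (intro card_mono) (auto simp: graph_Un_def simple_graph_def)
  ultimately show ?thesis using H by (auto simp: two_connected_def)
qed

section \<open>Paths and cycles as vertex lists\<close>

fun path_edges :: "'v list \<Rightarrow> 'v set set" where
  "path_edges (x # y # zs) = insert {x, y} (path_edges (y # zs))"
| "path_edges _ = {}"

lemma path_edges_append:
  "xs \<noteq> [] \<Longrightarrow> ys \<noteq> [] \<Longrightarrow>
    path_edges (xs @ ys) = path_edges xs \<union> path_edges ys \<union> {{last xs, hd ys}}"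
proof (induction xs rule: path_edges.induct)
  case ("2_2" x)
  then show ?case by (cases ys) auto
qed auto

lemma path_edges_subset: "e \<in> path_edges p \<Longrightarrow> e \<subseteq> set p"
  by (induction p rule: path_edges.induct) auto

lemma path_edges_card: "distinct p \<Longrightarrow> e \<in> path_edges p \<Longrightarrow> card e = 2"
  by (induction p rule: path_edges.induct) auto

lemma path_edges_reach:
  "path_edges p \<subseteq> edges G \<Longrightarrow> x \<in> set p \<Longrightarrow> (hd p, x) \<in> (adjrel G)\<^sup>*"
proof (induction p rule: path_edges.induct)
  case (1 a b zs)
  show ?case
  proof (cases "x = a")
    case False
    then have "(b, x) \<in> (adjrel G)\<^sup>*" using 1 by auto
    moreover have "(a, b) \<in> adjrel G" using 1 by (auto simp: adjrel_def)
    ultimately show ?thesis by (simp add: converse_rtrancl_into_rtrancl)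
  qed simp
qed auto

lemma path_edges_connected:
  assumes "path_edges p \<subseteq> edges G" "x \<in> set p" "y \<in> set p"
  shows "(x, y) \<in> (adjrel G)\<^sup>*"
  using path_edges_reach[OF assms(1,2)] path_edges_reach[OF assms(1,3)]
  by (meson adjrel_rtrancl_sym rtrancl_trans)

lemma simple_path_exists:
  assumes "(u, v) \<in> (adjrel G)\<^sup>*"
  obtains p where "distinct p" "p \<noteq> []" "hd p = u" "last p = v" "path_edges p \<subseteq> edges G"
proof -
  have "\<exists>p. distinct p \<and> p \<noteq> [] \<and> hd p = u \<and> last p = v \<and> path_edges p \<subseteq> edges G"
    using assms
  proof (induction rule: rtrancl_induct)
    case base
    show ?case by (rule exI[of _ "[u]"]) auto
  next
    case (step y z)
    then obtain p where p: "distinct p" "p \<noteq> []" "hd p = u" "last p = y" "path_edges p \<subseteq> edges G"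
      by auto
    show ?case
    proof (cases "z \<in> set p")
      case True
      then obtain xs ys where xy: "p = xs @ z # ys" by (meson split_list)
      \<comment> \<open>When the walk returns to a vertex already on the path, the path is cut there
        and the new edge is discarded.\<close>
      have "path_edges (xs @ [z]) \<subseteq> path_edges p"
        unfolding xy using path_edges_append[of "xs @ [z]" ys] by (cases ys) auto
      then have "path_edges (xs @ [z]) \<subseteq> edges G" using p by blast
      moreover have "hd (xs @ [z]) = u" using p xy by (cases xs) auto
      ultimately show ?thesis using p xy by (intro exI[of _ "xs @ [z]"]) auto
    next
      case False
      then show ?thesis
        using p step path_edges_append[of p "[z]"]
        by (intro exI[of _ "p @ [z]"]) (auto simp: adjrel_def)
    qed
  qed
  then show ?thesis using that by blast
qed

text \<open>A genuine cycle only from three vertices on: with one vertex the closing edge is a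
  singleton, with two it repeats the only edge.\<close>

definition cycle_graph :: "'v list \<Rightarrow> 'v graph" where
  "cycle_graph p = (set p, insert {last p, hd p} (path_edges p))"

text \<open>Deleting \<open>w\<close> leaves the arcs \<open>xs\<close> and \<open>ys\<close>; if
  both are nonempty, the closing edge joins \<open>last ys\<close> to \<open>hd xs\<close>.\<close>

lemma cycle_del_vert_connected:
  assumes p: "distinct p" "p = xs @ w # ys"
  shows "connected_graph (del_vert (cycle_graph p) w)"
proof -
  let ?D = "del_vert (cycle_graph p) w"
  have "path_edges xs \<subseteq> path_edges p" "path_edges ys \<subseteq> path_edges p"
    unfolding p using path_edges_append[of xs "w # ys"] path_edges_append[of "xs @ [w]" ys]
    by (cases xs; cases ys; auto)+
  then have sub: "path_edges xs \<subseteq> edges ?D" "path_edges ys \<subseteq> edges ?D"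
    using p path_edges_subset[of _ xs] path_edges_subset[of _ ys]
    by (fastforce simp: del_vert_def cycle_graph_def)+
  have join: "(hd xs, last ys) \<in> (adjrel ?D)\<^sup>*" if "xs \<noteq> []" "ys \<noteq> []"
  proof -
    have "hd xs \<in> set xs" "last ys \<in> set ys" using that by auto
    then have "{hd xs, last ys} \<in> edges ?D"
      using that p by (auto simp: del_vert_def cycle_graph_def insert_commute)
    then show ?thesis by (auto simp: adjrel_def)
  qed
  have cross: "(x, y) \<in> (adjrel ?D)\<^sup>*" if "x \<in> set xs" "y \<in> set ys" for x y
  proof -
    have "xs \<noteq> []" "ys \<noteq> []" using that by auto
    then have "(x, hd xs) \<in> (adjrel ?D)\<^sup>*" "(last ys, y) \<in> (adjrel ?D)\<^sup>*"
      using path_edges_connected[OF sub(1)] path_edges_connected[OF sub(2)] that by auto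
    then show ?thesis using join[OF \<open>xs \<noteq> []\<close> \<open>ys \<noteq> []\<close>] by (meson rtrancl_trans)
  qed
  have "verts ?D = set xs \<union> set ys" using p by (auto simp: del_vert_def cycle_graph_def)
  then show ?thesis
    unfolding connected_graph_iff
    by (auto intro: cross path_edges_connected[OF sub(1)] path_edges_connected[OF sub(2)]
        adjrel_rtrancl_sym[OF cross])
qed

lemma two_connected_cycle:
  assumes "distinct p" "length p \<ge> 3"
  shows "two_connected (cycle_graph p)"
  unfolding two_connected_def
proof (intro conjI ballI)
  show "connected_graph (cycle_graph p)"
    unfolding connected_graph_iff cycle_graph_def by (auto intro!: path_edges_connected[of p])
  show "3 \<le> card (verts (cycle_graph p))"
    using assms by (simp add: cycle_graph_def distinct_card)
  fix v assume "v \<in> verts (cycle_graph p)"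
  then obtain xs ys where "p = xs @ v # ys" by (auto simp: cycle_graph_def dest: split_list)
  then show "connected_graph (del_vert (cycle_graph p) v)"
    using cycle_del_vert_connected[OF assms(1)] by simp
qed

text \<open>Among the 2-connected subgraphs containing the edges of \<open>H\<close>, one with the
  most vertices plus edges is maximal among all 2-connected subgraphs, since anything above it
  contains these edges as well.\<close>

lemma two_connected_in_block:
  fixes G :: "('v::finite) graph"
  assumes H: "subgraph_of H G" "two_connected H"
  obtains B where "B \<in> blocks G" "edges H \<subseteq> edges B"
proof -
  let ?P = "\<lambda>K. subgraph_of K G \<and> two_connected K \<and> edges H \<subseteq> edges K"
  let ?f = "\<lambda>K :: 'v graph. card (verts K) + card (edges K)"
  have "?P H" using H by simp
  moreover have "\<forall>K. ?P K \<longrightarrow> ?f K < Suc (CARD('v) + CARD('v set))"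
    by (intro allI impI le_imp_less_Suc add_mono card_mono) auto
  ultimately obtain B where B: "?P B" and max: "\<And>K. ?P K \<Longrightarrow> ?f K \<le> ?f B"
    using ex_has_greatest_nat[of ?P H ?f] by blast
  have "K = B" if K: "subgraph_of K G" "two_connected K" "subgraph_of B K" for K
  proof -
    have sub: "verts B \<subseteq> verts K" "edges B \<subseteq> edges K" using K by (auto simp: subgraph_of_def)
    then have le: "card (verts B) \<le> card (verts K)" "card (edges B) \<le> card (edges K)"
      by (auto intro: card_mono)
    have "?f K \<le> ?f B" using max K B sub by blast
    then have "card (verts B) = card (verts K)" "card (edges B) = card (edges K)" using le by linarith+
    then have "verts B = verts K" "edges B = edges K"
      using card_subset_eq[OF finite sub(1)] card_subset_eq[OF finite sub(2)] by auto
    then show ?thesis by (simp add: prod_eq_iff)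
  qed
  then have "B \<in> blocks G" using B by (auto simp: blocks_def)
  then show ?thesis using B that by auto
qed

lemma cycle_in_block:
  fixes G :: "('v::finite) graph"
  assumes G: "simple_graph G" and p: "distinct p" "length p \<ge> 3"
    and sub: "path_edges p \<subseteq> edges G" "{last p, hd p} \<in> edges G"
  obtains B where "B \<in> blocks G" "path_edges p \<subseteq> edges B" "{last p, hd p} \<in> edges B"
proof -
  have "set p \<subseteq> verts G"
  proof
    fix x assume x: "x \<in> set p"
    have "(hd p, x) \<in> (adjrel G)\<^sup>*" using path_edges_reach[OF sub(1) x] .
    then show "x \<in> verts G"
      by (induction rule: rtrancl_induct)
        (use simple_graph_edge[OF G] sub(2) in \<open>auto simp: adjrel_def\<close>)
  qed
  moreover have "simple_graph (cycle_graph p)"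
  proof -
    have "hd p \<in> set p" "last p \<in> set p" "hd p \<noteq> last p"
      using p simple_graph_edge[OF G sub(2)] by (cases p; auto)+
    then show ?thesis
      using path_edges_card[OF p(1)] path_edges_subset[of _ p]
      by (auto simp: simple_graph_def cycle_graph_def)
  qed
  ultimately have "subgraph_of (cycle_graph p) G"
    using sub by (auto simp: subgraph_of_def cycle_graph_def)
  then obtain B where "B \<in> blocks G" "edges (cycle_graph p) \<subseteq> edges B"
    using two_connected_in_block two_connected_cycle[OF p] by blast
  then show ?thesis using that by (auto simp: cycle_graph_def)
qed

section \<open>Bridges and reachability\<close>

lemma reach_eq: "reach G = (adjrel G)\<^sup>* \<inter> verts G \<times> verts G"
  by (auto simp: reach_def adjrel_def)

lemma equiv_reach: "equiv (verts G) (reach G)"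
proof (rule equivI)
  show "reach G \<subseteq> verts G \<times> verts G" by (auto simp: reach_eq)
  show "refl_on (verts G) (reach G)" by (auto simp: reach_eq refl_on_def)
  show "sym (reach G)" by (auto simp: reach_eq sym_def intro: adjrel_rtrancl_sym)
  show "trans (reach G)" by (auto simp: reach_eq trans_def)
qed

lemma adjrel_del_edge_rtrancl:
  assumes "(u, v) \<in> (adjrel (del_edge G {u, v}))\<^sup>*"
  shows "(adjrel (del_edge G {u, v}))\<^sup>* = (adjrel G)\<^sup>*"
proof
  show "(adjrel (del_edge G {u, v}))\<^sup>* \<subseteq> (adjrel G)\<^sup>*"
    by (rule adjrel_rtrancl_mono) (auto simp: del_edge_def)
  have "adjrel G \<subseteq> (adjrel (del_edge G {u, v}))\<^sup>*"
  proof (rule subrelI)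
    fix x y assume xy: "(x, y) \<in> adjrel G"
    show "(x, y) \<in> (adjrel (del_edge G {u, v}))\<^sup>*"
    proof (cases "{x, y} = {u, v}")
      case True
      then show ?thesis using assms adjrel_rtrancl_sym[OF assms] by (auto simp: doubleton_eq_iff)
    next
      case False
      then show ?thesis using xy by (auto simp: adjrel_def del_edge_def)
    qed
  qed
  then show "(adjrel G)\<^sup>* \<subseteq> (adjrel (del_edge G {u, v}))\<^sup>*"
    using rtrancl_subset_rtrancl by blast
qed

text \<open>Bridges are defined by counting components. If the ends stay joined, reachability and
  hence the components are unchanged. Otherwise, sending each component after deletion to the
  component of \<open>G\<close> around it is onto but not injective, because the classes of
  \<open>u\<close> and \<open>v\<close> merge; so the count drops strictly.\<close>

lemma bridge_iff:
  assumes G: "simple_graph G" and e: "{u, v} \<in> edges G"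
  shows "bridge G {u, v} \<longleftrightarrow> (u, v) \<notin> (adjrel (del_edge G {u, v}))\<^sup>*"
proof
  let ?D = "del_edge G {u, v}"
  show "(u, v) \<notin> (adjrel ?D)\<^sup>*" if br: "bridge G {u, v}"
  proof
    assume "(u, v) \<in> (adjrel ?D)\<^sup>*"
    then have "components ?D = components G"
      using adjrel_del_edge_rtrancl[of u v G]
      by (simp add: components_def reach_eq) (simp add: del_edge_def)
    then show False using br by (simp add: bridge_def)
  qed
  assume nr: "(u, v) \<notin> (adjrel ?D)\<^sup>*"
  have V: "verts ?D = verts G" by (simp add: del_edge_def)
  have uv: "u \<in> verts G" "v \<in> verts G" using simple_graph_edge[OF G e] by auto
  have RR: "reach ?D \<subseteq> reach G"
    using adjrel_rtrancl_mono[of ?D G] by (auto simp: reach_eq del_edge_def)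
  have eqG: "equiv (verts G) (reach G)" and eqD: "equiv (verts G) (reach ?D)"
    using equiv_reach[of G] equiv_reach[of ?D] by (simp_all add: V)
  let ?f = "\<lambda>C. reach G `` C"
  have cls: "?f (reach ?D `` {x}) = reach G `` {x}" if "x \<in> verts G" for x
  proof
    show "?f (reach ?D `` {x}) \<subseteq> reach G `` {x}"
      using RR eqG by (auto simp: equiv_def trans_def)
    show "reach G `` {x} \<subseteq> ?f (reach ?D `` {x})"
      using eqD that by (auto simp: equiv_def refl_on_def)
  qed
  have im: "?f ` components ?D = components G"
  proof
    show "?f ` components ?D \<subseteq> components G"
      using cls by (auto simp: components_def V quotient_def)
    show "components G \<subseteq> ?f ` components ?D"
    proof
      fix C assume "C \<in> components G"
      then obtain x where x: "x \<in> verts G" "C = reach G `` {x}"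
        by (auto simp: components_def quotient_def)
      then have "C = ?f (reach ?D `` {x})" using cls by simp
      moreover have "reach ?D `` {x} \<in> components ?D"
        using x by (auto simp: components_def V intro: quotientI)
      ultimately show "C \<in> ?f ` components ?D" by blast
    qed
  qed
  have fin: "finite (components ?D)"
    unfolding components_def V using G eqD
    by (intro finite_quotient) (auto simp: simple_graph_def equiv_def)
  have "\<not> inj_on ?f (components ?D)"
  proof
    assume inj: "inj_on ?f (components ?D)"
    have "(u, v) \<in> reach G" using e uv by (auto simp: reach_eq adjrel_def)
    then have "reach G `` {u} = reach G `` {v}" using eqG by (simp add: equiv_class_eq)
    then have "reach ?D `` {u} = reach ?D `` {v}"
      using inj cls uv by (auto simp: inj_on_def components_def V quotientI)
    then have "(u, v) \<in> reach ?D" using eqD uv by (simp add: eq_equiv_class)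
    then show False using nr by (auto simp: reach_eq)
  qed
  then have "card (components G) < card (components ?D)"
    using im fin by (metis card_image_le eq_card_imp_inj_on le_neq_implies_less)
  then show "bridge G {u, v}" using e by (simp add: bridge_def)
qed

text \<open>A third vertex \<open>w\<close> is reached from \<open>u\<close> without
  \<open>v\<close>, and reaches \<open>v\<close> without \<open>u\<close>; both connections avoid
  the edge from \<open>u\<close> to \<open>v\<close>.\<close>

lemma two_connected_no_bridge:
  assumes G: "simple_graph G" and H: "subgraph_of H G" "two_connected H" and e: "e \<in> edges H"
  shows "\<not> bridge G e"
proof -
  have sH: "simple_graph H" using H by (simp add: subgraph_of_def)
  obtain u v where uv: "e = {u, v}" "u \<noteq> v" "u \<in> verts H" "v \<in> verts H"
    using simple_graph_edgeE[OF sH e] .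
  have "\<not> verts H \<subseteq> {u, v}"
  proof
    assume "verts H \<subseteq> {u, v}"
    then have "card (verts H) \<le> card {u, v}" by (intro card_mono) auto
    then show False using H uv by (simp add: two_connected_def)
  qed
  then obtain w where w: "w \<in> verts H" "w \<noteq> u" "w \<noteq> v" by auto
  have sub: "edges (del_vert H x) \<subseteq> edges (del_edge G e)" if "x \<in> e" for x
    using that H by (auto simp: del_vert_def del_edge_def subgraph_of_def)
  have "(u, w) \<in> (adjrel (del_vert H v))\<^sup>*" "(w, v) \<in> (adjrel (del_vert H u))\<^sup>*"
    using two_connected_del_vert[OF sH H(2)] uv w
    unfolding connected_graph_iff by (auto simp: del_vert_def)
  then have "(u, v) \<in> (adjrel (del_edge G e))\<^sup>*"
    using adjrel_rtrancl_mono[OF sub[of v]] adjrel_rtrancl_mono[OF sub[of u]] uv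
    by (meson insertCI rtrancl_trans subsetD)
  then show ?thesis using bridge_iff[OF G, of u v] H e uv by (auto simp: subgraph_of_def)
qed

section \<open>Every edge lies in exactly one block\<close>

lemma block_cases:
  assumes "B \<in> blocks G"
  obtains (two_connected) "subgraph_of B G" "two_connected B"
      "\<And>H. subgraph_of H G \<Longrightarrow> two_connected H \<Longrightarrow> subgraph_of B H \<Longrightarrow> H = B"
    | (bridge) e where "B = (e, {e})" "bridge G e"
proof -
  have "(subgraph_of B G \<and> two_connected B \<and>
        (\<forall>H. subgraph_of H G \<and> two_connected H \<and> subgraph_of B H \<longrightarrow> H = B)) \<or>
      (\<exists>e. B = (e, {e}) \<and> bridge G e)"
    using assms unfolding blocks_def Un_iff mem_Collect_eq .
  then show ?thesis
  proof
    assume *: "subgraph_of B G \<and> two_connected B \<and>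
        (\<forall>H. subgraph_of H G \<and> two_connected H \<and> subgraph_of B H \<longrightarrow> H = B)"
    show ?thesis by (rule two_connected) (simp_all add: *)
  next
    assume "\<exists>e. B = (e, {e}) \<and> bridge G e"
    then show ?thesis using bridge by metis
  qed
qed

lemma block_subgraph:
  assumes G: "simple_graph G" and B: "B \<in> blocks G"
  shows "subgraph_of B G"
  using B
proof (cases rule: block_cases)
  case (bridge e)
  then have "e \<in> edges G" by (simp add: bridge_def)
  then show ?thesis
    using G bridge finite_subset[of e "verts G"] by (auto simp: subgraph_of_def simple_graph_def)
qed

lemma block_connected:
  assumes G: "simple_graph G" and B: "B \<in> blocks G"
  shows "connected_graph B" "verts B \<noteq> {}"
proof -
  have "connected_graph B \<and> verts B \<noteq> {}"
    using B
  proof (cases rule: block_cases)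
    case two_connected
    then show ?thesis by (auto simp: two_connected_def)
  next
    case (bridge e)
    then have "e \<in> edges G" by (simp add: bridge_def)
    then obtain x y where "e = {x, y}" using simple_graph_edgeE[OF G] by metis
    then show ?thesis
      using bridge by (auto simp: connected_graph_iff adjrel_def insert_commute)
  qed
  then show "connected_graph B" "verts B \<noteq> {}" by auto
qed

text \<open>2-connected blocks sharing an edge share its two ends, so their union is 2-connected and
  maximality identifies both with it. A bridge lies in no 2-connected subgraph, and a bridge block
  is determined by its edge.\<close>

lemma blocks_edge_disjoint:
  assumes G: "simple_graph G" and H: "H \<in> blocks G" and K: "K \<in> blocks G"
    and e: "e \<in> edges H" "e \<in> edges K"
  shows "H = K"
  using H
proof (cases rule: block_cases)
  case two_connected
  note H' = this
  show ?thesis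
    using K
  proof (cases rule: block_cases)
    case two_connected
    have s: "simple_graph H" "simple_graph K"
      using H' two_connected by (auto simp: subgraph_of_def)
    obtain u v where uv: "e = {u, v}" "u \<noteq> v" "u \<in> verts H" "v \<in> verts H"
      using simple_graph_edgeE[OF s(1) e(1)] .
    moreover have "u \<in> verts K" "v \<in> verts K" using simple_graph_edge[OF s(2)] e(2) uv by auto
    ultimately have tc: "two_connected (graph_Un H K)"
      using s H' two_connected by (intro two_connected_Un[of H K u v]) auto
    have "subgraph_of (graph_Un H K) G" "subgraph_of H (graph_Un H K)" "subgraph_of K (graph_Un H K)"
      using H' two_connected s simple_graph_Un[OF s] by (auto simp: subgraph_of_def graph_Un_def)
    then show ?thesis using H'(3) two_connected(3) tc by metis
  next
    case (bridge f)
    then show ?thesis using two_connected_no_bridge[OF G H'(1,2) e(1)] e(2) by auto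
  qed
next
  case (bridge f)
  note H' = this
  show ?thesis
    using K
  proof (cases rule: block_cases)
    case two_connected
    then show ?thesis using two_connected_no_bridge[OF G _ _ e(2)] H' e(1) by auto
  next
    case (bridge f')
    then show ?thesis using H' e by auto
  qed
qed

lemma edge_in_block:
  fixes G :: "('v::finite) graph"
  assumes G: "simple_graph G" and e: "e \<in> edges G"
  obtains B where "B \<in> blocks G" "e \<in> edges B"
proof (cases "bridge G e")
  case True
  then have "(e, {e}) \<in> blocks G" by (auto simp: blocks_def)
  then show ?thesis using that by auto
next
  case False
  obtain u v where uv: "e = {u, v}" "u \<noteq> v" using simple_graph_edgeE[OF G e] by metis
  then have "(u, v) \<in> (adjrel (del_edge G e))\<^sup>*" using bridge_iff[OF G, of u v] e False by auto
  then obtain p where p: "distinct p" "p \<noteq> []" "hd p = u" "last p = v"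
      "path_edges p \<subseteq> edges (del_edge G e)"
    by (rule simple_path_exists)
  \<comment> \<open>A path with at most two vertices would have equal ends or consist of the deleted
    edge \<open>e\<close>.\<close>
  have "length p \<ge> 3"
  proof (rule ccontr)
    assume "\<not> ?thesis"
    then obtain x y where "p = [x] \<or> p = [x, y]"
      using p(2) by (cases p rule: path_edges.cases) (auto simp: neq_Nil_conv not_le less_Suc_eq)
    then show False using p uv by (auto simp: del_edge_def)
  qed
  moreover have eq: "{last p, hd p} = e" using p uv by auto
  moreover have "path_edges p \<subseteq> edges G" using p(5) by (auto simp: del_edge_def)
  ultimately obtain B where "B \<in> blocks G" "{last p, hd p} \<in> edges B"
    using cycle_in_block[OF G p(1)] e by metis
  then show ?thesis using that eq by simp
qed

section \<open>Connected unions of blocks\<close>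

lemma verts_graph_Union: "x \<in> verts (graph_Union A) \<longleftrightarrow> (\<exists>H\<in>A. x \<in> verts H)"
  by (simp add: graph_Union_def)

lemma edges_graph_Union: "e \<in> edges (graph_Union A) \<longleftrightarrow> (\<exists>H\<in>A. e \<in> edges H)"
  by (simp add: graph_Union_def)

lemma simple_graph_Union_blocks:
  assumes G: "simple_graph G" and A: "A \<subseteq> blocks G"
  shows "simple_graph (graph_Union A)" "edges (graph_Union A) \<subseteq> edges G"
    "verts (graph_Union A) \<subseteq> verts G"
proof -
  have sub: "subgraph_of H G" if "H \<in> A" for H using block_subgraph[OF G] A that by blast
  show E: "edges (graph_Union A) \<subseteq> edges G" and V: "verts (graph_Union A) \<subseteq> verts G"
    using sub by (auto simp: graph_Union_def subgraph_of_def)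
  have "finite (verts (graph_Union A))" using V G finite_subset by (auto simp: simple_graph_def)
  moreover have "e \<subseteq> verts (graph_Union A) \<and> card e = 2" if e: "e \<in> edges (graph_Union A)" for e
  proof -
    obtain H where H: "H \<in> A" "e \<in> edges H" using e unfolding edges_graph_Union by blast
    then have "e \<subseteq> verts H" "card e = 2"
      using sub[OF H(1)] by (auto simp: subgraph_of_def simple_graph_def)
    then show ?thesis using H(1) by (auto simp: graph_Union_def)
  qed
  ultimately show "simple_graph (graph_Union A)" by (simp add: simple_graph_def)
qed

text \<open>A path leaving \<open>graph_Union A\<close> between two of its vertices would close up to a cycle with a
  path inside, and the block containing this cycle shares an edge with a member of \<open>A\<close>.\<close>

lemma path_in_connected_family:
  fixes G :: "('v::finite) graph"
  assumes G: "simple_graph G" and A: "A \<subseteq> blocks G" "connected_graph (graph_Union A)"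
    and p: "distinct p" "p \<noteq> []" "path_edges p \<subseteq> edges G"
      "hd p \<in> verts (graph_Union A)" "last p \<in> verts (graph_Union A)"
  shows "path_edges p \<subseteq> edges (graph_Union A)"
  using p
proof (induction "length p" arbitrary: p rule: less_induct)
  case less
  let ?A = "graph_Union A"
  note sA = simple_graph_Union_blocks[OF G A(1)]
  show ?case
  proof (cases "\<exists>x y m. p = x # m @ [y]")
    case False
    then have "length p = 1"
      using less.prems(2) by (cases p) (auto, metis append_butlast_last_id)
    then show ?thesis by (cases p) auto
  next
    case True
    then obtain x y m where p: "p = x # m @ [y]" by auto
    have xy: "x \<in> verts ?A" "y \<in> verts ?A" "x \<noteq> y" using less.prems p by auto
    show ?thesis
    proof (cases "\<exists>z\<in>set m. z \<in> verts ?A")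
      case True
      \<comment> \<open>An inner vertex in the family splits the path into two shorter ones of the
        same kind, so from here on only paths with inner vertices outside the family remain.\<close>
      then obtain z m1 m2 where z: "z \<in> verts ?A" "m = m1 @ z # m2" by (meson split_list)
      have eq: "path_edges p = path_edges (x # m1 @ [z]) \<union> path_edges (z # m2 @ [y])"
      proof -
        have "p = (x # m1 @ [z]) @ (m2 @ [y])" using p z by simp
        then have "path_edges p = path_edges (x # m1 @ [z]) \<union> path_edges (m2 @ [y])
            \<union> {{z, hd (m2 @ [y])}}"
          using path_edges_append[of "x # m1 @ [z]" "m2 @ [y]"] by simp
        moreover have "path_edges (z # m2 @ [y]) = insert {z, hd (m2 @ [y])} (path_edges (m2 @ [y]))"
          by (cases m2) auto
        ultimately show ?thesis by blast
      qed
      have "path_edges (x # m1 @ [z]) \<subseteq> edges ?A"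
        using less.prems p z xy eq by (intro less.hyps) auto
      moreover have "path_edges (z # m2 @ [y]) \<subseteq> edges ?A"
        using less.prems p z xy eq by (intro less.hyps) auto
      ultimately show ?thesis using eq by simp
    next
      case False
      have "(y, x) \<in> (adjrel ?A)\<^sup>*" using A(2) xy by (simp add: connected_graph_iff)
      then obtain q where q: "distinct q" "q \<noteq> []" "hd q = y" "last q = x" "path_edges q \<subseteq> edges ?A"
        by (rule simple_path_exists)
      then obtain n where n: "q = y # n @ [x]"
        using xy(3) by (cases q) (auto, metis append_butlast_last_id)
      have qV: "z \<in> verts ?A" if "z \<in> set q" for z
      proof -
        have "(y, z) \<in> (adjrel ?A)\<^sup>*" using path_edges_reach[OF q(5) that] q(3) by simp
        then show ?thesis
          by (induction rule: rtrancl_induct)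
            (use xy simple_graph_edge[OF sA(1)] in \<open>auto simp: adjrel_def\<close>)
      qed
      \<comment> \<open>The cycle runs along \<open>p\<close> and back along \<open>q\<close>; the
        final \<open>x\<close> of \<open>q\<close> is omitted, so that the last edge of
        \<open>q\<close> becomes the closing edge.\<close>
      define c where "c = x # m @ y # n"
      have pc: "path_edges p \<subseteq> path_edges c" and cq: "path_edges c \<subseteq> path_edges p \<union> path_edges q"
        and lc: "{last c, hd c} \<in> path_edges q" and qc: "path_edges q \<subseteq> insert {last c, hd c} (path_edges c)"
      proof -
        have c: "path_edges c = path_edges p \<union> path_edges (y # n)"
        proof (cases n)
          case Nil
          then show ?thesis by (simp add: c_def p)
        next
          case (Cons a n')
          have "path_edges c = path_edges (p @ n)" by (simp add: c_def p)
          also have "\<dots> = path_edges p \<union> path_edges n \<union> {{y, a}}"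
            using path_edges_append[of p n] Cons p by simp
          finally show ?thesis using Cons by auto
        qed
        have q': "path_edges q = path_edges (y # n) \<union> {{last (y # n), x}}"
          using path_edges_append[of "y # n" "[x]"] n by simp
        have "last c = last (y # n)" "hd c = x" by (simp_all add: c_def)
        then show "path_edges p \<subseteq> path_edges c" "path_edges c \<subseteq> path_edges p \<union> path_edges q"
          "{last c, hd c} \<in> path_edges q" "path_edges q \<subseteq> insert {last c, hd c} (path_edges c)"
          using c q' by auto
      qed
      show ?thesis
      \<comment> \<open>Without inner vertices \<open>p\<close> and \<open>q\<close> use the same
        edge and form no cycle; this edge is in the family because \<open>q\<close> is.\<close>
      proof (cases "m = [] \<and> n = []")
        case True
        then show ?thesis using q(5) n p by (auto simp: insert_commute)
      next
        case nontriv: False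
        have "distinct c"
          using less.prems(1) q(1) p n False qV by (auto simp: c_def)
        moreover have "length c \<ge> 3" using nontriv by (cases m; cases n; simp add: c_def)
        moreover have "path_edges c \<subseteq> edges G" "{last c, hd c} \<in> edges G"
          using cq lc q(5) less.prems(3) sA(2) by blast+
        ultimately obtain B where B: "B \<in> blocks G" "path_edges c \<subseteq> edges B" "{last c, hd c} \<in> edges B"
          using cycle_in_block[OF G] by metis
        \<comment> \<open>The closing edge belongs to \<open>q\<close>, hence to a member of
          \<open>A\<close>; sharing it identifies the block around the cycle with that
          member.\<close>
        obtain H where H: "H \<in> A" "{last c, hd c} \<in> edges H"
          using lc q(5) edges_graph_Union by blast
        have "B = H" using blocks_edge_disjoint[OF G B(1) _ B(3) H(2)] H A by blast
        then show ?thesis using pc B H edges_graph_Union by blast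
      qed
    qed
  qed
qed

lemma connected_families_Int:
  fixes G :: "('v::finite) graph"
  assumes G: "simple_graph G" and A: "A \<in> connected_families G" and B: "B \<in> connected_families G"
  shows "A \<inter> B \<in> connected_families G"
proof -
  have AB: "A \<subseteq> blocks G" "connected_graph (graph_Union A)" "B \<subseteq> blocks G"
      "connected_graph (graph_Union B)"
    using A B by (auto simp: connected_families_def)
  have "(u, v) \<in> (adjrel (graph_Union (A \<inter> B)))\<^sup>*"
    if u: "u \<in> verts (graph_Union (A \<inter> B))" and v: "v \<in> verts (graph_Union (A \<inter> B))" for u v
  proof -
    have uvA: "u \<in> verts (graph_Union A)" "v \<in> verts (graph_Union A)"
      and uvB: "u \<in> verts (graph_Union B)" "v \<in> verts (graph_Union B)"
      using u v by (auto simp: verts_graph_Union)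
    have "(u, v) \<in> (adjrel (graph_Union A))\<^sup>*" using AB(2) uvA by (simp add: connected_graph_iff)
    then obtain p where p: "distinct p" "p \<noteq> []" "hd p = u" "last p = v"
        "path_edges p \<subseteq> edges (graph_Union A)"
      by (rule simple_path_exists)
    have "path_edges p \<subseteq> edges G" using p(5) simple_graph_Union_blocks(2)[OF G AB(1)] by blast
    then have pB: "path_edges p \<subseteq> edges (graph_Union B)"
      using path_in_connected_family[OF G AB(3,4) p(1,2)] p uvB by simp
    have "path_edges p \<subseteq> edges (graph_Union (A \<inter> B))"
    proof
      fix e assume "e \<in> path_edges p"
      then obtain H K where HK: "H \<in> A" "K \<in> B" "e \<in> edges H" "e \<in> edges K"
        using p(5) pB by (meson edges_graph_Union subsetD)
      \<comment> \<open>An edge determines its block, whereas a vertex may lie in several; this is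
        why the path is traced through its edges.\<close>
      then have "H = K" using blocks_edge_disjoint[OF G] AB by blast
      then show "e \<in> edges (graph_Union (A \<inter> B))" using HK by (auto simp: edges_graph_Union)
    qed
    then show ?thesis using path_edges_connected p by (metis hd_in_set last_in_set)
  qed
  then show ?thesis using AB by (auto simp: connected_families_def connected_graph_iff)
qed

lemma graph_Union_Un: "graph_Union (A \<union> B) = graph_Un (graph_Union A) (graph_Union B)"
  by (auto simp: graph_Union_def graph_Un_def)

lemma connected_graph_Union_blocks:
  fixes G :: "('v::finite) graph"
  assumes G: "simple_graph G" "connected_graph G"
  shows "connected_graph (graph_Union (blocks G))"
proof -
  have "edges G \<subseteq> edges (graph_Union (blocks G))"
    using edge_in_block[OF G(1)] by (metis edges_graph_Union subsetI)
  then show ?thesis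
    using adjrel_rtrancl_mono[of G "graph_Union (blocks G)"] G(2)
      simple_graph_Union_blocks(3)[OF G(1) subset_refl]
    unfolding connected_graph_iff by blast
qed

text \<open>Otherwise a walk starting on the \<open>C\<close> side never leaves it: the block of
  each traversed edge shares a vertex with a block in \<open>C\<close>, hence is in \<open>C\<close>
  itself. A walk to a vertex of a block outside \<open>C\<close> thus ends in a shared vertex after
  all.\<close>

lemma connected_families_crossing:
  assumes A: "A \<in> connected_families G" and G: "simple_graph G"
    and AC: "A \<inter> C \<noteq> {}" "\<not> A \<subseteq> C"
  shows "\<exists>x\<in>A \<inter> C. \<exists>y\<in>A - C. verts x \<inter> verts y \<noteq> {}"
proof (rule ccontr)
  assume "\<not> ?thesis"
  then have no: "verts x \<inter> verts y = {}" if "x \<in> A" "x \<in> C" "y \<in> A" "y \<notin> C" for x y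
    using that by auto
  have A': "A \<subseteq> blocks G" "connected_graph (graph_Union A)"
    using A by (auto simp: connected_families_def)
  obtain x z where xz: "x \<in> A \<inter> C" "z \<in> A - C" using AC by auto
  then obtain u v where uv: "u \<in> verts x" "v \<in> verts z"
    using block_connected(2)[OF G] A' by (metis DiffD1 IntD1 equals0I subsetD)
  have "(u, v) \<in> (adjrel (graph_Union A))\<^sup>*"
  proof -
    have "u \<in> verts (graph_Union A)" "v \<in> verts (graph_Union A)"
      using uv xz by (auto simp: verts_graph_Union)
    then show ?thesis using A'(2) by (simp add: connected_graph_iff)
  qed
  then have "\<exists>y\<in>A \<inter> C. v \<in> verts y"
  proof (induction rule: rtrancl_induct)
    case base
    then show ?case using uv xz by auto
  next
    case (step s t)
    then obtain y where y: "y \<in> A \<inter> C" "s \<in> verts y" by auto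
    obtain K where K: "K \<in> A" "{s, t} \<in> edges K"
      using step(2) by (auto simp: adjrel_def edges_graph_Union)
    have "K \<in> blocks G" using A' K(1) by blast
    then have "simple_graph K" using block_subgraph[OF G] by (simp add: subgraph_of_def)
    then have st: "s \<in> verts K" "t \<in> verts K" using simple_graph_edge[OF _ K(2)] by auto
    then have "K \<in> C" using no[of y K] y K(1) by auto
    then show ?case using K st by auto
  qed
  then obtain y where "y \<in> A \<inter> C" "v \<in> verts y" by auto
  then show False using no[of y z] xz uv by auto
qed

text \<open>The graph theory enters through \<open>Int_in\<close> and \<open>crossing\<close>;
  connectedness of \<open>G\<close> supplies \<open>full_in\<close>.\<close>

lemma connected_family_blocks:
  fixes G :: "('v::finite) graph"
  assumes G: "simple_graph G" "connected_graph G"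
  shows "connected_family (blocks G) (connected_families G) (\<lambda>H K. verts H \<inter> verts K \<noteq> {})"
proof
  show "finite (blocks G)" by simp
  show "A \<subseteq> blocks G" if "A \<in> connected_families G" for A
    using that by (simp add: connected_families_def)
  show "{} \<in> connected_families G"
    by (simp add: connected_families_def connected_graph_iff graph_Union_def)
  show "blocks G \<in> connected_families G"
    using connected_graph_Union_blocks[OF G] by (simp add: connected_families_def)
  show "{B} \<in> connected_families G" if "B \<in> blocks G" for B
    using block_connected(1)[OF G(1) that] that by (simp add: connected_families_def graph_Union_def)
  show "A \<inter> B \<in> connected_families G" if "A \<in> connected_families G" "B \<in> connected_families G" for A B
    using connected_families_Int[OF G(1) that] .
  show "verts B \<inter> verts B \<noteq> {}" if "B \<in> blocks G" for B
    using block_connected(2)[OF G(1) that] by simp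
  show "verts y \<inter> verts x \<noteq> {}" if "verts x \<inter> verts y \<noteq> {}" for x y :: "'v graph"
    using that by (simp add: Int_commute)
  show "A \<union> B \<in> connected_families G"
    if "A \<in> connected_families G" "B \<in> connected_families G" "x \<in> A" "y \<in> B"
      "verts x \<inter> verts y \<noteq> {}" for A B x y
  proof -
    have "verts (graph_Union A) \<inter> verts (graph_Union B) \<noteq> {}"
    proof -
      obtain w where "w \<in> verts x" "w \<in> verts y" using \<open>verts x \<inter> verts y \<noteq> {}\<close> by blast
      then have "w \<in> verts (graph_Union A)" "w \<in> verts (graph_Union B)"
        using that(3,4) by (auto simp: verts_graph_Union)
      then show ?thesis by blast
    qed
    then show ?thesis
      using connected_graph_Un[of "graph_Union A" "graph_Union B"] that
      by (auto simp: connected_families_def graph_Union_Un)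
  qed
  show "\<exists>x\<in>A \<inter> C. \<exists>y\<in>A - C. verts x \<inter> verts y \<noteq> {}"
    if "A \<in> connected_families G" "A \<inter> C \<noteq> {}" "\<not> A \<subseteq> C" for A C
    using connected_families_crossing[OF that(1) G(1) that(2,3)] .
qed

section \<open>Ideals\<close>

abbreviation monoms :: "'x set \<Rightarrow> 'x monom set" where
  "monoms X \<equiv> {m. Poly_Mapping.keys m \<subseteq> X}"

lemma keys_add_nat: "Poly_Mapping.keys (m + n) = Poly_Mapping.keys m \<union> Poly_Mapping.keys n"
  for m n :: "'x monom"
  by (auto simp: in_keys_iff lookup_add)

lemma polys_iff: "f \<in> polys X \<longleftrightarrow> Poly_Mapping.keys f \<subseteq> monoms X"
  by (auto simp: polys_def)

lemma polys_0: "0 \<in> polys X"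
  by (simp add: polys_def)

lemma polys_add: "f \<in> polys X \<Longrightarrow> g \<in> polys X \<Longrightarrow> f + g \<in> polys X"
  using Poly_Mapping.keys_add[of f g] by (auto simp: polys_iff dest: subsetD)

lemma polys_single: "m \<in> monoms X \<Longrightarrow> Poly_Mapping.single m c \<in> polys X"
  by (auto simp: polys_def)

lemma polys_mult:
  assumes "f \<in> polys X" "g \<in> polys X"
  shows "f * g \<in> polys X"
  unfolding polys_def mem_Collect_eq
proof
  fix m assume "m \<in> Poly_Mapping.keys (f * g)"
  then obtain a b where ab: "m = a + b" "a \<in> Poly_Mapping.keys f" "b \<in> Poly_Mapping.keys g"
    using keys_mult[of f g] by blast
  then show "Poly_Mapping.keys m \<subseteq> X" using assms by (auto simp: keys_add_nat polys_def)
qed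

lemma polys_1: "1 \<in> polys X"
  by (auto simp: polys_def)

lemma ideal_gen_least:
  assumes "F \<subseteq> I" "0 \<in> I" "\<And>f g. f \<in> I \<Longrightarrow> g \<in> I \<Longrightarrow> f + g \<in> I"
    and "\<And>q f. q \<in> polys X \<Longrightarrow> f \<in> I \<Longrightarrow> q * f \<in> I"
  shows "ideal_gen X F \<subseteq> I"
proof
  fix p assume "p \<in> ideal_gen X F"
  then obtain T q where p: "p = (\<Sum>f\<in>T. q f * f)" "finite T" "T \<subseteq> F" "\<forall>f\<in>T. q f \<in> polys X"
    by (auto simp: ideal_gen_def)
  from p(2-4) have "(\<Sum>f\<in>T. q f * f) \<in> I"
    by (induction T rule: finite_induct) (use assms in auto)
  then show "p \<in> I" using p by simp
qed

lemma ideal_genI: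
  "p = (\<Sum>f\<in>T. q f * f) \<Longrightarrow> finite T \<Longrightarrow> T \<subseteq> F \<Longrightarrow> (\<And>f. f \<in> T \<Longrightarrow> q f \<in> polys X) \<Longrightarrow>
    p \<in> ideal_gen X F"
  unfolding ideal_gen_def by (rule CollectI, rule exI[of _ T], rule exI[of _ q]) simp

lemma ideal_gen_0: "0 \<in> ideal_gen X F"
  unfolding ideal_gen_def by (rule CollectI, rule exI[of _ "{}"]) simp

lemma ideal_gen_base:
  assumes "f \<in> F"
  shows "f \<in> ideal_gen X F"
  by (rule ideal_genI[where T = "{f}" and q = "\<lambda>_. 1"]) (simp_all add: assms polys_1)

lemma ideal_gen_add:
  assumes "f \<in> ideal_gen X F" "g \<in> ideal_gen X F"
  shows "f + g \<in> ideal_gen X F"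
proof -
  obtain S p where p: "f = (\<Sum>h\<in>S. p h * h)" "finite S" "S \<subseteq> F" "\<forall>h\<in>S. p h \<in> polys X"
    using assms(1) by (auto simp: ideal_gen_def)
  obtain T q where q: "g = (\<Sum>h\<in>T. q h * h)" "finite T" "T \<subseteq> F" "\<forall>h\<in>T. q h \<in> polys X"
    using assms(2) by (auto simp: ideal_gen_def)
  \<comment> \<open>Padding the coefficients by zero lets both combinations range over the same
    generators.\<close>
  let ?p = "\<lambda>h. if h \<in> S then p h else 0" and ?q = "\<lambda>h. if h \<in> T then q h else 0"
  have "f = (\<Sum>h\<in>S \<union> T. ?p h * h)"
    unfolding p(1) using p q by (intro sum.mono_neutral_cong_left) auto
  moreover have "g = (\<Sum>h\<in>S \<union> T. ?q h * h)"
    unfolding q(1) using p q by (intro sum.mono_neutral_cong_left) auto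
  ultimately have "f + g = (\<Sum>h\<in>S \<union> T. (?p h + ?q h) * h)"
    by (simp add: sum.distrib distrib_right)
  then show ?thesis
    by (rule ideal_genI) (use p q in \<open>auto intro!: polys_add simp: polys_0\<close>)
qed

lemma ideal_gen_mult:
  assumes "p \<in> polys X" "f \<in> ideal_gen X F"
  shows "p * f \<in> ideal_gen X F"
proof -
  obtain T q where q: "f = (\<Sum>h\<in>T. q h * h)" "finite T" "T \<subseteq> F" "\<forall>h\<in>T. q h \<in> polys X"
    using assms(2) by (auto simp: ideal_gen_def)
  have "p * f = (\<Sum>h\<in>T. (p * q h) * h)"
    unfolding q(1) by (simp add: sum_distrib_left mult.assoc)
  then show ?thesis by (rule ideal_genI) (use q assms in \<open>auto intro: polys_mult\<close>)
qed

lemma ideal_gen_subset: "F \<subseteq> ideal_gen X F' \<Longrightarrow> ideal_gen X F \<subseteq> ideal_gen X F'"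
  by (rule ideal_gen_least) (simp_all add: ideal_gen_0 ideal_gen_add ideal_gen_mult)

lemma single_const_mult: "Poly_Mapping.single 0 c * Poly_Mapping.single k 1 = Poly_Mapping.single k c"
  for c :: "'k::field" and k :: "'a::monoid_add"
  by (simp add: mult_single)

lemma poly_eq_sum_single:
  "f = (\<Sum>m\<in>Poly_Mapping.keys f. Poly_Mapping.single m (Poly_Mapping.lookup f m))"
  by (rule poly_mapping_eqI)
    (auto simp: lookup_sum lookup_single when_def in_keys_iff if_distrib sum.delta' cong: if_cong)

section \<open>The toric homomorphism\<close>

text \<open>The exponent of the image of \<open>m\<close> under \<open>toric_map\<close>, which thus
  merely relabels monomials. The second component is the degree of \<open>m\<close>.\<close>

definition toric_exp :: "(int ^ 'n) monom \<Rightarrow> (int ^ 'n) \<times> nat" where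
  "toric_exp m = (\<Sum>a\<in>Poly_Mapping.keys m.
     (\<chi> i. int (Poly_Mapping.lookup m a) * a $ i, Poly_Mapping.lookup m a))"

lemma toric_exp_superset:
  assumes "finite A" "Poly_Mapping.keys m \<subseteq> A"
  shows "toric_exp m =
    (\<Sum>a\<in>A. (\<chi> i. int (Poly_Mapping.lookup m a) * a $ i, Poly_Mapping.lookup m a))"
  unfolding toric_exp_def using assms
  by (intro sum.mono_neutral_left) (auto simp: in_keys_iff zero_prod_def vec_eq_iff)

lemma toric_exp_add: "toric_exp (m + n) = toric_exp m + toric_exp n"
proof -
  let ?A = "Poly_Mapping.keys m \<union> Poly_Mapping.keys n"
  have "toric_exp k = (\<Sum>a\<in>?A. (\<chi> i. int (Poly_Mapping.lookup k a) * a $ i, Poly_Mapping.lookup k a))"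
    if "k \<in> {m, n, m + n}" for k
    using that by (intro toric_exp_superset) (auto simp: keys_add_nat)
  then show ?thesis
    by (simp add: sum.distrib[symmetric] lookup_add vec_eq_iff algebra_simps)
      (intro sum.cong refl, simp add: vec_eq_iff algebra_simps)
qed

lemma mdeg_superset:
  assumes "finite A" "Poly_Mapping.keys m \<subseteq> A"
  shows "mdeg m = (\<Sum>a\<in>A. Poly_Mapping.lookup m a)"
  unfolding mdeg_def using assms by (intro sum.mono_neutral_left) (auto simp: in_keys_iff)

lemma mdeg_add: "mdeg (m + n) = mdeg m + mdeg n"
proof -
  let ?A = "Poly_Mapping.keys m \<union> Poly_Mapping.keys n"
  have "mdeg k = (\<Sum>a\<in>?A. Poly_Mapping.lookup k a)" if "k \<in> {m, n, m + n}" for k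
    using that by (intro mdeg_superset) (auto simp: keys_add_nat)
  then show ?thesis by (simp add: sum.distrib[symmetric] lookup_add)
qed

lemma single_power_pair:
  fixes a :: "int ^ 'n"
  shows "(Poly_Mapping.single (a, 1 :: nat) (1 :: 'k::field)) ^ n
    = Poly_Mapping.single (\<chi> i. int n * a $ i, n) 1"
proof (induction n)
  case 0
  have "(\<chi> i. int 0 * a $ i, 0 :: nat) = 0" by (simp add: zero_prod_def vec_eq_iff)
  then show ?case by simp
next
  case (Suc n)
  have "(a, 1) + (\<chi> i. int n * a $ i, n) = (\<chi> i. int (Suc n) * a $ i, Suc n)"
    by (simp add: vec_eq_iff algebra_simps)
  then show ?case using Suc by (simp add: mult_single)
qed

lemma prod_single:
  "finite A \<Longrightarrow> (\<Prod>a\<in>A. Poly_Mapping.single (k a) (1 :: 'k::field))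
    = Poly_Mapping.single (\<Sum>a\<in>A. k a :: 'b::comm_monoid_add) 1"
  by (induction A rule: finite_induct) (simp_all add: mult_single)

lemma toric_map_eq:
  fixes f :: "(int ^ 'n, 'k::field) mpoly"
  shows "toric_map f =
    (\<Sum>m\<in>Poly_Mapping.keys f. Poly_Mapping.single (toric_exp m) (Poly_Mapping.lookup f m))"
  unfolding toric_map_def toric_exp_def single_power_pair
  by (intro sum.cong refl) (simp add: prod_single single_const_mult)

lemma toric_map_superset:
  fixes f :: "(int ^ 'n, 'k::field) mpoly"
  assumes "finite A" "Poly_Mapping.keys f \<subseteq> A"
  shows "toric_map f = (\<Sum>m\<in>A. Poly_Mapping.single (toric_exp m) (Poly_Mapping.lookup f m))"
  unfolding toric_map_eq using assms by (intro sum.mono_neutral_left) (auto simp: in_keys_iff)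

lemma toric_map_0: "toric_map (0 :: (int ^ 'n, 'k::field) mpoly) = 0"
  by (simp add: toric_map_eq)

lemma toric_map_add:
  fixes f g :: "(int ^ 'n, 'k::field) mpoly"
  shows "toric_map (f + g) = toric_map f + toric_map g"
proof -
  let ?A = "Poly_Mapping.keys f \<union> Poly_Mapping.keys g"
  have "toric_map h = (\<Sum>m\<in>?A. Poly_Mapping.single (toric_exp m) (Poly_Mapping.lookup h m))"
    if "h \<in> {f, g, f + g}" for h
    using that Poly_Mapping.keys_add[of f g] by (intro toric_map_superset) auto
  then show ?thesis by (simp add: sum.distrib[symmetric] lookup_add single_add)
qed

lemma toric_map_sum:
  fixes f :: "'i \<Rightarrow> (int ^ 'n, 'k::field) mpoly"
  shows "toric_map (sum f A) = (\<Sum>i\<in>A. toric_map (f i))"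
  by (induction A rule: infinite_finite_induct) (simp_all add: toric_map_0 toric_map_add)

lemma toric_map_single: "toric_map (Poly_Mapping.single m (c :: 'k::field)) = Poly_Mapping.single (toric_exp m) c"
  by (cases "c = 0") (simp_all add: toric_map_eq)

lemma toric_map_single_mult:
  fixes f :: "(int ^ 'n, 'k::field) mpoly"
  shows "toric_map (Poly_Mapping.single m c * f) = Poly_Mapping.single (toric_exp m) c * toric_map f"
proof -
  have "Poly_Mapping.single m c * f
      = (\<Sum>n\<in>Poly_Mapping.keys f. Poly_Mapping.single (m + n) (c * Poly_Mapping.lookup f n))"
    by (subst (1) poly_eq_sum_single[of f]) (simp add: sum_distrib_left mult_single)
  then show ?thesis
    by (simp add: toric_map_sum toric_map_single toric_map_eq[of f] sum_distrib_left mult_single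
        toric_exp_add)
qed

lemma toric_map_mult_eq_0:
  fixes f q :: "(int ^ 'n, 'k::field) mpoly"
  assumes "toric_map f = 0"
  shows "toric_map (q * f) = 0"
proof -
  have "q * f = (\<Sum>m\<in>Poly_Mapping.keys q. Poly_Mapping.single m (Poly_Mapping.lookup q m) * f)"
    by (subst (1) poly_eq_sum_single[of q]) (simp add: sum_distrib_right)
  then show ?thesis by (simp add: toric_map_sum toric_map_single_mult assms)
qed

text \<open>The coefficient of \<open>m\<close> in the image has to cancel, so another monomial of
  \<open>f\<close> has the same exponent.\<close>

lemma toric_map_other_key:
  fixes f :: "(int ^ 'n, 'k::field) mpoly"
  assumes f: "toric_map f = 0" and m: "m \<in> Poly_Mapping.keys f"
  obtains m' where "m' \<in> Poly_Mapping.keys f" "m' \<noteq> m" "toric_exp m' = toric_exp m"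
proof (rule ccontr)
  assume no: "\<not> thesis"
  have "Poly_Mapping.lookup (toric_map f) (toric_exp m)
      = (\<Sum>n\<in>Poly_Mapping.keys f. if n = m then Poly_Mapping.lookup f n else 0)"
    unfolding toric_map_eq lookup_sum
    by (intro sum.cong refl) (use that no in \<open>auto simp: lookup_single when_def\<close>)
  also have "\<dots> = Poly_Mapping.lookup f m" using m by simp
  finally show False using f m by (simp add: in_keys_iff)
qed

section \<open>The degree reverse lexicographic order\<close>

text \<open>Stated for a relation that is linear on \<open>D\<close> only, so that it covers
  variables in \<open>X\<close> as well as the monomials of one polynomial under the reversed term
  order.\<close>

lemma finite_linear_least:
  assumes "finite D" "D \<noteq> {}"
    and total: "\<And>x y. x \<in> D \<Longrightarrow> y \<in> D \<Longrightarrow> x \<noteq> y \<Longrightarrow> R x y \<or> R y x"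
    and trans: "\<And>x y z. x \<in> D \<Longrightarrow> y \<in> D \<Longrightarrow> z \<in> D \<Longrightarrow> R x y \<Longrightarrow> R y z \<Longrightarrow> R x z"
  shows "\<exists>l\<in>D. \<forall>j\<in>D. j \<noteq> l \<longrightarrow> R l j"
  using assms
proof (induction D rule: finite_ne_induct)
  case (singleton x)
  show ?case by simp
next
  case (insert x D)
  have "\<exists>l\<in>D. \<forall>j\<in>D. j \<noteq> l \<longrightarrow> R l j"
    by (rule insert.IH) (use insert.prems in \<open>blast+\<close>)
  then obtain l where l: "l \<in> D" "\<And>j. j \<in> D \<Longrightarrow> j \<noteq> l \<Longrightarrow> R l j" by blast
  show ?case
  proof (cases "R l x")
    case True
    then show ?thesis using l by (intro bexI[of _ l]) auto
  next
    case False
    then have "R x l" using insert.prems(1)[of x l] insert.hyps l by auto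
    then have "R x j" if "j \<in> D" for j
      using l(2)[OF that] insert.prems(2)[of x l j] l(1) that by (cases "j = l") auto
    then show ?thesis by auto
  qed
qed

lemma degrevlex_irrefl: "\<not> degrevlex_less r m m"
  by (simp add: degrevlex_less_def)

lemma degrevlex_add:
  "degrevlex_less r m m' \<Longrightarrow> degrevlex_less r (n + m) (n + m')"
  by (simp add: degrevlex_less_def mdeg_add lookup_add)

context
  fixes X :: "'x set" and r :: "'x rel"
  assumes r: "strict_linear_order_on X r"
begin

text \<open>The smaller of the two deciding variables decides the composite comparison: the other
  pair of monomials agrees at that variable, since a difference there would close a loop in
  \<open>r\<close>.\<close>

lemma degrevlex_trans:
  assumes X: "m1 \<in> monoms X" "m2 \<in> monoms X" "m3 \<in> monoms X"
    and less: "degrevlex_less r m1 m2" "degrevlex_less r m2 m3"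
  shows "degrevlex_less r m1 m3"
proof (cases "mdeg m1 = mdeg m2 \<and> mdeg m2 = mdeg m3")
  case False
  then show ?thesis using less by (auto simp: degrevlex_less_def)
next
  case True
  let ?l = Poly_Mapping.lookup
  have rt: "trans r" "irrefl r" "total_on X r" using r by (auto simp: strict_linear_order_on_def)
  obtain l where l: "?l m1 l > ?l m2 l" "\<And>j. ?l m1 j \<noteq> ?l m2 j \<Longrightarrow> j \<noteq> l \<Longrightarrow> (l, j) \<in> r"
    using less(1) True by (auto simp: degrevlex_less_def)
  obtain k where k: "?l m2 k > ?l m3 k" "\<And>j. ?l m2 j \<noteq> ?l m3 j \<Longrightarrow> j \<noteq> k \<Longrightarrow> (k, j) \<in> r"
    using less(2) True by (auto simp: degrevlex_less_def)
  have lX: "l \<in> X" and kX: "k \<in> X"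
    using l(1) k(1) X by (auto simp: in_keys_iff subset_iff)
  have noloop: "\<not> ((a, b) \<in> r \<and> (b, a) \<in> r)" for a b
    using rt by (meson irrefl_def transD)
  have "\<exists>l. ?l m1 l > ?l m3 l \<and> (\<forall>j. ?l m1 j \<noteq> ?l m3 j \<and> j \<noteq> l \<longrightarrow> (l, j) \<in> r)"
  proof (cases "l = k")
    case True
    show ?thesis
    proof (intro exI[of _ l] conjI allI impI)
      show "?l m3 l < ?l m1 l" using l k True by simp
      show "(l, j) \<in> r" if "?l m1 j \<noteq> ?l m3 j \<and> j \<noteq> l" for j
        using that l(2)[of j] k(2)[of j] True by (cases "?l m1 j = ?l m2 j") auto
    qed
  next
    case False
    then consider "(l, k) \<in> r" | "(k, l) \<in> r" using rt(3) lX kX by (auto simp: total_on_def)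
    then show ?thesis
    proof cases
      case 1
      show ?thesis
      proof (intro exI[of _ l] conjI allI impI)
        have "?l m2 l = ?l m3 l" using k(2)[of l] False 1 noloop by blast
        then show "?l m3 l < ?l m1 l" using l by simp
        show "(l, j) \<in> r" if "?l m1 j \<noteq> ?l m3 j \<and> j \<noteq> l" for j
        proof (cases "?l m1 j = ?l m2 j")
          case True
          then have "j = k \<or> (k, j) \<in> r" using k(2)[of j] that by auto
          then show ?thesis using 1 rt(1) by (meson transD)
        qed (use l that in auto)
      qed
    next
      case 2
      show ?thesis
      proof (intro exI[of _ k] conjI allI impI)
        have "?l m1 k = ?l m2 k" using l(2)[of k] False 2 noloop by blast
        then show "?l m3 k < ?l m1 k" using k by simp
        show "(k, j) \<in> r" if "?l m1 j \<noteq> ?l m3 j \<and> j \<noteq> k" for j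
        proof (cases "?l m2 j = ?l m3 j")
          case True
          then have "j = l \<or> (l, j) \<in> r" using l(2)[of j] that by auto
          then show ?thesis using 2 rt(1) by (meson transD)
        qed (use k that in auto)
      qed
    qed
  qed
  then show ?thesis using True by (auto simp: degrevlex_less_def)
qed

lemma degrevlex_total:
  assumes X: "m \<in> monoms X" "m' \<in> monoms X" and ne: "m \<noteq> m'"
  shows "degrevlex_less r m m' \<or> degrevlex_less r m' m"
proof (cases "mdeg m = mdeg m'")
  case False
  then show ?thesis by (auto simp: degrevlex_less_def)
next
  case True
  let ?l = Poly_Mapping.lookup
  let ?D = "{x. ?l m x \<noteq> ?l m' x}"
  have rt: "trans r" "total_on X r" using r by (auto simp: strict_linear_order_on_def)
  have sub: "?D \<subseteq> Poly_Mapping.keys m \<union> Poly_Mapping.keys m'" by (auto simp: in_keys_iff)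
  then have fin: "finite ?D" and DX: "?D \<subseteq> X" using X finite_subset[OF sub] by auto
  have "?D \<noteq> {}" using ne poly_mapping_eqI[of m m'] by auto
  with fin have "\<exists>l\<in>?D. \<forall>j\<in>?D. j \<noteq> l \<longrightarrow> (l, j) \<in> r"
    by (rule finite_linear_least[where R = "\<lambda>x y. (x, y) \<in> r"])
      (use rt DX in \<open>auto simp: total_on_def intro: transD\<close>)
  then obtain l where "?l m l \<noteq> ?l m' l" "\<forall>j\<in>?D. j \<noteq> l \<longrightarrow> (l, j) \<in> r" by auto
  then have "?l m l \<noteq> ?l m' l" "\<And>j. ?l m j \<noteq> ?l m' j \<Longrightarrow> j \<noteq> l \<Longrightarrow> (l, j) \<in> r" by auto
  then show ?thesis using True unfolding degrevlex_less_def
    by (cases "?l m l < ?l m' l") (metis, metis linorder_neqE_nat)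
qed

lemma leading_monomial_exists:
  assumes f: "f \<in> polys X" "f \<noteq> (0 :: ('x, 'k::field) mpoly)"
  obtains m where "m \<in> Poly_Mapping.keys f"
    "\<And>m'. m' \<in> Poly_Mapping.keys f \<Longrightarrow> m' \<noteq> m \<Longrightarrow> degrevlex_less r m' m"
proof -
  have sub: "Poly_Mapping.keys f \<subseteq> monoms X" using f by (simp add: polys_iff)
  have "\<exists>m\<in>Poly_Mapping.keys f. \<forall>m'\<in>Poly_Mapping.keys f. m' \<noteq> m \<longrightarrow> degrevlex_less r m' m"
  proof (rule finite_linear_least[where R = "\<lambda>a b. degrevlex_less r b a"])
    show "Poly_Mapping.keys f \<noteq> {}"
      using f(2) by (metis empty_iff in_keys_iff lookup_zero poly_mapping_eqI)
    show "degrevlex_less r y x \<or> degrevlex_less r x y"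
      if "x \<in> Poly_Mapping.keys f" "y \<in> Poly_Mapping.keys f" "x \<noteq> y" for x y
      using degrevlex_total[of x y] that sub by blast
    show "degrevlex_less r z x"
      if "x \<in> Poly_Mapping.keys f" "y \<in> Poly_Mapping.keys f" "z \<in> Poly_Mapping.keys f"
        "degrevlex_less r y x" "degrevlex_less r z y" for x y z
      using degrevlex_trans[of z y x] that sub by blast
  qed simp
  then show ?thesis using that by blast
qed

lemma initial_term_eq:
  assumes f: "f \<in> polys X" and m: "m \<in> Poly_Mapping.keys f"
    and max: "\<And>m'. m' \<in> Poly_Mapping.keys f \<Longrightarrow> m' \<noteq> m \<Longrightarrow> degrevlex_less r m' m"
  shows "initial_term r f = Poly_Mapping.single m 1"
proof -
  have sub: "Poly_Mapping.keys f \<subseteq> monoms X" using f by (simp add: polys_iff)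
  have "(THE m. m \<in> Poly_Mapping.keys f \<and>
          (\<forall>m'\<in>Poly_Mapping.keys f. m' \<noteq> m \<longrightarrow> degrevlex_less r m' m)) = m"
  proof (rule the_equality)
    fix n assume n: "n \<in> Poly_Mapping.keys f \<and>
      (\<forall>m'\<in>Poly_Mapping.keys f. m' \<noteq> n \<longrightarrow> degrevlex_less r m' n)"
    show "n = m"
    proof (rule ccontr)
      assume "n \<noteq> m"
      then have "degrevlex_less r n m" "degrevlex_less r m n" using n m max by auto
      moreover have "n \<in> monoms X" "m \<in> monoms X" using n m sub by auto
      ultimately show False using degrevlex_trans[of n m n] degrevlex_irrefl by blast
    qed
  qed (use m max in auto)
  then show ?thesis by (simp add: initial_term_def)
qed

end

section \<open>The Groebner basis\<close>

lemma inc_nth: "inc A $ H = (if H \<in> A then 1 else 0)"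
  by (simp add: inc_def)

lemma inc_eq_iff: "inc A = inc B \<longleftrightarrow> A = B"
  by (auto simp: vec_eq_iff inc_nth split: if_splits)

lemma inj_inc: "inj_on inc F"
  by (simp add: inj_on_def inc_eq_iff)

definition mon :: "('v::finite) graph set \<Rightarrow> (int ^ 'v graph) monom" where
  "mon A = Poly_Mapping.single (inc A) 1"

lemma lookup_mon: "Poly_Mapping.lookup (mon A) (inc B) = (if A = B then 1 else 0)"
  by (simp add: mon_def lookup_single when_def inc_eq_iff)

lemma keys_mon: "Poly_Mapping.keys (mon A) = {inc A}"
  by (simp add: mon_def)

lemma mvar_mult_mvar: "mvar (inc A) * mvar (inc B) = Poly_Mapping.single (mon A + mon B) 1"
  by (simp add: mvar_def mon_def mult_single)

lemma block_binomial_eq: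
  "block_binomial A B = Poly_Mapping.single (mon A + mon B) 1
     - Poly_Mapping.single (mon (A \<inter> B) + mon (A \<union> B)) 1"
  by (simp add: block_binomial_def mvar_mult_mvar)

lemma mdeg_mon: "mdeg (mon A) = 1"
  by (simp add: mdeg_def mon_def)

lemma toric_exp_mon: "toric_exp (mon A) = (inc A, 1)"
  by (simp add: toric_exp_def mon_def vec_eq_iff)

lemma toric_exp_uncross:
  "toric_exp (mon A + mon B) = toric_exp (mon (A \<inter> B) + mon (A \<union> B))"
  by (auto simp: toric_exp_add toric_exp_mon vec_eq_iff inc_nth)

locale block_family = connected_family E F adj
  for E :: "('v::finite) graph set" and F adj
begin

abbreviation X :: "(int ^ 'v graph) set" where
  "X \<equiv> inc ` F"

text \<open>For monomials in \<open>X\<close>: those divisible by no leading product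
  \<open>x_A * x_B\<close> of an incompatible pair, i.e. the standard monomials of the candidate
  initial ideal.\<close>

definition standard :: "(int ^ 'v graph) monom \<Rightarrow> bool" where
  "standard m \<longleftrightarrow> compatible {A \<in> F. Poly_Mapping.lookup m (inc A) \<noteq> 0}"

definition binomials :: "(int ^ 'v graph, 'k::field) mpoly set" where
  "binomials = {block_binomial A B | A B. A \<in> F \<and> B \<in> F \<and> incompatible A B}"

lemma toric_exp_family:
  assumes "m \<in> monoms X"
  shows "toric_exp m =
    (\<Sum>A\<in>F. (\<chi> H. if H \<in> A then int (Poly_Mapping.lookup m (inc A)) else 0,
      Poly_Mapping.lookup m (inc A)))"
proof -
  have "toric_exp m =
      (\<Sum>A\<in>F. (\<chi> i. int (Poly_Mapping.lookup m (inc A)) * inc A $ i, Poly_Mapping.lookup m (inc A)))"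
    using toric_exp_superset[of X m] assms finite_F by (simp add: sum.reindex[OF inj_inc] o_def)
  also have "\<dots> = (\<Sum>A\<in>F. (\<chi> H. if H \<in> A then int (Poly_Mapping.lookup m (inc A)) else 0,
      Poly_Mapping.lookup m (inc A)))"
    by (intro sum.cong refl) (simp add: vec_eq_iff inc_nth)
  finally show ?thesis .
qed

text \<open>Multiplicities are weights: the exponents of \<open>y\<close> are their marginals and
  the exponent of \<open>s\<close> is their total, so \<open>weights_unique\<close> applies.\<close>

lemma standard_unique:
  assumes m: "m \<in> monoms X" "standard m" and n: "n \<in> monoms X" "standard n"
    and eq: "toric_exp m = toric_exp n"
  shows "m = n"
proof -
  let ?u = "\<lambda>m A. real (Poly_Mapping.lookup m (inc A))"
  have marg: "(\<Sum>A\<in>{A \<in> F. e \<in> A}. ?u k A) = real_of_int (fst (toric_exp k) $ e)"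
    if "k \<in> monoms X" for k e
  proof -
    have "fst (toric_exp k) $ e = (\<Sum>A\<in>F. if e \<in> A then int (Poly_Mapping.lookup k (inc A)) else 0)"
      by (simp add: toric_exp_family[OF that] fst_sum)
    also have "\<dots> = (\<Sum>A\<in>{A \<in> F. e \<in> A}. int (Poly_Mapping.lookup k (inc A)))"
      using finite_F by (intro sum.mono_neutral_cong_right) auto
    finally show ?thesis by simp
  qed
  have total: "sum (?u k) F = real (snd (toric_exp k))" if "k \<in> monoms X" for k
    by (simp add: toric_exp_family[OF that] snd_sum)
  have u: "?u m A = ?u n A" if "A \<in> F" for A
  proof (rule weights_unique[OF _ _ _ _ _ _ that])
    show "compatible {B \<in> F. ?u m B \<noteq> 0}" "compatible {B \<in> F. ?u n B \<noteq> 0}"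
      using m(2) n(2) by (simp_all add: standard_def)
    show "(\<Sum>B\<in>{B \<in> F. e \<in> B}. ?u m B) = (\<Sum>B\<in>{B \<in> F. e \<in> B}. ?u n B)" for e
      unfolding marg[OF m(1)] marg[OF n(1)] eq ..
    show "sum (?u m) F = sum (?u n) F"
      unfolding total[OF m(1)] total[OF n(1)] eq ..
  qed simp_all
  show ?thesis
  proof (rule poly_mapping_eqI)
    fix k
    show "Poly_Mapping.lookup m k = Poly_Mapping.lookup n k"
    proof (cases "k \<in> X")
      case True
      then show ?thesis using u by auto
    next
      case False
      then have "k \<notin> Poly_Mapping.keys m" "k \<notin> Poly_Mapping.keys n" using m(1) n(1) by auto
      then show ?thesis by (simp add: in_keys_iff)
    qed
  qed
qed

lemma not_standardE:
  assumes "m \<in> monoms X" "\<not> standard m"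
  obtains A B n where "A \<in> F" "B \<in> F" "incompatible A B" "n \<in> monoms X" "m = n + (mon A + mon B)"
proof -
  obtain A B where AB: "A \<in> F" "B \<in> F" "incompatible A B"
    "Poly_Mapping.lookup m (inc A) \<noteq> 0" "Poly_Mapping.lookup m (inc B) \<noteq> 0"
    using assms(2) by (auto simp: standard_def compatible_def)
  have ne: "inc A \<noteq> inc B" using AB by (auto simp: inc_eq_iff incompatible_def)
  \<comment> \<open>Subtraction of exponents truncates at 0; here it is exact, because the two
    variables differ and both divide \<open>m\<close>.\<close>
  define n where "n = m - (mon A + mon B)"
  have n: "m = n + (mon A + mon B)"
    by (rule poly_mapping_eqI)
      (use AB ne in \<open>auto simp: n_def lookup_add lookup_minus mon_def lookup_single when_def\<close>)
  then have "n \<in> monoms X" using assms(1) by (auto simp: keys_add_nat)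
  then show ?thesis using that AB n by blast
qed

lemma mdeg_family: "m \<in> monoms X \<Longrightarrow> mdeg m = (\<Sum>A\<in>F. Poly_Mapping.lookup m (inc A))"
  using mdeg_superset[of X m] finite_F by (simp add: sum.reindex[OF inj_inc] o_def)

text \<open>Termination measure for uncrossing: it increases with each replacement and is bounded in
  terms of the degree, so well-foundedness of the term order is never invoked.\<close>

definition potential :: "(int ^ 'v graph) monom \<Rightarrow> nat" where
  "potential m = (\<Sum>A\<in>F. Poly_Mapping.lookup m (inc A) * (card A)\<^sup>2)"

lemma potential_add: "potential (m + n) = potential m + potential n"
  by (simp add: potential_def lookup_add distrib_right sum.distrib)

lemma potential_mon: "A \<in> F \<Longrightarrow> potential (mon A) = (card A)\<^sup>2"
  using finite_F by (simp add: potential_def lookup_mon if_distrib[of "\<lambda>x. x * _"] cong: if_cong)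

lemma potential_le:
  assumes "m \<in> monoms X"
  shows "potential m \<le> mdeg m * (card E)\<^sup>2"
  unfolding mdeg_family[OF assms] potential_def sum_distrib_right
  by (intro sum_mono mult_left_mono power_mono card_mono finite_E F_subset) auto

lemma potential_uncross:
  assumes "A \<in> F" "B \<in> F" "incompatible A B"
  shows "potential (mon A + mon B) < potential (mon (A \<inter> B) + mon (A \<union> B))"
proof -
  have F: "A \<inter> B \<in> F" "A \<union> B \<in> F" using assms Int_in by (auto simp: incompatible_def)
  have "real ((card A)\<^sup>2 + (card B)\<^sup>2) < real ((card (A \<inter> B))\<^sup>2 + (card (A \<union> B))\<^sup>2)"
    using card_square_uncross[OF assms] by simp
  then show ?thesis using assms F by (simp only: potential_add potential_mon of_nat_less_iff)
qed

lemma binomial_monoms: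
  assumes "A \<in> F" "B \<in> F" "incompatible A B"
  shows "mon A + mon B \<in> monoms X" "mon (A \<inter> B) + mon (A \<union> B) \<in> monoms X"
  using assms Int_in by (auto simp: keys_add_nat keys_mon incompatible_def)

end

section \<open>Reduction by uncrossing with respect to the term order\<close>

locale ordered_block_family = block_family E F adj
  for E :: "('v::finite) graph set" and F adj +
  fixes r :: "(int ^ 'v graph) rel"
  assumes order: "strict_linear_order_on (inc ` F) r"
    and order_supset: "\<And>A B. A \<in> F \<Longrightarrow> B \<in> F \<Longrightarrow> B \<subset> A \<Longrightarrow> (inc A, inc B) \<in> r"
begin

text \<open>The union is the smallest variable involved and occurs only in the uncrossed monomial,
  which in the reverse lexicographic order makes that monomial smaller.\<close>

lemma uncross_less:
  assumes AB: "A \<in> F" "B \<in> F" "incompatible A B"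
  shows "degrevlex_less r (mon (A \<inter> B) + mon (A \<union> B)) (mon A + mon B)"
proof -
  have sub: "A \<subset> A \<union> B" "B \<subset> A \<union> B" "A \<inter> B \<subset> A \<union> B" and U: "A \<union> B \<in> F"
    using AB by (auto simp: incompatible_def)
  have less: "(inc (A \<union> B), inc C) \<in> r" if "C \<in> {A, B, A \<inter> B}" for C
    using that AB Int_in U sub by (intro order_supset) auto
  show ?thesis
    unfolding degrevlex_less_def
  proof (intro disjI2 conjI exI[of _ "inc (A \<union> B)"] allI impI)
    show "mdeg (mon (A \<inter> B) + mon (A \<union> B)) = mdeg (mon A + mon B)"
      by (simp add: mdeg_add mdeg_mon)
    show "Poly_Mapping.lookup (mon A + mon B) (inc (A \<union> B))
        < Poly_Mapping.lookup (mon (A \<inter> B) + mon (A \<union> B)) (inc (A \<union> B))"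
      using sub by (auto simp: lookup_add lookup_mon)
    fix j
    assume "Poly_Mapping.lookup (mon (A \<inter> B) + mon (A \<union> B)) j \<noteq> Poly_Mapping.lookup (mon A + mon B) j
      \<and> j \<noteq> inc (A \<union> B)"
    then have "j \<in> {inc A, inc B, inc (A \<inter> B)}"
      by (auto simp: lookup_add mon_def lookup_single when_def split: if_splits)
    then show "(inc (A \<union> B), j) \<in> r" using less by auto
  qed
qed

lemma keys_binomial:
  assumes AB: "A \<in> F" "B \<in> F" "incompatible A B"
  shows "Poly_Mapping.keys (block_binomial A B :: (int ^ 'v graph, 'k::field) mpoly)
    = {mon A + mon B, mon (A \<inter> B) + mon (A \<union> B)}"
proof -
  have "mon A + mon B \<noteq> mon (A \<inter> B) + mon (A \<union> B)"
    using uncross_less[OF AB] degrevlex_irrefl by metis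
  then show ?thesis
    by (auto simp: block_binomial_eq in_keys_iff lookup_minus lookup_single when_def split: if_splits)
qed

lemma binomial_polys:
  assumes "A \<in> F" "B \<in> F" "incompatible A B"
  shows "(block_binomial A B :: (int ^ 'v graph, 'k::field) mpoly) \<in> polys X"
  using binomial_monoms[OF assms] by (simp add: polys_iff keys_binomial[OF assms])

lemma initial_term_binomial:
  assumes "A \<in> F" "B \<in> F" "incompatible A B"
  shows "initial_term r (block_binomial A B :: (int ^ 'v graph, 'k::field) mpoly)
    = mvar (inc A) * mvar (inc B)"
  unfolding mvar_mult_mvar
  using uncross_less[OF assms] keys_binomial[OF assms, where 'k = 'k]
  by (intro initial_term_eq[OF order binomial_polys[OF assms]]) auto

text \<open>Each uncrossing keeps the degree and the toric exponent, lowers the monomial, and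
  changes it by a multiple of a binomial. The growing potential brings this to an end at a standard
  monomial.\<close>

lemma normal_form_exists:
  fixes m :: "(int ^ 'v graph) monom"
  assumes "m \<in> monoms X"
  shows "\<exists>n. n \<in> monoms X \<and> standard n \<and> toric_exp n = toric_exp m \<and>
    (n = m \<or> degrevlex_less r n m) \<and>
    Poly_Mapping.single m 1 - Poly_Mapping.single n 1
      \<in> ideal_gen X (binomials :: (int ^ 'v graph, 'k::field) mpoly set)"
  using assms
proof (induction "mdeg m * (card E)\<^sup>2 - potential m" arbitrary: m rule: less_induct)
  case less
  let ?J = "ideal_gen X (binomials :: (int ^ 'v graph, 'k) mpoly set)"
  show ?case
  proof (cases "standard m")
    case True
    then show ?thesis using less.prems by (intro exI[of _ m]) (simp add: ideal_gen_0)
  next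
    case False
    then obtain A B k where AB: "A \<in> F" "B \<in> F" "incompatible A B" and k: "k \<in> monoms X"
      and m: "m = k + (mon A + mon B)"
      using not_standardE less.prems by blast
    define m' where "m' = k + (mon (A \<inter> B) + mon (A \<union> B))"
    have m': "m' \<in> monoms X" using k binomial_monoms(2)[OF AB] by (auto simp: m'_def keys_add_nat)
    have mdeg: "mdeg m' = mdeg m" by (simp add: m'_def m mdeg_add mdeg_mon)
    have "potential m < potential m'"
      using potential_uncross[OF AB] by (simp add: m'_def m potential_add)
    then have "mdeg m' * (card E)\<^sup>2 - potential m' < mdeg m * (card E)\<^sup>2 - potential m"
      using potential_le[OF m'] mdeg by simp
    then obtain n where n: "n \<in> monoms X" "standard n" "toric_exp n = toric_exp m'"
        "n = m' \<or> degrevlex_less r n m'"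
        "Poly_Mapping.single m' 1 - Poly_Mapping.single n 1 \<in> ?J"
      using less.hyps m' by blast
    have lm: "degrevlex_less r m' m" unfolding m'_def m by (intro degrevlex_add uncross_less AB)
    have "degrevlex_less r n m"
      using n(4) lm degrevlex_trans[OF order n(1) m' less.prems] by auto
    moreover have "toric_exp n = toric_exp m"
      using n(3) toric_exp_uncross[of A B] by (simp add: m m'_def toric_exp_add)
    moreover have "Poly_Mapping.single m 1 - Poly_Mapping.single n 1 \<in> ?J"
    proof -
      have "block_binomial A B \<in> (binomials :: (int ^ 'v graph, 'k) mpoly set)"
        using AB by (auto simp: binomials_def)
      then have "Poly_Mapping.single k 1 * block_binomial A B \<in> ?J"
        using k by (intro ideal_gen_mult polys_single ideal_gen_base)
      moreover have "Poly_Mapping.single k 1 * block_binomial A B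
          = (Poly_Mapping.single m 1 - Poly_Mapping.single m' 1 :: (int ^ 'v graph, 'k) mpoly)"
        by (simp add: block_binomial_eq right_diff_distrib mult_single m m'_def)
      ultimately have "(Poly_Mapping.single m 1 - Poly_Mapping.single m' 1)
          + (Poly_Mapping.single m' 1 - Poly_Mapping.single n 1) \<in> ?J"
        using n(5) by (intro ideal_gen_add) auto
      then show ?thesis by simp
    qed
    ultimately show ?thesis using n by blast
  qed
qed

definition toric :: "(int ^ 'v graph, 'k::field) mpoly set" where
  "toric = {f \<in> polys X. toric_map f = 0}"

lemma toric_0: "0 \<in> toric"
  by (simp add: toric_def polys_0 toric_map_0)

lemma toric_add: "f \<in> toric \<Longrightarrow> g \<in> toric \<Longrightarrow> f + g \<in> toric"
  by (simp add: toric_def polys_add toric_map_add)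

lemma toric_mult: "q \<in> polys X \<Longrightarrow> f \<in> toric \<Longrightarrow> q * f \<in> toric"
  by (simp add: toric_def polys_mult toric_map_mult_eq_0)

lemma single_diff_toric:
  assumes "m \<in> monoms X" "n \<in> monoms X" "toric_exp m = toric_exp n"
  shows "Poly_Mapping.single m 1 - Poly_Mapping.single n 1
    \<in> (toric :: (int ^ 'v graph, 'k::field) mpoly set)"
proof -
  let ?f = "Poly_Mapping.single m 1 + Poly_Mapping.single n (- 1) :: (int ^ 'v graph, 'k) mpoly"
  have "toric_map ?f = 0"
    using assms(3) by (simp add: toric_map_add toric_map_single flip: single_add)
  moreover have "?f \<in> polys X" using assms by (intro polys_add polys_single)
  moreover have "?f = Poly_Mapping.single m 1 - Poly_Mapping.single n 1"
    by (simp add: single_uminus)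
  ultimately show ?thesis by (simp add: toric_def)
qed

lemma binomials_toric: "(binomials :: (int ^ 'v graph, 'k::field) mpoly set) \<subseteq> toric"
proof
  fix f :: "(int ^ 'v graph, 'k) mpoly" assume "f \<in> binomials"
  then obtain A B where AB: "A \<in> F" "B \<in> F" "incompatible A B" and f: "f = block_binomial A B"
    by (auto simp: binomials_def)
  show "f \<in> toric"
    unfolding f block_binomial_eq
    using binomial_monoms[OF AB] toric_exp_uncross by (rule single_diff_toric)
qed

text \<open>Both monomials reduce to standard monomials with the same toric exponent, which
  coincide.\<close>

lemma single_diff_ideal:
  assumes m: "m \<in> monoms X" and n: "n \<in> monoms X" and eq: "toric_exp m = toric_exp n"
  shows "Poly_Mapping.single m 1 - Poly_Mapping.single n 1
    \<in> ideal_gen X (binomials :: (int ^ 'v graph, 'k::field) mpoly set)"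
proof -
  let ?J = "ideal_gen X (binomials :: (int ^ 'v graph, 'k) mpoly set)"
  obtain m' where m': "m' \<in> monoms X" "standard m'" "toric_exp m' = toric_exp m"
      "Poly_Mapping.single m 1 - Poly_Mapping.single m' 1 \<in> ?J"
    using normal_form_exists[OF m] by blast
  obtain n' where n': "n' \<in> monoms X" "standard n'" "toric_exp n' = toric_exp n"
      "Poly_Mapping.single n 1 - Poly_Mapping.single n' 1 \<in> ?J"
    using normal_form_exists[OF n] by blast
  have "m' = n'" using standard_unique m' n' eq by simp
  have "- 1 = (Poly_Mapping.single 0 (- 1) :: (int ^ 'v graph, 'k) mpoly)"
    by (simp add: single_uminus)
  then have "- 1 \<in> (polys X :: (int ^ 'v graph, 'k) mpoly set)" by (simp add: polys_single)
  then have "- 1 * (Poly_Mapping.single n 1 - Poly_Mapping.single n' 1) \<in> ?J"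
    using n'(4) by (rule ideal_gen_mult)
  then have "(Poly_Mapping.single m 1 - Poly_Mapping.single m' 1)
      + - 1 * (Poly_Mapping.single n 1 - Poly_Mapping.single n' 1) \<in> ?J"
    using m'(4) by (intro ideal_gen_add)
  then show ?thesis using \<open>m' = n'\<close> by simp
qed

text \<open>Two monomials \<open>m\<close>, \<open>n\<close> of \<open>f\<close> share a toric
  exponent. Subtracting the coefficient of \<open>m\<close> times their difference removes
  \<open>m\<close> and adds no monomial, so the support shrinks while the polynomial stays in the
  toric ideal.\<close>

lemma toric_subset_ideal:
  "(toric :: (int ^ 'v graph, 'k::field) mpoly set) \<subseteq> ideal_gen X binomials"
proof
  fix f :: "(int ^ 'v graph, 'k) mpoly" assume "f \<in> toric"
  then show "f \<in> ideal_gen X binomials"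
  proof (induction "card (Poly_Mapping.keys f)" arbitrary: f rule: less_induct)
    case less
    show ?case
    proof (cases "f = 0")
      case True
      then show ?thesis by (simp add: ideal_gen_0)
    next
      case False
      then obtain m where m: "m \<in> Poly_Mapping.keys f"
        by (metis ex_in_conv in_keys_iff lookup_zero poly_mapping_eqI)
      obtain n where n: "n \<in> Poly_Mapping.keys f" "n \<noteq> m" "toric_exp n = toric_exp m"
        using toric_map_other_key[OF _ m] less.prems by (auto simp: toric_def)
      have mn: "m \<in> monoms X" "n \<in> monoms X"
        using m n less.prems by (auto simp: toric_def polys_def)
      define d :: "(int ^ 'v graph, 'k) mpoly"
        where "d = Poly_Mapping.single m 1 - Poly_Mapping.single n 1"
      define c where "c = Poly_Mapping.lookup f m"
      define g where "g = f + Poly_Mapping.single 0 (- c) * d"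
      have g: "g = f - Poly_Mapping.single m c + Poly_Mapping.single n c"
        by (simp add: g_def d_def right_diff_distrib single_const_mult single_uminus mult_single)
      have "g \<in> toric"
        unfolding g_def d_def using less.prems single_diff_toric[OF mn] n(3)
        by (intro toric_add toric_mult polys_single) auto
      moreover have "Poly_Mapping.keys g \<subseteq> Poly_Mapping.keys f - {m}"
        using n(1,2) unfolding g
        by (auto simp: in_keys_iff lookup_add lookup_minus lookup_single when_def c_def split: if_splits)
      then have "card (Poly_Mapping.keys g) < card (Poly_Mapping.keys f)"
        using m by (meson card_Diff1_less card_mono finite_Diff finite_keys order_le_less_trans)
      ultimately have gJ: "g \<in> ideal_gen X binomials" by (intro less.hyps)
      have "f = g + Poly_Mapping.single 0 c * d"
        by (simp add: g_def single_uminus)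
      moreover have "Poly_Mapping.single 0 c * d \<in> ideal_gen X binomials"
        unfolding d_def using single_diff_ideal[OF mn] n(3)
        by (intro ideal_gen_mult polys_single) auto
      ultimately show ?thesis using gJ ideal_gen_add by metis
    qed
  qed
qed

text \<open>Another monomial \<open>m'\<close> of \<open>f\<close> shares the toric exponent of the
  leading monomial \<open>m\<close>. If \<open>m\<close> were standard, it would be the normal form
  of \<open>m'\<close> and so lie below it. Hence \<open>m\<close> is a multiple of some leading
  product.\<close>

lemma initial_term_toric:
  fixes f :: "(int ^ 'v graph, 'k::field) mpoly"
  assumes f: "f \<in> toric" "f \<noteq> 0"
  shows "initial_term r f \<in> ideal_gen X (initial_term r ` ((binomials :: (int ^ 'v graph, 'k) mpoly set) - {0}))"
proof -
  have fX: "f \<in> polys X" using f by (simp add: toric_def)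
  obtain m where m: "m \<in> Poly_Mapping.keys f"
    and max: "\<And>m'. m' \<in> Poly_Mapping.keys f \<Longrightarrow> m' \<noteq> m \<Longrightarrow> degrevlex_less r m' m"
    using leading_monomial_exists[OF order fX f(2)] by blast
  obtain m' where m': "m' \<in> Poly_Mapping.keys f" "m' \<noteq> m" "toric_exp m' = toric_exp m"
    using toric_map_other_key[OF _ m] f by (auto simp: toric_def)
  have mX: "m \<in> monoms X" "m' \<in> monoms X" using m m' fX by (auto simp: polys_def)
  have "\<not> standard m"
  proof
    assume st: "standard m"
    obtain n where n: "n \<in> monoms X" "standard n" "toric_exp n = toric_exp m'"
        "n = m' \<or> degrevlex_less r n m'"
      using normal_form_exists[OF mX(2)] by blast
    then have "n = m" using standard_unique mX(1) st m'(3) by simp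
    then have "degrevlex_less r m m'" using n(4) m'(2) by simp
    then show False
      using max[OF m'(1,2)] degrevlex_trans[OF order mX(1,2,1)] degrevlex_irrefl by blast
  qed
  then obtain A B n where AB: "A \<in> F" "B \<in> F" "incompatible A B" and n: "n \<in> monoms X"
    and eq: "m = n + (mon A + mon B)"
    using not_standardE mX(1) by blast
  let ?b = "block_binomial A B :: (int ^ 'v graph, 'k) mpoly"
  have "?b \<noteq> 0" using keys_binomial[OF AB, where 'k = 'k] by auto
  then have "initial_term r ?b \<in> initial_term r ` (binomials - {0})"
    using AB by (auto simp: binomials_def)
  then have "Poly_Mapping.single n 1 * initial_term r ?b
      \<in> ideal_gen X (initial_term r ` ((binomials :: (int ^ 'v graph, 'k) mpoly set) - {0}))"
    using n by (intro ideal_gen_mult polys_single ideal_gen_base)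
  moreover have "initial_term r f = Poly_Mapping.single m 1"
    by (rule initial_term_eq[OF order fX m max])
  ultimately show ?thesis
    by (simp add: initial_term_binomial[OF AB] mvar_mult_mvar mult_single eq)
qed

theorem groebner_basis_binomials:
  "groebner_basis X r (binomials :: (int ^ 'v graph, 'k::field) mpoly set) toric"
  unfolding groebner_basis_def
proof (intro conjI)
  let ?B = "binomials :: (int ^ 'v graph, 'k) mpoly set"
  show "?B \<subseteq> toric" by (rule binomials_toric)
  show "ideal_gen X ?B = toric"
    using toric_subset_ideal ideal_gen_least[OF binomials_toric toric_0 toric_add toric_mult] by blast
  show "ideal_gen X (initial_term r ` (?B - {0})) = ideal_gen X (initial_term r ` (toric - {0}))"
  proof
    have "initial_term r ` (?B - {0}) \<subseteq> initial_term r ` (toric - {0})"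
      using binomials_toric by blast
    then show "ideal_gen X (initial_term r ` (?B - {0})) \<subseteq> ideal_gen X (initial_term r ` (toric - {0}))"
      by (intro ideal_gen_subset) (auto intro: ideal_gen_base)
    show "ideal_gen X (initial_term r ` (toric - {0})) \<subseteq> ideal_gen X (initial_term r ` (?B - {0}))"
      by (intro ideal_gen_subset) (auto intro: initial_term_toric)
  qed
qed

end

section \<open>The regular triangulation\<close>

lemma convex_hull_image:
  fixes p :: "'i \<Rightarrow> 'b::real_vector"
  assumes I: "finite I" "inj_on p I"
  shows "convex hull (p ` I) = {\<Sum>i\<in>I. u i *\<^sub>R p i | u. (\<forall>i\<in>I. 0 \<le> u i) \<and> sum u I = 1}"
proof (intro equalityI subsetI)
  fix x assume "x \<in> convex hull (p ` I)"
  then obtain u where "\<forall>y\<in>p ` I. 0 \<le> u y" "sum u (p ` I) = 1" "(\<Sum>y\<in>p ` I. u y *\<^sub>R y) = x"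
    unfolding convex_hull_finite[OF finite_imageI[OF I(1)]] by auto
  then show "x \<in> {\<Sum>i\<in>I. u i *\<^sub>R p i | u. (\<forall>i\<in>I. 0 \<le> u i) \<and> sum u I = 1}"
    by (intro CollectI exI[of _ "u \<circ> p"]) (auto simp: sum.reindex[OF I(2)] o_def)
next
  fix x assume "x \<in> {\<Sum>i\<in>I. u i *\<^sub>R p i | u. (\<forall>i\<in>I. 0 \<le> u i) \<and> sum u I = 1}"
  then obtain u where u: "x = (\<Sum>i\<in>I. u i *\<^sub>R p i)" "\<forall>i\<in>I. 0 \<le> u i" "sum u I = 1" by auto
  show "x \<in> convex hull (p ` I)"
    unfolding u(1) by (rule convex_sum) (use u I in \<open>auto intro: hull_inc\<close>)
qed

definition chi :: "('v::finite) graph set \<Rightarrow> real ^ 'v graph" where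
  "chi A = rvec (inc A)"

lemma chi_nth: "chi A $ H = (if H \<in> A then 1 else 0)"
  by (simp add: chi_def rvec_def inc_nth)

lemma chi_eq_iff: "chi A = chi B \<longleftrightarrow> A = B"
  by (auto simp: vec_eq_iff chi_nth split: if_splits)

lemma inj_chi: "inj_on chi N"
  by (simp add: inj_on_def chi_eq_iff)

lemma chi_empty: "chi {} = 0"
  by (simp add: vec_eq_iff chi_nth)

lemma chi_modular: "chi (A \<inter> B) + chi (A \<union> B) = chi A + chi B"
  by (auto simp: vec_eq_iff chi_nth)

lemma sum_chi_nth:
  "finite N \<Longrightarrow> (\<Sum>A\<in>N. u A *\<^sub>R chi A) $ H = (\<Sum>A\<in>{A \<in> N. H \<in> A}. u A)"
proof -
  assume "finite N"
  have "(\<Sum>A\<in>N. u A *\<^sub>R chi A) $ H = (\<Sum>A\<in>N. if H \<in> A then u A else 0)"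
    by (simp add: chi_nth if_distrib cong: if_cong)
  also have "\<dots> = (\<Sum>A\<in>{A \<in> N. H \<in> A}. u A)"
    using \<open>finite N\<close> by (intro sum.mono_neutral_cong_right) auto
  finally show ?thesis .
qed

context block_family
begin

section \<open>Simplices spanned by compatible families\<close>

abbreviation polytope_of :: "'v graph set set \<Rightarrow> (real ^ 'v graph) set" where
  "polytope_of N \<equiv> convex hull (chi ` N)"

lemma polytope_of_eq:
  assumes "finite N"
  shows "polytope_of N = {\<Sum>A\<in>N. u A *\<^sub>R chi A | u. (\<forall>A\<in>N. 0 \<le> u A) \<and> sum u N = 1}"
  by (rule convex_hull_image[OF assms inj_chi])

text \<open>Fix a vertex \<open>B\<close> with positive weight in a convex combination. Coordinates
  in \<open>B\<close> are then positive and at most 1, the others nonnegative and below 1;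
  integrality leaves only the incidence vector of \<open>B\<close>.\<close>

lemma lattice_points_polytope: "lattice_points (polytope_of F) = inc ` F"
proof
  show "inc ` F \<subseteq> lattice_points (polytope_of F)"
    by (auto simp: lattice_points_def chi_def[symmetric] intro: hull_inc)
  show "lattice_points (polytope_of F) \<subseteq> inc ` F"
  proof
    fix a assume "a \<in> lattice_points (polytope_of F)"
    then obtain u where u: "rvec a = (\<Sum>A\<in>F. u A *\<^sub>R chi A)" "\<forall>A\<in>F. 0 \<le> u A" "sum u F = 1"
      by (auto simp: lattice_points_def polytope_of_eq[OF finite_F])
    have a: "real_of_int (a $ e) = (\<Sum>A\<in>{A \<in> F. e \<in> A}. u A)" for e
      using sum_chi_nth[OF finite_F, of u e] unfolding u(1)[symmetric] by (simp add: rvec_def)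
    have "\<exists>B\<in>F. u B \<noteq> 0"
    proof (rule ccontr)
      assume "\<not> ?thesis"
      then have "sum u F = 0" by (intro sum.neutral) auto
      then show False using u(3) by simp
    qed
    then obtain B where B: "B \<in> F" "u B > 0" using u(2) by force
    have "a $ e = inc B $ e" for e
    proof -
      have split: "sum u F = (\<Sum>A\<in>{A \<in> F. e \<in> A}. u A) + (\<Sum>A\<in>{A \<in> F. e \<notin> A}. u A)"
        using finite_F by (subst sum.union_disjoint[symmetric]) (auto intro!: arg_cong2[where f = sum])
      have pos: "u B \<le> (\<Sum>A\<in>M. u A)" if "B \<in> M" "M \<subseteq> F" for M
        using that u(2) finite_F by (intro member_le_sum) (auto intro: finite_subset)
      have nonneg: "0 \<le> (\<Sum>A\<in>M. u A)" if "M \<subseteq> F" for M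
        using that u(2) by (intro sum_nonneg) auto
      show ?thesis
      proof (cases "e \<in> B")
        case True
        have "0 < real_of_int (a $ e)" using pos[of "{A \<in> F. e \<in> A}"] True B a[of e] by auto
        moreover have "real_of_int (a $ e) \<le> 1" using split nonneg[of "{A \<in> F. e \<notin> A}"] u(3) a[of e] by auto
        ultimately show ?thesis using True by (simp add: inc_nth)
      next
        case False
        have "real_of_int (a $ e) < 1" using pos[of "{A \<in> F. e \<notin> A}"] False B split u(3) a[of e] by auto
        moreover have "0 \<le> real_of_int (a $ e)" using nonneg[of "{A \<in> F. e \<in> A}"] a[of e] by auto
        ultimately show ?thesis using False by (simp add: inc_nth)
      qed
    qed
    then have "a = inc B" by (simp add: vec_eq_iff)
    then show "a \<in> inc ` F" using B by simp
  qed
qed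

lemma compatible_coeffs_zero:
  assumes N: "compatible N" and w: "(\<Sum>A\<in>N. w A *\<^sub>R chi A) = 0" and A: "A \<in> N" "A \<noteq> {}"
  shows "w A = 0"
proof (rule weights_independent[OF N A])
  fix e
  show "(\<Sum>B\<in>{B \<in> N. e \<in> B}. w B) = 0"
    using sum_chi_nth[OF compatible_finite[OF N], of w e] w by simp
qed

lemma compatible_affine_independent:
  assumes N: "compatible N"
  shows "\<not> affine_dependent (chi ` N)"
proof
  have fin: "finite N" using compatible_finite[OF N] .
  assume "affine_dependent (chi ` N)"
  then obtain U where U: "sum U (chi ` N) = 0" "\<exists>v\<in>chi ` N. U v \<noteq> 0" "(\<Sum>v\<in>chi ` N. U v *\<^sub>R v) = 0"
    using affine_dependent_explicit_finite[of "chi ` N"] fin by auto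
  define w where "w = U \<circ> chi"
  have w: "sum w N = 0" "(\<Sum>A\<in>N. w A *\<^sub>R chi A) = 0"
    using U by (simp_all add: sum.reindex[OF inj_chi] w_def)
  obtain A where A: "A \<in> N" "w A \<noteq> 0" using U(2) by (auto simp: w_def)
  have zero: "w B = 0" if "B \<in> N" "B \<noteq> {}" for B
    using compatible_coeffs_zero[OF N w(2) that] .
  then have "A = {}" using A by blast
  have "sum w N = w A + sum w (N - {A})" using fin A by (simp add: sum.remove)
  moreover have "sum w (N - {A}) = 0" using zero \<open>A = {}\<close> by (intro sum.neutral) auto
  ultimately show False using w A by simp
qed

text \<open>Since \<open>chi {}\<close> is the origin, removing it turns affine into linear
  independence. This allows the values of a linear functional on the remaining vertices to be
  prescribed freely.\<close>

lemma compatible_independent: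
  assumes N: "compatible N"
  shows "independent (chi ` (N - {{}}))"
proof (rule independent_if_scalars_zero)
  have c: "compatible (N - {{}})" using N by (rule compatible_subset) auto
  show "finite (chi ` (N - {{}}))" using compatible_finite[OF c] by simp
  fix f x assume f: "(\<Sum>x\<in>chi ` (N - {{}}). f x *\<^sub>R x) = 0" and x: "x \<in> chi ` (N - {{}})"
  have "(\<Sum>A\<in>N - {{}}. (f \<circ> chi) A *\<^sub>R chi A) = 0"
    using f by (simp add: sum.reindex[OF inj_chi])
  then have "(f \<circ> chi) A = 0" if "A \<in> N - {{}}" for A
    using compatible_coeffs_zero[OF c] that by blast
  then show "f x = 0" using x by auto
qed

text \<open>A common point has a decomposition along \<open>N\<close> and one along
  \<open>M\<close>; by uniqueness they agree, so both are supported on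
  \<open>N \<inter> M\<close>.\<close>

lemma polytope_of_Int:
  assumes N: "compatible N" and M: "compatible M"
  shows "polytope_of N \<inter> polytope_of M = polytope_of (N \<inter> M)"
proof
  show "polytope_of (N \<inter> M) \<subseteq> polytope_of N \<inter> polytope_of M"
    by (meson Int_greatest hull_mono image_mono inf_le1 inf_le2)
  have fin: "finite N" "finite M" using compatible_finite N M by auto
  have NF: "N \<subseteq> F" "M \<subseteq> F" using N M by (auto simp: compatible_def)
  show "polytope_of N \<inter> polytope_of M \<subseteq> polytope_of (N \<inter> M)"
  proof
    fix x assume x: "x \<in> polytope_of N \<inter> polytope_of M"
    obtain u where u: "x = (\<Sum>A\<in>N. u A *\<^sub>R chi A)" "\<forall>A\<in>N. 0 \<le> u A" "sum u N = 1"
      using x polytope_of_eq[OF fin(1)] by blast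
    obtain v where v: "x = (\<Sum>A\<in>M. v A *\<^sub>R chi A)" "\<forall>A\<in>M. 0 \<le> v A" "sum v M = 1"
      using x polytope_of_eq[OF fin(2)] by blast
    let ?u = "\<lambda>A. if A \<in> N then u A else 0" and ?v = "\<lambda>A. if A \<in> M then v A else 0"
    have eq: "?u A = ?v A" if "A \<in> F" for A
    proof (rule weights_unique[OF _ _ _ _ _ _ that])
      show "compatible {B \<in> F. ?u B \<noteq> 0}" by (rule compatible_subset[OF N]) auto
      show "compatible {B \<in> F. ?v B \<noteq> 0}" by (rule compatible_subset[OF M]) auto
      show "(\<Sum>B\<in>{B \<in> F. e \<in> B}. ?u B) = (\<Sum>B\<in>{B \<in> F. e \<in> B}. ?v B)" for e
      proof -
        have "(\<Sum>B\<in>{B \<in> F. e \<in> B}. ?u B) = x $ e"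
          unfolding u(1) sum_chi_nth[OF fin(1)]
          using finite_F NF by (intro sum.mono_neutral_cong_right) auto
        moreover have "(\<Sum>B\<in>{B \<in> F. e \<in> B}. ?v B) = x $ e"
          unfolding v(1) sum_chi_nth[OF fin(2)]
          using finite_F NF by (intro sum.mono_neutral_cong_right) auto
        ultimately show ?thesis by simp
      qed
      have "sum ?u F = sum u N" using finite_F NF by (intro sum.mono_neutral_cong_right) auto
      moreover have "sum ?v F = sum v M" using finite_F NF by (intro sum.mono_neutral_cong_right) auto
      ultimately show "sum ?u F = sum ?v F" using u v by simp
    qed (use u v in auto)
    have zero: "u A = 0" if "A \<in> N - M" for A using eq[of A] that NF by auto
    have "x = (\<Sum>A\<in>N \<inter> M. u A *\<^sub>R chi A)"
      unfolding u(1) using fin zero by (intro sum.mono_neutral_right) auto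
    moreover have "sum u (N \<inter> M) = 1"
      unfolding u(3)[symmetric] using fin zero by (intro sum.mono_neutral_left) auto
    ultimately show "x \<in> polytope_of (N \<inter> M)"
      using u(2) fin unfolding polytope_of_eq[OF finite_Int[OF disjI1[OF fin(1)]]] by blast
  qed
qed

text \<open>Nonmaximal families supply the faces; the empty family gives the empty simplex, which is
  also among the lower faces.\<close>

definition simplices :: "(real ^ 'v graph) set set" where
  "simplices = polytope_of ` {N. compatible N}"

lemma simplicial_complex_simplices: "simplicial_complex simplices"
  unfolding simplicial_complex_def
proof (intro conjI ballI allI impI)
  have "finite {N. compatible N}"
    using finite_F by (auto simp: compatible_def intro: finite_subset[of _ "Pow F"])
  then show "finite simplices" by (simp add: simplices_def)
next
  fix S assume "S \<in> simplices"
  then obtain N where N: "compatible N" "S = polytope_of N" by (auto simp: simplices_def)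
  then have "(int (card (chi ` N)) - 1) simplex S"
    unfolding simplex_def using compatible_affine_independent[OF N(1)] by auto
  then show "\<exists>n. n simplex S" by blast
next
  fix T S assume *: "S \<in> simplices \<and> T face_of S"
  then obtain N where N: "compatible N" "S = polytope_of N" by (auto simp: simplices_def)
  then obtain c where "c \<subseteq> chi ` N" "T = convex hull c"
    using * face_of_convex_hull_affine_independent[OF compatible_affine_independent[OF N(1)]] by auto
  then obtain M where "M \<subseteq> N" "T = polytope_of M" by (auto simp: subset_image_iff)
  then show "T \<in> simplices" using compatible_subset[OF N(1)] by (auto simp: simplices_def)
next
  fix S S' assume *: "S \<in> simplices \<and> S' \<in> simplices"
  then obtain N M where N: "compatible N" "S = polytope_of N" and M: "compatible M" "S' = polytope_of M"
    by (auto simp: simplices_def)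
  have "S \<inter> S' = polytope_of (N \<inter> M)" using polytope_of_Int N M by simp
  moreover have "chi ` (N \<inter> M) \<subseteq> chi ` N" by auto
  ultimately show "S \<inter> S' face_of S"
    unfolding N(2) face_of_convex_hull_affine_independent[OF compatible_affine_independent[OF N(1)]]
    by blast
qed

section \<open>Heights and lower faces\<close>

definition height :: "int ^ 'v graph \<Rightarrow> real" where
  "height a = - (\<Sum>H\<in>UNIV. real_of_int (a $ H))\<^sup>2"

lemma height_inc: "height (inc A) = - (real (card A))\<^sup>2"
  by (simp add: height_def inc_nth if_distrib[of real_of_int] sum.If_cases cong: if_cong)

definition lift :: "'v graph set \<Rightarrow> (real ^ 'v graph) \<times> real" where
  "lift A = (chi A, height (inc A))"

lemma inj_lift: "inj_on lift N"
  by (simp add: inj_on_def lift_def chi_eq_iff)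

definition lifted :: "((real ^ 'v graph) \<times> real) set" where
  "lifted = convex hull (lift ` F)"

lemma lifted_eq: "lifted = {\<Sum>A\<in>F. u A *\<^sub>R lift A | u. (\<forall>A\<in>F. 0 \<le> u A) \<and> sum u F = 1}"
  unfolding lifted_def by (rule convex_hull_image[OF finite_F inj_lift])

lemma fst_image_lift: "fst ` (convex hull (lift ` N)) = polytope_of N"
proof -
  have "fst ` (convex hull (lift ` N)) = convex hull (fst ` lift ` N)"
    by (intro convex_hull_linear_image bounded_linear.linear bounded_linear_fst)
  also have "fst ` lift ` N = chi ` N" by (simp add: image_image lift_def)
  finally show ?thesis .
qed

text \<open>A linear functional takes equal sums on both sides, by \<open>chi_modular\<close>; only
  the squares contribute.\<close>

lemma height_uncross:
  assumes "A \<in> F" "B \<in> F" "incompatible A B"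
  shows "(c, 1) \<bullet> lift (A \<inter> B) + (c, 1) \<bullet> lift (A \<union> B) + 2 \<le> (c, 1) \<bullet> lift A + (c, 1) \<bullet> lift B"
proof -
  have "c \<bullet> chi (A \<inter> B) + c \<bullet> chi (A \<union> B) = c \<bullet> chi A + c \<bullet> chi B"
    by (simp add: inner_add_right[symmetric] chi_modular)
  then show ?thesis using card_square_uncross[OF assms] by (simp add: lift_def height_inc)
qed

text \<open>A convex combination can attain the lower bound \<open>b\<close> only by weighting
  vertices that attain it.\<close>

lemma lower_face_eq:
  assumes b: "\<And>A. A \<in> F \<Longrightarrow> b \<le> (c, 1) \<bullet> lift A"
  shows "lifted \<inter> {z. (c, 1) \<bullet> z = b} = convex hull (lift ` {A \<in> F. (c, 1) \<bullet> lift A = b})"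
    (is "?L = convex hull (lift ` ?M)")
proof
  have "lift ` ?M \<subseteq> {z. (c, 1) \<bullet> z = b}" by auto
  then have "convex hull (lift ` ?M) \<subseteq> {z. (c, 1) \<bullet> z = b}"
    by (rule hull_minimal) (rule convex_hyperplane)
  moreover have "convex hull (lift ` ?M) \<subseteq> lifted"
    unfolding lifted_def by (rule hull_mono) auto
  ultimately show "convex hull (lift ` ?M) \<subseteq> ?L" by blast
  show "?L \<subseteq> convex hull (lift ` ?M)"
  proof
    fix z assume z: "z \<in> ?L"
    then obtain u where u: "z = (\<Sum>A\<in>F. u A *\<^sub>R lift A)" "\<forall>A\<in>F. 0 \<le> u A" "sum u F = 1"
      using lifted_eq by blast
    have "(\<Sum>A\<in>F. u A * ((c, 1) \<bullet> lift A - b)) = (c, 1) \<bullet> z - b * sum u F"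
      unfolding u(1) by (simp add: inner_sum_right right_diff_distrib sum_subtractf sum_distrib_left mult.commute)
    also have "\<dots> = 0" using z u(3) by simp
    finally have "\<forall>A\<in>F. u A * ((c, 1) \<bullet> lift A - b) = 0"
      using u(2) b finite_F by (subst (asm) sum_nonneg_eq_0_iff) auto
    then have zero: "u A = 0" if "A \<in> F - ?M" for A using that by auto
    have "z = (\<Sum>A\<in>?M. u A *\<^sub>R lift A)"
      unfolding u(1) using finite_F zero by (intro sum.mono_neutral_right) auto
    moreover have "sum u ?M = sum u F"
      using finite_F zero by (intro sum.mono_neutral_left) auto
    moreover have "finite ?M" using finite_F by simp
    ultimately show "z \<in> convex hull (lift ` ?M)"
      using u(2,3) unfolding convex_hull_image[OF \<open>finite ?M\<close> inj_lift] by auto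
  qed
qed

text \<open>By strict submodularity of the height, the minimisers of height plus an affine functional form
  a compatible family.\<close>

lemma minimisers_compatible:
  assumes "\<And>A. A \<in> F \<Longrightarrow> b \<le> (c, 1) \<bullet> lift A"
  shows "compatible {A \<in> F. (c, 1) \<bullet> lift A = b}"
  unfolding compatible_def
proof (intro conjI ballI notI)
  fix A B assume A: "A \<in> {A \<in> F. (c, 1) \<bullet> lift A = b}" and B: "B \<in> {A \<in> F. (c, 1) \<bullet> lift A = b}"
    and i: "incompatible A B"
  have "A \<inter> B \<in> F" "A \<union> B \<in> F" using A B i Int_in by (auto simp: incompatible_def)
  then have "b \<le> (c, 1) \<bullet> lift (A \<inter> B)" "b \<le> (c, 1) \<bullet> lift (A \<union> B)" using assms by auto
  moreover have "(c, 1) \<bullet> lift A = b" "(c, 1) \<bullet> lift B = b" "A \<in> F" "B \<in> F" using A B by auto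
  ultimately show False using height_uncross[of A B c] i by linarith
qed auto

text \<open>Extend \<open>N\<close> to a maximal \<open>M\<close> and choose an affine functional so
  that its sum with the height is 0 on \<open>N\<close> and 1 on the rest of \<open>M\<close>. By
  \<open>uncross\<close> the sum is at least 1 outside \<open>M\<close>, so exactly \<open>N\<close>
  is minimal.\<close>

lemma compatible_minimisers:
  assumes N: "compatible N"
  obtains c b where "\<And>A. A \<in> F \<Longrightarrow> b \<le> (c, 1) \<bullet> lift A" "{A \<in> F. (c, 1) \<bullet> lift A = b} = N"
proof -
  obtain M where M: "N \<subseteq> M" "maximal_compatible M" using extend_maximal[OF N] .
  have cM: "compatible M" using M by (simp add: maximal_compatible_def)
  define p :: "'v graph set \<Rightarrow> real" where "p A = (if A \<in> N then 0 else 1)" for A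
  \<comment> \<open>The lift of \<open>{}\<close> is the origin, so \<open>h {}\<close> equals
    \<open>- b\<close> for every \<open>c\<close>; this fixes the constant.\<close>
  define b where "b = - p {}"
  define f where "f x = p (the_inv chi x) + b - height (inc (the_inv chi x))" for x
  obtain g where g: "linear g" "\<And>x. x \<in> chi ` (M - {{}}) \<Longrightarrow> g x = f x"
    using linear_independent_extend[OF compatible_independent[OF cM], of f] by auto
  \<comment> \<open>The vector representing the functional \<open>g\<close> by the inner
    product.\<close>
  define c where "c = adjoint g (1::real)"
  have c: "c \<bullet> x = g x" for x
    using adjoint_works[OF g(1), of x 1] by (simp add: c_def inner_commute)
  define h where "h A = (c, 1) \<bullet> lift A - b" for A
  have hM: "h A = p A" if "A \<in> M" for A
  proof (cases "A = {}")
    case True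
    then show ?thesis by (simp add: h_def lift_def chi_empty height_inc b_def)
  next
    case False
    have "the_inv chi (chi A) = A" by (rule the_inv_f_f) (rule inj_chi)
    then show ?thesis using g(2)[of "chi A"] False that by (simp add: h_def lift_def c f_def)
  qed
  have h: "0 \<le> h A \<and> (A \<notin> M \<longrightarrow> 1 \<le> h A)" if "A \<in> F" for A
  proof (rule uncross[OF M(2) _ _ that])
    show "h (A \<inter> B) + h (A \<union> B) + 2 \<le> h A + h B" if "A \<in> F" "B \<in> F" "incompatible A B" for A B
      using height_uncross[OF that, of c] by (simp add: h_def)
    show "0 \<le> h A \<and> h A \<le> 1" if "A \<in> M" for A using hM[OF that] by (simp add: p_def)
  qed
  show ?thesis
  proof (rule that)
    show "b \<le> (c, 1) \<bullet> lift A" if "A \<in> F" for A using h[OF that] by (simp add: h_def)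
    show "{A \<in> F. (c, 1) \<bullet> lift A = b} = N"
    proof (intro equalityI subsetI)
      fix A assume A: "A \<in> {A \<in> F. (c, 1) \<bullet> lift A = b}"
      then have "h A = 0" by (simp add: h_def)
      then have "A \<in> M" using h[of A] A by auto
      then show "A \<in> N" using hM[of A] \<open>h A = 0\<close> by (simp add: p_def split: if_splits)
    next
      fix A assume A: "A \<in> N"
      then have "h A = 0" using hM[of A] M(1) by (auto simp: p_def)
      then show "A \<in> {A \<in> F. (c, 1) \<bullet> lift A = b}" using A N by (auto simp: h_def compatible_def)
    qed
  qed
qed

lemma lifted_halfspace:
  "lifted \<subseteq> {z. (c, 1) \<bullet> z \<ge> b} \<longleftrightarrow> (\<forall>A\<in>F. b \<le> (c, 1) \<bullet> lift A)"
proof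
  assume "lifted \<subseteq> {z. (c, 1) \<bullet> z \<ge> b}"
  moreover have "lift A \<in> lifted" if "A \<in> F" for A using that by (simp add: lifted_def hull_inc)
  ultimately show "\<forall>A\<in>F. b \<le> (c, 1) \<bullet> lift A" by auto
next
  assume "\<forall>A\<in>F. b \<le> (c, 1) \<bullet> lift A"
  then have "lift ` F \<subseteq> {z. (c, 1) \<bullet> z \<ge> b}" by auto
  then show "lifted \<subseteq> {z. (c, 1) \<bullet> z \<ge> b}"
    unfolding lifted_def by (rule hull_minimal) (rule convex_halfspace_ge)
qed

lemma simplices_lower_faces: "simplices = (\<lambda>S. fst ` S) ` lower_faces lifted"
proof (intro equalityI subsetI)
  fix S assume "S \<in> simplices"
  then obtain N where N: "compatible N" "S = polytope_of N" by (auto simp: simplices_def)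
  obtain c b where cb: "\<And>A. A \<in> F \<Longrightarrow> b \<le> (c, 1) \<bullet> lift A" "{A \<in> F. (c, 1) \<bullet> lift A = b} = N"
    using compatible_minimisers[OF N(1)] by blast
  have "lifted \<inter> {z. (c, 1) \<bullet> z = b} \<in> lower_faces lifted"
    unfolding lower_faces_def using cb(1) lifted_halfspace[of b c] by blast
  moreover have "lifted \<inter> {z. (c, 1) \<bullet> z = b} = convex hull (lift ` N)"
    using lower_face_eq[of b c] cb by simp
  then have "S = fst ` (lifted \<inter> {z. (c, 1) \<bullet> z = b})" by (simp add: fst_image_lift N(2))
  ultimately show "S \<in> (\<lambda>S. fst ` S) ` lower_faces lifted" by blast
next
  fix S assume "S \<in> (\<lambda>S. fst ` S) ` lower_faces lifted"
  then obtain c b where S: "S = fst ` (lifted \<inter> {z. (c, 1) \<bullet> z = b})"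
    and "lifted \<subseteq> {z. (c, 1) \<bullet> z \<ge> b}"
    unfolding lower_faces_def by blast
  then have b: "\<And>A. A \<in> F \<Longrightarrow> b \<le> (c, 1) \<bullet> lift A" using lifted_halfspace by blast
  have "lifted \<inter> {z. (c, 1) \<bullet> z = b} = convex hull (lift ` {A \<in> F. (c, 1) \<bullet> lift A = b})"
    using lower_face_eq[of b c] b by simp
  then have "S = polytope_of {A \<in> F. (c, 1) \<bullet> lift A = b}" by (simp add: fst_image_lift S)
  then show "S \<in> simplices" using minimisers_compatible[OF b] by (auto simp: simplices_def)
qed

text \<open>A point of minimal height above \<open>x\<close> has compatible support, since uncrossing lowers it.\<close>

lemma simplices_cover: "\<Union>simplices = polytope_of F"
proof
  show "\<Union>simplices \<subseteq> polytope_of F"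
  proof (rule Union_least)
    fix S assume "S \<in> simplices"
    then obtain N where "N \<subseteq> F" "S = polytope_of N" by (auto simp: simplices_def compatible_def)
    then show "S \<subseteq> polytope_of F" by (simp add: hull_mono image_mono)
  qed
  show "polytope_of F \<subseteq> \<Union>simplices"
  proof
    fix x assume "x \<in> polytope_of F"
    then have "x \<in> fst ` lifted" unfolding lifted_def fst_image_lift .
    let ?K = "lifted \<inter> {z. fst z = x}"
    have "compact lifted"
      unfolding lifted_def using finite_F by (simp add: finite_imp_compact_convex_hull)
    moreover have "closed {z :: (real ^ 'v graph) \<times> real. fst z = x}"
      by (intro closed_Collect_eq continuous_intros)
    ultimately have "compact ?K" by (rule compact_Int_closed)
    moreover have "?K \<noteq> {}" using \<open>x \<in> fst ` lifted\<close> by auto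
    moreover have "continuous_on ?K snd" by (intro continuous_intros)
    ultimately obtain z where z: "z \<in> ?K" "\<forall>y\<in>?K. snd z \<le> snd y"
      using continuous_attains_inf by blast
    then obtain u where u: "z = (\<Sum>A\<in>F. u A *\<^sub>R lift A)" "\<forall>A\<in>F. 0 \<le> u A" "sum u F = 1"
      using lifted_eq by blast
    define N where "N = {A \<in> F. u A \<noteq> 0}"
    have "compatible N"
      unfolding compatible_def
    proof (intro conjI ballI notI)
      fix A B assume AB: "A \<in> N" "B \<in> N" and i: "incompatible A B"
      have F: "A \<in> F" "B \<in> F" "A \<inter> B \<in> F" "A \<union> B \<in> F"
        using AB i Int_in by (auto simp: N_def incompatible_def)
      have ne: "A \<noteq> B" using i by (auto simp: incompatible_def)
      \<comment> \<open>The largest weight that can be moved from \<open>A\<close> and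
        \<open>B\<close> to their intersection and union without a negative coefficient.\<close>
      define d where "d = min (u A) (u B)"
      have d: "0 < d" using AB u(2) by (auto simp: N_def d_def order_less_le)
      let ?s = "\<lambda>C D. if D = C then d else 0 :: real"
      define v where "v D = u D + ?s (A \<inter> B) D + ?s (A \<union> B) D - ?s A D - ?s B D" for D
      \<comment> \<open>Stated for arbitrary \<open>q\<close>: the lifts give the moved point, the
        constant 1 shows that the total weight is kept.\<close>
      have sum_v: "(\<Sum>D\<in>F. v D *\<^sub>R q D)
          = (\<Sum>D\<in>F. u D *\<^sub>R q D) + d *\<^sub>R (q (A \<inter> B) + q (A \<union> B) - q A - q B)"
        for q :: "'v graph set \<Rightarrow> 'w::real_vector"
      proof -
        have s: "(\<Sum>D\<in>F. ?s C D *\<^sub>R q D) = d *\<^sub>R q C" if "C \<in> F" for C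
          using that finite_F by (simp add: if_distrib[of "\<lambda>t. t *\<^sub>R _"] cong: if_cong)
        show ?thesis
          by (simp add: v_def scaleR_add_left scaleR_diff_left sum.distrib sum_subtractf s F
              scaleR_add_right scaleR_diff_right)
      qed
      define y where "y = (\<Sum>D\<in>F. v D *\<^sub>R lift D)"
      have y: "y = z + d *\<^sub>R (lift (A \<inter> B) + lift (A \<union> B) - lift A - lift B)"
        unfolding y_def u(1) by (rule sum_v)
      have "\<forall>D\<in>F. 0 \<le> v D" using u(2) d ne by (auto simp: v_def d_def)
      moreover have "sum v F = 1" using sum_v[of "\<lambda>_. 1 :: real"] u(3) by simp
      ultimately have "y \<in> lifted" unfolding lifted_eq y_def by blast
      moreover have "fst y = x"
        using z(1) chi_modular[of A B] unfolding y by (simp add: lift_def algebra_simps)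
      ultimately have "snd z \<le> snd y" using z(2) by simp
      moreover have "snd y - snd z
          = d * (height (inc (A \<inter> B)) + height (inc (A \<union> B)) - height (inc A) - height (inc B))"
        unfolding y by (simp add: lift_def)
      moreover have "height (inc (A \<inter> B)) + height (inc (A \<union> B)) - height (inc A) - height (inc B) < 0"
        using card_square_uncross[OF F(1,2) i] by (simp add: height_inc)
      ultimately show False using d by (smt (verit) mult_pos_neg)
    qed (auto simp: N_def)
    have "x = (\<Sum>A\<in>F. u A *\<^sub>R chi A)" using z(1) u(1) by (simp add: fst_sum lift_def)
    also have "\<dots> = (\<Sum>A\<in>N. u A *\<^sub>R chi A)"
      unfolding N_def using finite_F by (intro sum.mono_neutral_right) auto
    finally have "x = (\<Sum>A\<in>N. u A *\<^sub>R chi A)" .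
    moreover have "sum u N = 1"
      unfolding u(3)[symmetric] N_def using finite_F by (intro sum.mono_neutral_left) auto
    moreover have "\<forall>A\<in>N. 0 \<le> u A" using u(2) by (auto simp: N_def)
    ultimately have "x \<in> polytope_of N"
      unfolding polytope_of_eq[OF compatible_finite[OF \<open>compatible N\<close>]] by blast
    then show "x \<in> \<Union>simplices" using \<open>compatible N\<close> by (auto simp: simplices_def)
  qed
qed

theorem regular_triangulation_simplices: "regular_triangulation simplices (polytope_of F)"
  unfolding regular_triangulation_def triangulation_of_def
proof (intro conjI exI[of _ height])
  have "{(rvec a, height a) | a. a \<in> lattice_points (polytope_of F)} = lift ` F"
    unfolding lattice_points_polytope by (auto simp: lift_def chi_def)
  then show "simplices = (\<lambda>S. fst ` S) `
      lower_faces (convex hull {(rvec a, height a) | a. a \<in> lattice_points (polytope_of F)})"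
    using simplices_lower_faces by (simp add: lifted_def)
qed (rule simplicial_complex_simplices simplices_cover)+

end

section \<open>Unimodularity\<close>

text \<open>Coordinates of larger rank are shifted by multiples of coordinates of smaller rank; integrating
  out the coordinate of largest rank first reduces to translation invariance.\<close>

lemma distr_PiM_triangular:
  fixes D :: "'a set" and rank :: "'a \<Rightarrow> int" and c :: "'a \<Rightarrow> 'a \<Rightarrow> real"
  assumes "finite D" "\<And>i j. i \<in> D \<Longrightarrow> j \<in> D \<Longrightarrow> c i j \<noteq> 0 \<Longrightarrow> rank j < rank i"
  shows "distr (Pi\<^sub>M D (\<lambda>_. lborel)) (Pi\<^sub>M D (\<lambda>_. lborel)) (\<lambda>x. \<lambda>i\<in>D. x i + (\<Sum>j\<in>D. c i j * x j))
    = Pi\<^sub>M D (\<lambda>_. lborel)"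
  using assms
proof (induction D rule: finite_ranking_induct[where f = rank])
  case empty
  let ?M = "Pi\<^sub>M {} (\<lambda>_. lborel :: real measure) :: ('a \<Rightarrow> real) measure"
  have "distr ?M ?M (\<lambda>x. \<lambda>i\<in>{}. x i + (\<Sum>j\<in>{}. c i j * x j)) = distr ?M ?M (\<lambda>x. x)"
    by (rule distr_cong) (auto simp: space_PiM_empty)
  then show ?case by (simp only: distr_id)
next
  case (insert i S)
  show ?case
  \<comment> \<open>The ranking induction may insert an element that is already present.\<close>
  proof (cases "i \<in> S")
    case True
    then show ?thesis using insert by (simp add: insert_absorb)
  next
    case False
    interpret product_sigma_finite "\<lambda>_::'a. lborel :: real measure" by standard
    let ?M = "\<lambda>D::'a set. Pi\<^sub>M D (\<lambda>_. lborel :: real measure)"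
    let ?T = "\<lambda>D x. \<lambda>i\<in>D. x i + (\<Sum>j\<in>D. c i j * x j)"
    have T[measurable]: "?T D \<in> measurable (?M D) (?M D)" if "finite D" for D
      by (rule measurable_restrict) (auto intro!: borel_measurable_add borel_measurable_sum
          borel_measurable_times measurable_component_singleton simp: measurable_lborel1)
    have IH: "distr (?M S) (?M S) (?T S) = ?M S"
      using insert.IH insert.prems by blast
    \<comment> \<open>\<open>i\<close> has the largest rank so far, so no coordinate is shifted by a
      multiple of the coordinate \<open>i\<close>.\<close>
    have ci: "c j i = 0" if "j \<in> insert i S" for j
      using insert.prems[of j i] insert.hyps(2)[of j] that by force
    have upd: "?T (insert i S) (x(i := y)) = (?T S x)(i := y + (\<Sum>j\<in>S. c i j * x j))"
      if "x \<in> space (?M S)" for x y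
    proof
      fix k
      have sum: "(\<Sum>j\<in>insert i S. c k j * (x(i := y)) j) = (\<Sum>j\<in>S. c k j * x j)"
        if k: "k \<in> insert i S"
      proof -
        have "(\<Sum>j\<in>insert i S. c k j * (x(i := y)) j)
            = c k i * (x(i := y)) i + (\<Sum>j\<in>S. c k j * (x(i := y)) j)"
          by (rule sum.insert[OF insert.hyps(1) False])
        also have "(\<Sum>j\<in>S. c k j * (x(i := y)) j) = (\<Sum>j\<in>S. c k j * x j)"
          by (rule sum.cong) (use False in auto)
        finally show ?thesis by (simp add: ci[OF k])
      qed
      show "?T (insert i S) (x(i := y)) k = ((?T S x)(i := y + (\<Sum>j\<in>S. c i j * x j))) k"
      proof (cases "k \<in> insert i S")
        case True
        then have "?T (insert i S) (x(i := y)) k = (x(i := y)) k + (\<Sum>j\<in>S. c k j * x j)"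
          by (simp only: restrict_apply' sum)
        then show ?thesis using True False by (cases "k = i") simp_all
      qed simp
    qed
    show ?thesis
    proof (rule measure_eqI)
      fix A assume "A \<in> sets (distr (?M (insert i S)) (?M (insert i S)) (?T (insert i S)))"
      then have A[measurable]: "A \<in> sets (?M (insert i S))" by simp
      have fin: "finite S" "finite (insert i S)" using insert.hyps by auto
      have Ti[measurable]: "?T (insert i S) \<in> measurable (?M (insert i S)) (?M (insert i S))"
        using T fin by blast
      have ind: "(\<lambda>x. indicator A x :: ennreal) \<in> borel_measurable (?M (insert i S))" by measurable
      define h where "h z = (\<integral>\<^sup>+ y. indicator A (z(i := y)) \<partial>lborel)" for z
      have hm: "h \<in> borel_measurable (?M S)"
        unfolding h_def
      proof (rule lborel.borel_measurable_nn_integral)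
        have "(\<lambda>(z, y). z(i := y)) \<in> measurable (?M S \<Otimes>\<^sub>M lborel) (?M (insert i S))"
          by (rule measurable_add_dim)
        from measurable_comp[OF this ind]
        show "(\<lambda>(z, y). indicator A (z(i := y)) :: ennreal) \<in> borel_measurable (?M S \<Otimes>\<^sub>M lborel)"
          by (simp add: o_def split_beta')
      qed
      \<comment> \<open>The shift of coordinate \<open>i\<close> depends only on coordinates in
        \<open>S\<close>, so it is a constant \<open>t\<close> in the inner integral and translation
        invariance absorbs it.\<close>
      have shift: "(\<integral>\<^sup>+ y. indicator A ((?T S x)(i := y + t)) \<partial>lborel) = h (?T S x)"
        if x: "x \<in> space (?M S)" for x t
      proof -
        have "?T S x \<in> space (?M S)" using measurable_space[OF T[OF fin(1)] x] .
        then have m: "(\<lambda>y. (?T S x)(i := y)) \<in> measurable lborel (?M (insert i S))"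
          using measurable_component_update[of "?T S x" S "\<lambda>_. lborel" i] False by simp
        have "h (?T S x) = (\<integral>\<^sup>+ y. indicator A ((?T S x)(i := y)) \<partial>distr lborel borel ((+) t))"
          unfolding h_def lborel_distr_plus ..
        also have "\<dots> = (\<integral>\<^sup>+ y. indicator A ((?T S x)(i := t + y)) \<partial>lborel)"
          using measurable_comp[OF m ind] by (subst nn_integral_distr) (auto simp: o_def)
        finally show ?thesis by (simp add: add.commute)
      qed
      have "emeasure (distr (?M (insert i S)) (?M (insert i S)) (?T (insert i S))) A
          = (\<integral>\<^sup>+ x. indicator A x \<partial>distr (?M (insert i S)) (?M (insert i S)) (?T (insert i S)))"
        by simp
      also have "\<dots> = (\<integral>\<^sup>+ x. indicator A (?T (insert i S) x) \<partial>?M (insert i S))"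
        by (rule nn_integral_distr[OF Ti]) simp
      also have "\<dots> = (\<integral>\<^sup>+ x. (\<integral>\<^sup>+ y. indicator A (?T (insert i S) (x(i := y))) \<partial>lborel) \<partial>?M S)"
        by (rule product_nn_integral_insert[OF fin(1) False])
          (use measurable_comp[OF Ti ind] in \<open>simp add: o_def\<close>)
      also have "\<dots> = (\<integral>\<^sup>+ x. h (?T S x) \<partial>?M S)"
        by (rule nn_integral_cong) (simp only: upd shift)
      also have "\<dots> = (\<integral>\<^sup>+ x. h x \<partial>distr (?M S) (?M S) (?T S))"
        by (rule nn_integral_distr[OF T[OF fin(1)], symmetric]) (simp add: hm)
      also have "\<dots> = (\<integral>\<^sup>+ x. h x \<partial>?M S)" unfolding IH ..
      also have "\<dots> = (\<integral>\<^sup>+ x. indicator A x \<partial>?M (insert i S))"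
        unfolding h_def by (rule product_nn_integral_insert[OF fin(1) False ind, symmetric])
      also have "\<dots> = emeasure (?M (insert i S)) A" by simp
      finally show "emeasure (distr (?M (insert i S)) (?M (insert i S)) (?T (insert i S))) A
          = emeasure (?M (insert i S)) A" .
    qed simp
  qed
qed

context block_family
begin

text \<open>Indexing the barycentric coordinates of the nonempty members by their private blocks
  makes the simplex the image of the standard simplex under \<open>T\<close>. This map is a
  unitriangular shear and preserves Lebesgue measure.\<close>

lemma maximal_simplex_volume:
  assumes N: "maximal_compatible N"
  shows "normalized_volume E (polytope_of N) = 1"
proof -
  have cN: "compatible N" using N by (simp add: maximal_compatible_def)
  have fN: "finite N" using compatible_finite[OF cN] .
  have NE: "A \<subseteq> E" if "A \<in> N" for A using that cN F_subset by (auto simp: compatible_def)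
  obtain b where b: "bij_betw b (N - {{}}) E"
    and bA: "\<And>A. A \<in> N \<Longrightarrow> A \<noteq> {} \<Longrightarrow> b A \<in> A"
    and bB: "\<And>A B. A \<in> N \<Longrightarrow> A \<noteq> {} \<Longrightarrow> B \<in> N \<Longrightarrow> b A \<in> B \<Longrightarrow> A \<subseteq> B"
    using maximal_compatible_bij[OF N] by blast
  define a where "a = the_inv_into (N - {{}}) b"
  have ab: "a (b A) = A" if "A \<in> N - {{}}" for A
    unfolding a_def using b that by (intro the_inv_into_f_f) (auto simp: bij_betw_def)
  have ba: "b (a e) = e" and aN: "a e \<in> N" "a e \<noteq> {}" if "e \<in> E" for e
  proof -
    show "b (a e) = e"
      unfolding a_def using b that by (intro f_the_inv_into_f) (auto simp: bij_betw_def)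
    have "a e \<in> N - {{}}"
      unfolding a_def using b that by (intro the_inv_into_into) (auto simp: bij_betw_def)
    then show "a e \<in> N" "a e \<noteq> {}" by auto
  qed
  \<comment> \<open>Thus \<open>a e\<close> is the smallest member of \<open>N\<close> containing
    \<open>e\<close>.\<close>
  have ea: "e \<in> a e" and asub: "\<And>B. B \<in> N \<Longrightarrow> e \<in> B \<Longrightarrow> a e \<subseteq> B" if "e \<in> E" for e
    using bA[OF aN[OF that]] bB[OF aN[OF that]] ba[OF that] by simp_all
  \<comment> \<open>The incidence matrix without its diagonal; the diagonal entries are all 1 and
    form the identity part of \<open>T\<close>.\<close>
  define c :: "'v graph \<Rightarrow> 'v graph \<Rightarrow> real" where "c i j = (if i \<in> a j \<and> i \<noteq> j then 1 else 0)" for i j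
  let ?M = "Pi\<^sub>M E (\<lambda>_. lborel :: real measure)"
  define T where "T x = (\<lambda>i\<in>E. x i + (\<Sum>j\<in>E. c i j * x j))" for x
  have T_eq: "T x i = (\<Sum>j\<in>E. if i \<in> a j then x j else 0)" if "i \<in> E" for x i
  proof -
    have "T x i = (\<Sum>j\<in>E. (if j = i then x i else 0) + c i j * x j)"
      using that finite_E by (simp add: T_def sum.distrib)
    also have "\<dots> = (\<Sum>j\<in>E. if i \<in> a j then x j else 0)"
      using ea by (intro sum.cong) (auto simp: c_def)
    finally show ?thesis .
  qed
  \<comment> \<open>A nonzero \<open>c i j\<close> means that \<open>a i\<close> is a proper subset
    of \<open>a j\<close>. The shifting coordinate \<open>j\<close> must have the smaller rank,
    hence the negated size.\<close>
  have distr: "distr ?M ?M T = ?M"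
    unfolding T_def
  proof (rule distr_PiM_triangular[OF finite_E, where rank = "\<lambda>i. - int (card (a i))"])
    fix i j assume ij: "i \<in> E" "j \<in> E" "c i j \<noteq> 0"
    then have "i \<in> a j" "i \<noteq> j" by (auto simp: c_def split: if_splits)
    then have "a i \<subseteq> a j" "a i \<noteq> a j" using asub[OF ij(1) aN(1)[OF ij(2)]] ba ij by metis+
    moreover have "finite (a j)" using NE[OF aN(1)[OF ij(2)]] finite_E finite_subset by blast
    ultimately have "card (a i) < card (a j)" by (simp add: psubset_card_mono psubset_eq)
    then show "- int (card (a j)) < - int (card (a i))" by simp
  qed
  have Tm: "T \<in> measurable ?M ?M"
    unfolding T_def
    by (rule measurable_restrict) (auto intro!: borel_measurable_add borel_measurable_sum
        borel_measurable_times measurable_component_singleton simp: measurable_lborel1)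
  \<comment> \<open>Extension by zero from coordinates in \<open>E\<close>, inverse on the simplex
    to the restriction in \<open>normalized_volume\<close>; it makes the image a measurable
    preimage.\<close>
  define ext :: "('v graph \<Rightarrow> real) \<Rightarrow> real ^ 'v graph" where
    "ext y = (\<Sum>i\<in>E. y i *\<^sub>R axis i 1)" for y
  have ext_nth: "ext y $ i = (if i \<in> E then y i else 0)" for y i
    using finite_E by (simp add: ext_def axis_def if_distrib cong: if_cong)
  have ext_m: "ext \<in> borel_measurable ?M"
    unfolding ext_def
    by (intro borel_measurable_sum borel_measurable_scaleR borel_measurable_const)
      (auto intro!: measurable_component_singleton simp flip: measurable_lborel1)
  let ?S = "polytope_of N"
  define Y where "Y = ext -` ?S \<inter> space ?M"
  have "closed ?S" using fN by (simp add: finite_imp_compact_convex_hull compact_imp_closed)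
  then have "?S \<in> sets borel" by (rule borel_closed)
  then have Ym: "Y \<in> sets ?M" unfolding Y_def by (rule measurable_sets[OF ext_m])
  have image: "(\<lambda>x. \<lambda>i\<in>E. x $ i) ` ?S = Y"
  proof -
    have ext_restrict: "ext (\<lambda>i\<in>E. x $ i) = x" if x: "x \<in> ?S" for x
    proof -
      obtain u where u: "x = (\<Sum>A\<in>N. u A *\<^sub>R chi A)" using x polytope_of_eq[OF fN] by blast
      have "x $ i = 0" if "i \<notin> E" for i
        unfolding u sum_chi_nth[OF fN] using NE that by (intro sum.neutral) auto
      then show ?thesis by (simp add: vec_eq_iff ext_nth)
    qed
    have restrict_ext: "(\<lambda>i\<in>E. ext y $ i) = y" if "y \<in> space ?M" for y
      using that by (auto simp: space_PiM PiE_def extensional_def ext_nth fun_eq_iff)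
    show ?thesis
    proof (intro equalityI subsetI)
      fix y assume "y \<in> (\<lambda>x. \<lambda>i\<in>E. x $ i) ` ?S"
      then show "y \<in> Y" using ext_restrict by (auto simp: Y_def space_PiM)
    next
      fix y assume "y \<in> Y"
      then have "ext y \<in> ?S" "y = (\<lambda>i\<in>E. ext y $ i)" using restrict_ext by (auto simp: Y_def)
      then show "y \<in> (\<lambda>x. \<lambda>i\<in>E. x $ i) ` ?S" by blast
    qed
  qed
  have extT: "ext (T x) = (\<Sum>A\<in>N - {{}}. x (b A) *\<^sub>R chi A)" for x
  proof -
    have "ext (T x) $ i = (\<Sum>A\<in>N - {{}}. x (b A) *\<^sub>R chi A) $ i" for i
    proof (cases "i \<in> E")
      case True
      have "ext (T x) $ i = (\<Sum>j\<in>E. if i \<in> a j then x j else 0)" using True by (simp add: ext_nth T_eq)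
      also have "\<dots> = (\<Sum>A\<in>N - {{}}. if i \<in> a (b A) then x (b A) else 0)"
        by (rule sum.reindex_bij_betw[OF b, symmetric])
      also have "\<dots> = (\<Sum>A\<in>N - {{}}. x (b A) * chi A $ i)"
        using ab by (intro sum.cong) (auto simp: chi_nth)
      finally show ?thesis by simp
    next
      case False
      then have "chi A $ i = 0" if "A \<in> N" for A using NE[OF that] by (auto simp: chi_nth)
      then show ?thesis using False by (simp add: ext_nth)
    qed
    then show ?thesis by (simp add: vec_eq_iff)
  qed
  \<comment> \<open>The slack \<open>1 - sum x E\<close> is the barycentric coordinate of the
    origin, the vertex of \<open>{}\<close>.\<close>
  let ?D = "{x. (\<forall>i\<in>E. 0 \<le> x i) \<and> sum x E \<le> 1}"
  have empty: "{} \<in> N" using maximal_compatible_empty[OF N] .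
  have sumE: "sum x E = (\<Sum>A\<in>N - {{}}. x (b A))" for x :: "'v graph \<Rightarrow> real"
    by (rule sum.reindex_bij_betw[OF b, symmetric])
  have mem: "ext (T x) \<in> ?S \<longleftrightarrow> x \<in> ?D" for x
  proof
    assume "ext (T x) \<in> ?S"
    then obtain u where u: "ext (T x) = (\<Sum>A\<in>N. u A *\<^sub>R chi A)" "\<forall>A\<in>N. 0 \<le> u A" "sum u N = 1"
      using polytope_of_eq[OF fN] by blast
    \<comment> \<open>The difference of two expansions of the same point. At \<open>{}\<close> the
      second coefficient may be set to 0 because \<open>chi {} = 0\<close>; independence determines
      the others.\<close>
    let ?w = "\<lambda>A. u A - (if A = {} then 0 else x (b A))"
    have "(\<Sum>A\<in>N. (if A = {} then 0 else x (b A)) *\<^sub>R chi A) = ext (T x)"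
      unfolding extT using fN by (intro sum.mono_neutral_cong_right) auto
    then have "(\<Sum>A\<in>N. ?w A *\<^sub>R chi A) = 0"
      using u(1) by (simp add: scaleR_diff_left sum_subtractf)
    then have w: "x (b A) = u A" if "A \<in> N" "A \<noteq> {}" for A
      using compatible_coeffs_zero[OF cN _ that, of ?w] that by simp
    have "0 \<le> x i" if "i \<in> E" for i
      using w[OF aN[OF that]] ba[OF that] u(2) aN[OF that] by auto
    moreover have "sum x E = (\<Sum>A\<in>N - {{}}. u A)" unfolding sumE using w by (intro sum.cong) auto
    moreover have "sum u N = u {} + (\<Sum>A\<in>N - {{}}. u A)" using fN empty by (simp add: sum.remove)
    ultimately show "x \<in> ?D" using u(2,3) empty by force
  next
    assume x: "x \<in> ?D"
    let ?u = "\<lambda>A. if A = {} then 1 - sum x E else x (b A)"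
    have "b A \<in> E" if "A \<in> N" "A \<noteq> {}" for A using bA NE that by blast
    then have u1: "\<forall>A\<in>N. 0 \<le> ?u A" using x by auto
    have u2: "sum ?u N = 1"
    proof -
      have "sum ?u N = ?u {} + sum ?u (N - {{}})" using fN empty by (rule sum.remove)
      also have "sum ?u (N - {{}}) = sum x E" unfolding sumE by (intro sum.cong) auto
      finally show ?thesis by simp
    qed
    have u3: "ext (T x) = (\<Sum>A\<in>N. ?u A *\<^sub>R chi A)"
      unfolding extT using fN by (intro sum.mono_neutral_cong_left) (auto simp: chi_empty)
    show "ext (T x) \<in> ?S"
      unfolding polytope_of_eq[OF fN]
      by (rule CollectI, rule exI[of _ ?u], rule conjI[OF u3 conjI[OF u1 u2]])
  qed
  have pre: "T -` Y \<inter> space ?M = ?D \<inter> space ?M"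
    using measurable_space[OF Tm] mem by (auto simp: Y_def)
  have "emeasure ?M Y = emeasure (distr ?M ?M T) Y" by (simp only: distr)
  also have "\<dots> = emeasure ?M (?D \<inter> space ?M)"
    using Tm Ym by (simp add: emeasure_distr pre)
  \<comment> \<open>The volume of the standard simplex, which cancels the factorial in
    \<open>normalized_volume\<close>.\<close>
  also have "\<dots> = ennreal (1 / fact (card E))"
    using emeasure_std_simplex_aux[OF finite_E, of 1] by simp
  finally show ?thesis
    by (simp add: normalized_volume_def image measure_def)
qed

text \<open>Extending the family of an inclusion-maximal simplex gives a simplex that contains it
  and so equals it; hence it comes from a maximal compatible family.\<close>

theorem unimodular_simplices: "unimodular E simplices"
  unfolding unimodular_def
proof (intro ballI impI)
  fix S assume "S \<in> simplices" and max: "\<forall>S'\<in>simplices. S \<subseteq> S' \<longrightarrow> S' = S"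
  then obtain N where N: "compatible N" "S = polytope_of N" by (auto simp: simplices_def)
  obtain M where M: "N \<subseteq> M" "maximal_compatible M" using extend_maximal[OF N(1)] .
  have cM: "compatible M" using M by (simp add: maximal_compatible_def)
  then have "polytope_of M \<in> simplices" by (auto simp: simplices_def)
  moreover have "S \<subseteq> polytope_of M" unfolding N(2) using M(1) by (intro hull_mono image_mono)
  ultimately have S: "S = polytope_of M" using max by blast
  have "chi ` M \<subseteq> range rvec" by (auto simp: chi_def)
  then have "lattice_simplex S"
    unfolding lattice_simplex_def S using compatible_affine_independent[OF cM] by blast
  then show "lattice_simplex S \<and> normalized_volume E S = 1"
    using maximal_simplex_volume[OF M(2)] S by simp
qed

end

theorem theorem7p1:
  fixes G :: "('v::finite) graph" and r :: "(int ^ 'v graph) rel"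
  assumes "simple_graph G" and "connected_graph G"
    and "strict_linear_order_on (inc ` connected_families G) r"
    and "\<And>A1 A2. A1 \<in> connected_families G \<Longrightarrow> A2 \<in> connected_families G \<Longrightarrow> A2 \<subset> A1 \<Longrightarrow>
           (inc A1, inc A2) \<in> r"
  shows "groebner_basis (inc ` connected_families G) r
           {block_binomial A1 A2 | A1 A2. block_pair G A1 A2}
           (toric_ideal (CBP G) :: (int ^ 'v graph, 'k::field) mpoly set) \<and>
         (\<forall>A1 A2. block_pair G A1 A2 \<longrightarrow>
           initial_term r (block_binomial A1 A2 :: (int ^ 'v graph, 'k) mpoly)
             = mvar (inc A1) * mvar (inc A2)) \<and>
         (\<exists>T. regular_triangulation T (CBP G) \<and> unimodular (blocks G) T)"
proof -
  interpret connected_family "blocks G" "connected_families G" "\<lambda>H K. verts H \<inter> verts K \<noteq> {}"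
    by (rule connected_family_blocks[OF assms(1,2)])
  interpret ordered_block_family "blocks G" "connected_families G"
      "\<lambda>H K. verts H \<inter> verts K \<noteq> {}" r
    by unfold_locales (fact assms)+
  have CBP: "CBP G = polytope_of (connected_families G)"
    unfolding CBP_def chi_def[abs_def] by (rule arg_cong[where f = "\<lambda>A. convex hull A"]) auto
  have pair: "block_pair G A B \<longleftrightarrow>
      A \<in> connected_families G \<and> B \<in> connected_families G \<and> incompatible A B" for A B
    by (auto simp: block_pair_def incompatible_def)
  \<comment> \<open>The lattice points of the polytope are exactly the incidence vectors indexing
    the variables, so both ideals live in the same polynomial ring.\<close>
  have "toric_ideal (CBP G) = (toric :: (int ^ 'v graph, 'k) mpoly set)"
    by (simp add: toric_ideal_def toric_def CBP lattice_points_polytope)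
  moreover have "{block_binomial A1 A2 | A1 A2. block_pair G A1 A2}
      = (binomials :: (int ^ 'v graph, 'k) mpoly set)"
    by (simp add: binomials_def pair)
  ultimately show ?thesis
    using groebner_basis_binomials[where 'k = 'k] initial_term_binomial[where 'k = 'k]
      regular_triangulation_simplices unimodular_simplices
    by (auto simp: pair CBP)
qed

end
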